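(* Let $n\ge1$. The nilCoxeter basis $\{\psi_w\}_{w\in S_n}$ of $\mathrm{NH}_n$ over $R_n=\mathbb{Z}[x_1,\dots,x_n]$ (as a left, or as a right, $R_n$-module) is a downfree basis, with partial order given by the Bruhat order on $S_n$.
   Context: The nilHecke algebra $\mathrm{NH}_n$ is the graded $\mathbb{Z}$-algebra generated by $x_1,\dots,x_n$ (degree $2$) and $\partial_1,\dots,\partial_{n-1}$ (degree $-2$) with relations: the $x_i$ commute; $\partial_i^2=0$; $\partial_i\partial_{i+1}\partial_i=\partial_{i+1}\partial_i\partial_{i+1}$; $\partial_i\partial_j=\partial_j\partial_i$ for $|i-j|>1$; $x_j\partial_i=\partial_ix_j$ for $j\neq i,i+1$; $x_i\partial_i-\partial_ix_{i+1}=1=\partial_ix_i-x_{i+1}\partial_i$. For $w\in S_n$ with reduced expression $w=s_{k_1}\cdots s_{k_\ell}$, $\psi_w=\partial_{k_1}\cdots\partial_{k_\ell}$ (independent of the reduced expression); $\{\psi_w\}$ is a basis of $\mathrm{NH}_n$ as a left or right $R_n$-module. $\mathfrak{sl}_2$ acts on $\mathrm{NH}_n$ by derivations with $\mathbf{d}(x_i)=x_i^2$, $\mathbf{d}(\partial_i)=-x_i\partial_i-\partial_ix_{i+1}$, $\mathbf{z}(x_i)=1$, $\mathbf{z}(\partial_i)=0$, $\mathbf{h}(f)=\deg(f)f$; $(\mathbf{d},\mathbf{h},-\mathbf{z})$ is the $\mathfrak{sl}_2$-triple. It restricts to the standard action on $R_n$: $\mathbf{d}=\sum_ix_i^2\frac{\partial}{\partial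 x_i}$, $\mathbf{z}=\sum_i\frac{\partial}{\partial x_i}$. An $(R_n,\mathfrak{sl}_2)$-module is an $R_n$-module $M$ with an $\mathfrak{sl}_2$-action satisfying the Leibniz rule $\mathbf{x}(rm)=\mathbf{x}(r)m+r\mathbf{x}(m)$ for $\mathbf{x}\in\{\mathbf{d},\mathbf{h},\mathbf{z}\}$. Let $M$ be an $(R_n,\mathfrak{sl}_2)$-module which is free and finitely generated as a graded $R_n$-module. A downfree filtration on $M$ is a splitting $M=\bigoplus_{i\in I}M_i$ as graded $R_n$-modules, with each $M_i$ free of rank one and $I$ finite, such that (1) each $M_i$ is preserved by $\mathbf{z}$; (2) $I$ can be equipped with a partial order so that $\mathbf{d}(M_i)\subset\bigoplus_{j\le i}M_j$ for all $i\in I$. A homogeneous $R_n$-basis of $M$ is downfree (with a given partial order) if the rank one submodules spanned by its elements form a downfree filtration (with that order). *)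

theory Defs
  imports
    "HOL-Library.Poly_Mapping"
    "HOL-Combinatorics.Permutations"
    "HOL-Algebra.QuotRing"
    "HOL-Algebra.Module"
begin

section \<open>The polynomial ring $R_n$ and its $\mathfrak{sl}_2$-action\<close>

text \<open>
  Polynomials are finitely supported maps from exponent vectors to integers, multiplied by
  convolution. The variables of $R_n$ are indexed by $1, \dots, n$.
\<close>

type_synonym polyn = "(nat \<Rightarrow>\<^sub>0 nat) \<Rightarrow>\<^sub>0 int"

definition poly_ring :: "nat \<Rightarrow> polyn ring" where
  "poly_ring n =
    \<lparr>carrier = {p. \<forall>a\<in>Poly_Mapping.keys p. Poly_Mapping.keys a \<subseteq> {1..n}},
     mult = (*), one = 1, zero = 0, add = (+)\<rparr>"

definition pvar :: "nat \<Rightarrow> polyn" where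
  "pvar i = frag_of (Poly_Mapping.single i 1)"

text \<open>
  The function \<^const>\<open>frag_extend\<close> extends a map on the basis of monomials
  \<open>\<int>\<close>-linearly. In \<open>pdiff\<close>, if the exponent of the variable is \<open>0\<close>, then the truncated
  subtraction is harmless because the coefficient vanishes.
\<close>

definition pdiff :: "nat \<Rightarrow> polyn \<Rightarrow> polyn" where
  "pdiff i = frag_extend (\<lambda>a. Poly_Mapping.single (a - Poly_Mapping.single i 1)
                                 (int (Poly_Mapping.lookup a i)))"

definition exp_degree :: "(nat \<Rightarrow>\<^sub>0 nat) \<Rightarrow> int" where
  "exp_degree a = 2 * (\<Sum>i\<in>Poly_Mapping.keys a. int (Poly_Mapping.lookup a i))"

definition poly_d :: "nat \<Rightarrow> polyn \<Rightarrow> polyn" where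
  "poly_d n p = (\<Sum>i\<in>{1..n}. pvar i ^ 2 * pdiff i p)"

definition poly_z :: "nat \<Rightarrow> polyn \<Rightarrow> polyn" where
  "poly_z n p = (\<Sum>i\<in>{1..n}. pdiff i p)"

definition poly_h :: "polyn \<Rightarrow> polyn" where
  "poly_h = frag_extend (\<lambda>a. Poly_Mapping.single a (exp_degree a))"

definition poly_grading :: "nat \<Rightarrow> int \<Rightarrow> polyn set" where
  "poly_grading n k =
    {p \<in> carrier (poly_ring n). \<forall>a\<in>Poly_Mapping.keys p. exp_degree a = k}"

section \<open>Graded $(R_n, \mathfrak{sl}_2)$-modules\<close>

record ('a, 'b) sl2_module = "('a, 'b) module" +
  act_d :: "'b \<Rightarrow> 'b"
  act_h :: "'b \<Rightarrow> 'b"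
  act_z :: "'b \<Rightarrow> 'b"
  grading :: "int \<Rightarrow> 'b set"

text \<open>
  Internal direct sum of a possibly infinite family of subsets (in practice, additive subgroups):
  every element is a sum of a unique finitely supported family.
\<close>

definition direct_sum_decomp ::
    "('b, 'c) ring_scheme \<Rightarrow> 'i set \<Rightarrow> ('i \<Rightarrow> 'b set) \<Rightarrow> bool" where
  "direct_sum_decomp M I N \<longleftrightarrow>
    (\<forall>m\<in>carrier M. \<exists>!f. f \<in> (\<Pi>\<^sub>E i\<in>I. N i) \<and> finite {i\<in>I. f i \<noteq> \<zero>\<^bsub>M\<^esub>} \<and>
       m = (\<Oplus>\<^bsub>M\<^esub>i\<in>{i\<in>I. f i \<noteq> \<zero>\<^bsub>M\<^esub>}. f i))"

definition sum_of_family ::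
    "('b, 'c) ring_scheme \<Rightarrow> 'i set \<Rightarrow> ('i \<Rightarrow> 'b set) \<Rightarrow> 'b set" where
  "sum_of_family M J N = {\<Oplus>\<^bsub>M\<^esub>j\<in>J. f j | f. f \<in> (\<Pi> j\<in>J. N j)}"

text \<open>
  The triple of $\mathfrak{sl}_2$ is $(e, h, f) = (\mathbf{d}, \mathbf{h}, -\mathbf{z})$, so
  that $[h,e]=2e$, $[h,f]=-2f$ and $[e,f]=h$ become the three commutator axioms below.
\<close>

locale graded_sl2_module = module "poly_ring n" M
  for n :: nat and M :: "(polyn, 'b, 'c) sl2_module_scheme" (structure) +
  assumes grading_subgroup: "subgroup (grading M k) (add_monoid M)"
    and grading_decomp: "direct_sum_decomp M (UNIV :: int set) (grading M)"
    and grading_smult: "\<lbrakk>r \<in> poly_grading n j; m \<in> grading M k\<rbrakk> \<Longrightarrow> r \<odot>\<^bsub>M\<^esub> m \<in> grading M (j + k)"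
    and d_hom: "act_d M \<in> hom (add_monoid M) (add_monoid M)"
    and h_hom: "act_h M \<in> hom (add_monoid M) (add_monoid M)"
    and z_hom: "act_z M \<in> hom (add_monoid M) (add_monoid M)"
    and comm_hd: "m \<in> carrier M \<Longrightarrow>
      act_h M (act_d M m) \<ominus>\<^bsub>M\<^esub> act_d M (act_h M m) = [(2::int)] \<cdot>\<^bsub>M\<^esub> act_d M m"
    and comm_hz: "m \<in> carrier M \<Longrightarrow>
      act_h M (act_z M m) \<ominus>\<^bsub>M\<^esub> act_z M (act_h M m) = [(-2::int)] \<cdot>\<^bsub>M\<^esub> act_z M m"
    and comm_zd: "m \<in> carrier M \<Longrightarrow>
      act_z M (act_d M m) \<ominus>\<^bsub>M\<^esub> act_d M (act_z M m) = act_h M m"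
    and leibniz_d: "\<lbrakk>r \<in> carrier (poly_ring n); m \<in> carrier M\<rbrakk> \<Longrightarrow>
      act_d M (r \<odot>\<^bsub>M\<^esub> m) = poly_d n r \<odot>\<^bsub>M\<^esub> m \<oplus>\<^bsub>M\<^esub> r \<odot>\<^bsub>M\<^esub> act_d M m"
    and leibniz_h: "\<lbrakk>r \<in> carrier (poly_ring n); m \<in> carrier M\<rbrakk> \<Longrightarrow>
      act_h M (r \<odot>\<^bsub>M\<^esub> m) = poly_h r \<odot>\<^bsub>M\<^esub> m \<oplus>\<^bsub>M\<^esub> r \<odot>\<^bsub>M\<^esub> act_h M m"
    and leibniz_z: "\<lbrakk>r \<in> carrier (poly_ring n); m \<in> carrier M\<rbrakk> \<Longrightarrow>
      act_z M (r \<odot>\<^bsub>M\<^esub> m) = poly_z n r \<odot>\<^bsub>M\<^esub> m \<oplus>\<^bsub>M\<^esub> r \<odot>\<^bsub>M\<^esub> act_z M m"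

definition homogeneous :: "('a, 'b, 'c) sl2_module_scheme \<Rightarrow> 'b \<Rightarrow> bool" where
  "homogeneous M m \<longleftrightarrow> (\<exists>k. m \<in> grading M k)"

definition rank_one_span :: "nat \<Rightarrow> (polyn, 'b, 'c) sl2_module_scheme \<Rightarrow> 'b \<Rightarrow> 'b set" where
  "rank_one_span n M b = (\<lambda>r. r \<odot>\<^bsub>M\<^esub> b) ` carrier (poly_ring n)"

definition graded_free_rank_one ::
    "nat \<Rightarrow> (polyn, 'b, 'c) sl2_module_scheme \<Rightarrow> 'b set \<Rightarrow> bool" where
  "graded_free_rank_one n M N \<longleftrightarrow>
    (\<exists>b\<in>carrier M. homogeneous M b \<and> N = rank_one_span n M b \<and>
       inj_on (\<lambda>r. r \<odot>\<^bsub>M\<^esub> b) (carrier (poly_ring n)))"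

section \<open>Downfree filtrations and downfree bases\<close>

text \<open>
  The splitting exhibits \<open>M\<close> as a finitely generated graded free module, so this is not required
  separately. The pair \<open>(j, i) \<in> leq\<close> stands for $j \le i$.
\<close>

locale downfree_filtration_wrt = graded_sl2_module n M
  for n :: nat and M :: "(polyn, 'b, 'c) sl2_module_scheme" (structure) +
  fixes I :: "'i set" and N :: "'i \<Rightarrow> 'b set" and leq :: "'i rel"
  assumes finite_index: "finite I"
    and rank_one: "i \<in> I \<Longrightarrow> graded_free_rank_one n M (N i)"
    and splitting: "direct_sum_decomp M I N"
    and z_preserves: "i \<in> I \<Longrightarrow> act_z M ` N i \<subseteq> N i"
    and order: "partial_order_on I leq"
    and d_lowers: "i \<in> I \<Longrightarrow> act_d M ` N i \<subseteq> sum_of_family M {j\<in>I. (j, i) \<in> leq} N"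

definition downfree_filtration ::
    "nat \<Rightarrow> (polyn, 'b, 'c) sl2_module_scheme \<Rightarrow> 'i set \<Rightarrow> ('i \<Rightarrow> 'b set) \<Rightarrow> bool" where
  "downfree_filtration n M I N \<longleftrightarrow> (\<exists>leq. downfree_filtration_wrt n M I N leq)"

definition homogeneous_basis ::
    "nat \<Rightarrow> (polyn, 'b, 'c) sl2_module_scheme \<Rightarrow> 'i set \<Rightarrow> ('i \<Rightarrow> 'b) \<Rightarrow> bool" where
  "homogeneous_basis n M I b \<longleftrightarrow> finite I \<and>
    (\<forall>i\<in>I. b i \<in> carrier M \<and> homogeneous M (b i)) \<and>
    (\<forall>m\<in>carrier M. \<exists>!c. c \<in> (\<Pi>\<^sub>E i\<in>I. carrier (poly_ring n)) \<and>
       m = (\<Oplus>\<^bsub>M\<^esub>i\<in>I. c i \<odot>\<^bsub>M\<^esub> b i))"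

definition downfree_basis ::
    "nat \<Rightarrow> (polyn, 'b, 'c) sl2_module_scheme \<Rightarrow> 'i set \<Rightarrow> ('i \<Rightarrow> 'b) \<Rightarrow> 'i rel \<Rightarrow> bool" where
  "downfree_basis n M I b leq \<longleftrightarrow>
    homogeneous_basis n M I b \<and>
    downfree_filtration_wrt n M I (\<lambda>i. rank_one_span n M (b i)) leq"

section \<open>The free ring on the nilHecke generators\<close>

datatype nh_gen = X nat | D nat

text \<open>The free monoid, written additively so that \<open>\<Rightarrow>\<^sub>0\<close> provides its monoid ring.\<close>

datatype nh_word = Word (letters: "nh_gen list")

instantiation nh_word :: monoid_add
begin

definition zero_nh_word :: nh_word where
  "zero_nh_word = Word []"

definition plus_nh_word :: "nh_word \<Rightarrow> nh_word \<Rightarrow> nh_word" where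
  "plus_nh_word u v = Word (letters u @ letters v)"

instance
  by standard (simp_all add: zero_nh_word_def plus_nh_word_def)

end

type_synonym free_nh = "nh_word \<Rightarrow>\<^sub>0 int"

definition nh_gens :: "nat \<Rightarrow> nh_gen set" where
  "nh_gens n = X ` {1..n} \<union> D ` {1..<n}"

definition free_nh_ring :: "nat \<Rightarrow> free_nh ring" where
  "free_nh_ring n =
    \<lparr>carrier = {p. \<forall>w\<in>Poly_Mapping.keys p. set (letters w) \<subseteq> nh_gens n},
     mult = (*), one = 1, zero = 0, add = (+)\<rparr>"

definition word_mon :: "nh_gen list \<Rightarrow> free_nh" where
  "word_mon gs = frag_of (Word gs)"

abbreviation xg :: "nat \<Rightarrow> free_nh" where "xg i \<equiv> word_mon [X i]"
abbreviation dg :: "nat \<Rightarrow> free_nh" where "dg i \<equiv> word_mon [D i]"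

fun gen_degree :: "nh_gen \<Rightarrow> int" where
  "gen_degree (X i) = 2"
| "gen_degree (D i) = - 2"

definition word_degree :: "nh_word \<Rightarrow> int" where
  "word_degree w = (\<Sum>g\<leftarrow>letters w. gen_degree g)"

text \<open>The derivation of the free ring with prescribed values on the generators.\<close>

fun word_der :: "(nh_gen \<Rightarrow> free_nh) \<Rightarrow> nh_gen list \<Rightarrow> free_nh" where
  "word_der \<delta> [] = 0"
| "word_der \<delta> (g # gs) = \<delta> g * word_mon gs + word_mon [g] * word_der \<delta> gs"

definition free_der :: "(nh_gen \<Rightarrow> free_nh) \<Rightarrow> free_nh \<Rightarrow> free_nh" where
  "free_der \<delta> = frag_extend (\<lambda>w. word_der \<delta> (letters w))"

fun d_gen :: "nh_gen \<Rightarrow> free_nh" where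
  "d_gen (X i) = xg i ^ 2"
| "d_gen (D i) = - (xg i * dg i) - dg i * xg (Suc i)"

fun z_gen :: "nh_gen \<Rightarrow> free_nh" where
  "z_gen (X i) = 1"
| "z_gen (D i) = 0"

definition free_h :: "free_nh \<Rightarrow> free_nh" where
  "free_h = frag_extend (\<lambda>w. Poly_Mapping.single w (word_degree w))"

section \<open>The nilHecke algebra\<close>

definition nh_rels :: "nat \<Rightarrow> free_nh set" where
  "nh_rels n =
     {xg i * xg j - xg j * xg i | i j. i \<in> {1..n} \<and> j \<in> {1..n}}
   \<union> {dg i * dg i | i. i \<in> {1..<n}}
   \<union> {dg i * dg (Suc i) * dg i - dg (Suc i) * dg i * dg (Suc i) | i.
        i \<in> {1..<n} \<and> Suc i \<in> {1..<n}}
   \<union> {dg i * dg j - dg j * dg i | i j.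
        i \<in> {1..<n} \<and> j \<in> {1..<n} \<and> \<bar>int i - int j\<bar> > 1}
   \<union> {xg j * dg i - dg i * xg j | i j.
        i \<in> {1..<n} \<and> j \<in> {1..n} \<and> j \<noteq> i \<and> j \<noteq> Suc i}
   \<union> {xg i * dg i - dg i * xg (Suc i) - 1 | i. i \<in> {1..<n}}
   \<union> {dg i * xg i - xg (Suc i) * dg i - 1 | i. i \<in> {1..<n}}"

definition nh_ideal :: "nat \<Rightarrow> free_nh set" where
  "nh_ideal n = Idl\<^bsub>free_nh_ring n\<^esub> (nh_rels n)"

definition NH :: "nat \<Rightarrow> free_nh set ring" where
  "NH n = free_nh_ring n Quot nh_ideal n"

definition nh_class :: "nat \<Rightarrow> free_nh \<Rightarrow> free_nh set" where
  "nh_class n p = nh_ideal n +>\<^bsub>free_nh_ring n\<^esub> p"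

text \<open>
  The operator on the quotient induced by an operator preserving the ideal; all members of the
  union coincide in that case.
\<close>

definition nh_induced :: "nat \<Rightarrow> (free_nh \<Rightarrow> free_nh) \<Rightarrow> free_nh set \<Rightarrow> free_nh set" where
  "nh_induced n \<phi> a = (\<Union>p\<in>a. nh_class n (\<phi> p))"

definition nh_d :: "nat \<Rightarrow> free_nh set \<Rightarrow> free_nh set" where
  "nh_d n = nh_induced n (free_der d_gen)"

definition nh_z :: "nat \<Rightarrow> free_nh set \<Rightarrow> free_nh set" where
  "nh_z n = nh_induced n (free_der z_gen)"

definition nh_h :: "nat \<Rightarrow> free_nh set \<Rightarrow> free_nh set" where
  "nh_h n = nh_induced n free_h"

definition nh_grading :: "nat \<Rightarrow> int \<Rightarrow> free_nh set set" where
  "nh_grading n k =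
    nh_class n ` {p \<in> carrier (free_nh_ring n). \<forall>w\<in>Poly_Mapping.keys p. word_degree w = k}"

text \<open>The ring homomorphism $R_n \to \mathrm{NH}_n$, sending $x^a$ to $x_1^{a_1} \cdots x_n^{a_n}$.\<close>

definition exp_word :: "nat \<Rightarrow> (nat \<Rightarrow>\<^sub>0 nat) \<Rightarrow> nh_gen list" where
  "exp_word n a = concat (map (\<lambda>i. replicate (Poly_Mapping.lookup a i) (X i)) [1..<Suc n])"

definition nh_of_poly :: "nat \<Rightarrow> polyn \<Rightarrow> free_nh set" where
  "nh_of_poly n p = nh_class n (frag_extend (\<lambda>a. word_mon (exp_word n a)) p)"

definition NH_left :: "nat \<Rightarrow> (polyn, free_nh set) sl2_module" where
  "NH_left n =
    \<lparr>carrier = carrier (NH n), mult = mult (NH n), one = one (NH n),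
     zero = zero (NH n), add = add (NH n),
     smult = (\<lambda>r m. nh_of_poly n r \<otimes>\<^bsub>NH n\<^esub> m),
     act_d = nh_d n, act_h = nh_h n, act_z = nh_z n, grading = nh_grading n\<rparr>"

definition NH_right :: "nat \<Rightarrow> (polyn, free_nh set) sl2_module" where
  "NH_right n =
    \<lparr>carrier = carrier (NH n), mult = mult (NH n), one = one (NH n),
     zero = zero (NH n), add = add (NH n),
     smult = (\<lambda>r m. m \<otimes>\<^bsub>NH n\<^esub> nh_of_poly n r),
     act_d = nh_d n, act_h = nh_h n, act_z = nh_z n, grading = nh_grading n\<rparr>"

section \<open>The symmetric group, Bruhat order and the nilCoxeter basis\<close>

definition symm_group :: "nat \<Rightarrow> (nat \<Rightarrow> nat) set" where
  "symm_group n = {w. w permutes {1..n}}"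

definition simple_prod :: "nat list \<Rightarrow> nat \<Rightarrow> nat" where
  "simple_prod ks = foldr (\<lambda>k w. transpose k (Suc k) \<circ> w) ks id"

definition expression :: "nat \<Rightarrow> (nat \<Rightarrow> nat) \<Rightarrow> nat list \<Rightarrow> bool" where
  "expression n w ks \<longleftrightarrow> set ks \<subseteq> {1..<n} \<and> simple_prod ks = w"

definition coxeter_length :: "nat \<Rightarrow> (nat \<Rightarrow> nat) \<Rightarrow> nat" where
  "coxeter_length n w = (LEAST l. \<exists>ks. expression n w ks \<and> length ks = l)"

definition reduced_expression :: "nat \<Rightarrow> (nat \<Rightarrow> nat) \<Rightarrow> nat list \<Rightarrow> bool" where
  "reduced_expression n w ks \<longleftrightarrow> expression n w ks \<and> length ks = coxeter_length n w"

text \<open>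
  The Bruhat order is generated by right multiplication by arbitrary (not only simple)
  transpositions that increase the length.
\<close>

definition bruhat_step :: "nat \<Rightarrow> (nat \<Rightarrow> nat) rel" where
  "bruhat_step n =
    {(u, u \<circ> transpose i j) | u i j. u \<in> symm_group n \<and> i \<in> {1..n} \<and> j \<in> {1..n} \<and>
       coxeter_length n u < coxeter_length n (u \<circ> transpose i j)}"

definition bruhat :: "nat \<Rightarrow> (nat \<Rightarrow> nat) rel" where
  "bruhat n = (bruhat_step n)\<^sup>* \<inter> symm_group n \<times> symm_group n"

text \<open>By the braid relations, the choice of the reduced expression is immaterial.\<close>

definition nh_psi :: "nat \<Rightarrow> (nat \<Rightarrow> nat) \<Rightarrow> free_nh set" where
  "nh_psi n w = nh_class n (word_mon (map D (SOME ks. reduced_expression n w ks)))"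

end

theory Submission
  imports Defs "HOL-Computational_Algebra.Fraction_Field"
begin

text \<open>
  Write \<open>\<psi>\<close> for the nilCoxeter basis and \<open>s k\<close> for the simple reflection \<open>sref k\<close>. Four facts carry
  the theorem.

  \<^item> The operators act on \<open>NH\<close>. The three derivations exist on the free algebra, where already the
    commutator identities of the triple hold, because both sides are derivations and agree on
    generators (\<open>commutator_hd\<close>, \<open>commutator_hz\<close>, \<open>commutator_zd\<close>). They descend because they map
    every defining relation into the ideal (\<open>free_d_nh_ideal\<close> and its companions); for the braid
    relation this rests on an explicit certificate, \<open>d_braid_identity\<close>.

  \<^item> The \<open>\<psi> w\<close> span. By the braid relations \<open>\<psi> w\<close> does not depend on the reduced word
    (\<open>reduced_words_nh_eq\<close>), so multiplication by a generator \<open>D k\<close> sends \<open>\<psi> w\<close> to \<open>\<psi> (s k w)\<close> or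
    to zero, as the length goes up or down (\<open>psi_side_refl\<close>, \<open>psi_side_refl_zero\<close>). A polynomial is
    moved past \<open>D k\<close> at the price of a polynomial summand (\<open>side_mult_dg_lift\<close>). Hence the span is
    closed under multiplication by all generators (\<open>psi_span_top\<close>).

  \<^item> The \<open>\<psi> w\<close> are independent. The algebra acts on functions on the orbit of a generic point, \<open>D k\<close>
    acting by the divided difference. There \<open>\<psi> w\<close> is a linear combination of translations by
    elements of smaller length and, with a nonzero coefficient, of the translation by \<open>w\<close>
    (\<open>psi_op_triangular\<close>). A relation among the \<open>\<psi> w\<close> is then refuted by applying it to the
    indicator function of one point (\<open>psi_independent\<close>).

  \<^item> The filtration. The operator \<open>z\<close> is zero on each \<open>\<psi> w\<close>, so it preserves the rank one pieces. For
    \<open>d\<close>, write \<open>\<psi> w\<close> as \<open>D k * \<psi> v\<close> with \<open>v\<close> shorter than \<open>w\<close>. Since \<open>d (D k)\<close> is a combination of \<open>D k\<close>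
    and \<open>1\<close> with polynomial coefficients (\<open>free_d_dg\<close>), the Leibniz rule and induction leave,
    besides multiples of \<open>\<psi> v\<close> and \<open>\<psi> w\<close>, products of \<open>D k\<close> with multiples of \<open>\<psi> u\<close> for \<open>u\<close> below \<open>v\<close>.
    These are controlled by the lifting property of the Bruhat
    order: \<open>s k u\<close> lies below \<open>s k v = w\<close> (\<open>bruhat_lifting\<close>, \<open>free_d_psi\<close>).

  Left and right modules are treated together. A Boolean selects the side: \<open>side_mult True\<close> is the
  product, \<open>side_mult False\<close> the opposite product, and \<open>side_refl\<close> multiplies a permutation by a simple
  reflection on the same side. Nearly all of the argument is insensitive to this choice.
\<close>

section \<open>Inversions and the length function\<close>

text \<open>
  The notation \<open>inv\<close> stands for the inverse in an algebraic structure.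
\<close>

abbreviation perm_inv :: "(nat \<Rightarrow> nat) \<Rightarrow> nat \<Rightarrow> nat" where
  "perm_inv \<equiv> inv_into UNIV"

abbreviation sref :: "nat \<Rightarrow> nat \<Rightarrow> nat" where
  "sref k \<equiv> transpose k (Suc k)"

definition inversion_set :: "nat \<Rightarrow> (nat \<Rightarrow> nat) \<Rightarrow> (nat \<times> nat) set" where
  "inversion_set n w = {(i, j). 1 \<le> i \<and> i < j \<and> j \<le> n \<and> w j < w i}"

definition inversions :: "nat \<Rightarrow> (nat \<Rightarrow> nat) \<Rightarrow> nat" where
  "inversions n w = card (inversion_set n w)"

lemma finite_inversion_set [simp]: "finite (inversion_set n w)"
  by (rule finite_subset[of _ "{1..n} \<times> {1..n}"]) (auto simp: inversion_set_def)

lemma symm_groupD: "w \<in> symm_group n \<Longrightarrow> w permutes {1..n}"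
  by (simp add: symm_group_def)

lemma sref_symm_group: "k \<in> {1..<n} \<Longrightarrow> sref k \<in> symm_group n"
  by (auto simp: symm_group_def intro!: permutes_swap_id)

lemma id_symm_group [simp]: "id \<in> symm_group n"
  by (simp add: symm_group_def permutes_id)

lemma comp_symm_group: "u \<in> symm_group n \<Longrightarrow> v \<in> symm_group n \<Longrightarrow> u \<circ> v \<in> symm_group n"
  by (simp add: symm_group_def permutes_compose)

lemma inv_symm_group: "u \<in> symm_group n \<Longrightarrow> perm_inv u \<in> symm_group n"
  by (simp add: symm_group_def permutes_inv)

lemma finite_symm_group [simp]: "finite (symm_group n)"
  by (simp add: symm_group_def finite_permutations)

lemma sref_involutive [simp]: "sref k \<circ> (sref k \<circ> w) = w" "(w \<circ> sref k) \<circ> sref k = w"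
  by (auto simp: fun_eq_iff transpose_def)

lemma inv_sref_comp: "w \<in> symm_group n \<Longrightarrow> perm_inv (sref k \<circ> w) = perm_inv w \<circ> sref k"
  by (simp add: o_inv_distrib permutes_bij[OF symm_groupD])

lemma inv_comp_sref: "w \<in> symm_group n \<Longrightarrow> perm_inv (w \<circ> sref k) = sref k \<circ> perm_inv w"
  by (simp add: o_inv_distrib permutes_bij[OF symm_groupD])

text \<open>
  Exchanging the values \<open>k\<close> and \<open>Suc k\<close> cannot change the relative order of two values unless they are
  these two, so exactly one pair of positions is affected.
\<close>

lemma inversion_set_sref_comp:
  assumes w: "w \<in> symm_group n" and k: "k \<in> {1..<n}" and lt: "perm_inv w k < perm_inv w (Suc k)"
  shows "inversion_set n (sref k \<circ> w) = insert (perm_inv w k, perm_inv w (Suc k)) (inversion_set n w)"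
    and "(perm_inv w k, perm_inv w (Suc k)) \<notin> inversion_set n w"
proof -
  have wp: "w permutes {1..n}" using w by (rule symm_groupD)
  define a b where "a = perm_inv w k" and "b = perm_inv w (Suc k)"
  have wa: "w a = k" "w b = Suc k"
    using permutes_inverses(1)[OF wp] by (auto simp: a_def b_def)
  have ab: "a \<in> {1..n}" "b \<in> {1..n}"
    using k permutes_in_image[OF permutes_inv[OF wp]] by (auto simp: a_def b_def)
  have abl: "a < b" using lt by (simp add: a_def b_def)
  have uniq: "w x = k \<longleftrightarrow> x = a" "w x = Suc k \<longleftrightarrow> x = b" for x
    using wa permutes_inj[OF wp] by (metis injD)+
  have inj: "w x = w y \<longleftrightarrow> x = y" for x y
    using permutes_inj[OF wp] by (auto dest: injD)
  have "(i, j) \<in> inversion_set n (sref k \<circ> w) \<longleftrightarrow> (i, j) \<in> insert (a, b) (inversion_set n w)" for i j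
    proof (cases "i < j")
      case True
      have "sref k (w j) < sref k (w i) \<longleftrightarrow> w j < w i \<or> (i = a \<and> j = b)"
      proof (cases "i = a \<and> j = b")
        case True
        then show ?thesis using wa by simp
      next
        case False
        then have "\<not> (w i = k \<and> w j = Suc k)" "\<not> (w j = k \<and> w i = Suc k)"
          using uniq abl True by auto
        moreover have "w i \<noteq> w j" using inj True by auto
        ultimately show ?thesis using False by (auto simp: transpose_def)
      qed
      then show ?thesis using ab True abl by (auto simp: inversion_set_def)
    qed (use abl in \<open>auto simp: inversion_set_def\<close>)
  then show "inversion_set n (sref k \<circ> w) = insert (perm_inv w k, perm_inv w (Suc k)) (inversion_set n w)"
    unfolding a_def[symmetric] b_def[symmetric] by (meson equalityI subrelI)
  show "(perm_inv w k, perm_inv w (Suc k)) \<notin> inversion_set n w"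
    using wa by (auto simp: inversion_set_def a_def b_def)
qed

lemma inversions_sref_comp_ascent:
  assumes "w \<in> symm_group n" "k \<in> {1..<n}" "perm_inv w k < perm_inv w (Suc k)"
  shows "inversions n (sref k \<circ> w) = Suc (inversions n w)"
  using inversion_set_sref_comp[OF assms] by (simp add: inversions_def)

lemma inversions_sref_comp_descent:
  assumes "w \<in> symm_group n" "k \<in> {1..<n}" "perm_inv w (Suc k) < perm_inv w k"
  shows "Suc (inversions n (sref k \<circ> w)) = inversions n w"
  using inversions_sref_comp_ascent[of "sref k \<circ> w" n k] assms
  by (simp add: comp_symm_group sref_symm_group inv_sref_comp)

lemma inv_neq_Suc: "w \<in> symm_group n \<Longrightarrow> perm_inv w k \<noteq> perm_inv w (Suc k)"
  using permutes_inj[OF permutes_inv[OF symm_groupD]] by (metis injD n_not_Suc_n)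

lemma inversions_sref_comp_less_iff:
  assumes "w \<in> symm_group n" "k \<in> {1..<n}"
  shows "inversions n w < inversions n (sref k \<circ> w) \<longleftrightarrow> perm_inv w k < perm_inv w (Suc k)"
  using inversions_sref_comp_ascent[OF assms] inversions_sref_comp_descent[OF assms]
    inv_neq_Suc[OF assms(1), of k] by (cases "perm_inv w k < perm_inv w (Suc k)") auto

lemma inversions_sref_comp_cases:
  assumes "w \<in> symm_group n" "k \<in> {1..<n}"
  shows "inversions n (sref k \<circ> w) = Suc (inversions n w)
    \<or> Suc (inversions n (sref k \<circ> w)) = inversions n w"
  using inversions_sref_comp_ascent[OF assms] inversions_sref_comp_descent[OF assms]
    inv_neq_Suc[OF assms(1), of k] by (meson nat_neq_iff)

text \<open>
  Without descents, \<open>i \<le> p i\<close> follows by going upwards from \<open>1\<close> and \<open>p i \<le> i\<close> by going downwards from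
  \<open>n\<close>.
\<close>

lemma permutation_no_descent_id:
  assumes p: "p permutes {1..n::nat}" and asc: "\<And>k. k \<in> {1..<n} \<Longrightarrow> p k < p (Suc k)"
  shows "p = id"
proof -
  have lower: "1 \<le> i \<Longrightarrow> i \<le> n \<Longrightarrow> i \<le> p i" for i
  proof (induction i rule: nat_induct_at_least)
    case base
    then show ?case using permutes_in_image[OF p, of 1] by auto
  next
    case (Suc i)
    then show ?case using asc[of i] by force
  qed
  have upper: "d < n \<Longrightarrow> p (n - d) \<le> n - d" for d
  proof (induction d)
    case 0
    then show ?case using permutes_in_image[OF p, of n] by auto
  next
    case (Suc d)
    have "p (n - Suc d) < p (n - d)"
      using asc[of "n - Suc d"] Suc.prems by (auto simp: Suc_diff_Suc)
    then show ?case using Suc by simp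
  qed
  have "p i = i" for i
  proof (cases "i \<in> {1..n}")
    case True
    then show ?thesis using lower[of i] upper[of "n - i"] by auto
  next
    case False
    then show ?thesis using p by (simp add: permutes_def)
  qed
  then show ?thesis by auto
qed

lemma ex_left_descent:
  assumes "w \<in> symm_group n" "w \<noteq> id"
  shows "\<exists>k\<in>{1..<n}. perm_inv w (Suc k) < perm_inv w k"
proof (rule ccontr)
  assume "\<not> ?thesis"
  then have "perm_inv w = id"
    using inv_neq_Suc[OF assms(1)]
    by (intro permutation_no_descent_id[of _ n] permutes_inv symm_groupD assms) (metis nat_neq_iff)
  then show False
    using assms by (metis inv_id inv_inv_eq permutes_bij symm_groupD)
qed

lemma inversions_id [simp]: "inversions n id = 0"
proof -
  have "inversion_set n id = {}" by (auto simp: inversion_set_def)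
  then show ?thesis by (simp add: inversions_def)
qed

lemma simple_prod_simps [simp]:
  "simple_prod [] = id" "simple_prod (k # ks) = sref k \<circ> simple_prod ks"
  by (simp_all add: simple_prod_def)

lemma simple_prod_append: "simple_prod (ks @ js) = simple_prod ks \<circ> simple_prod js"
  by (induction ks) (simp_all add: comp_assoc)

lemma simple_prod_symm_group: "set ks \<subseteq> {1..<n} \<Longrightarrow> simple_prod ks \<in> symm_group n"
  by (induction ks) (use sref_symm_group in \<open>auto intro!: comp_symm_group\<close>)

lemma inversions_simple_prod_le: "set ks \<subseteq> {1..<n} \<Longrightarrow> inversions n (simple_prod ks) \<le> length ks"
proof (induction ks)
  case (Cons k ks)
  then have "simple_prod ks \<in> symm_group n" "k \<in> {1..<n}" "inversions n (simple_prod ks) \<le> length ks"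
    using simple_prod_symm_group by auto
  then show ?case
    using inversions_sref_comp_cases[of "simple_prod ks" n k]
    unfolding simple_prod_simps list.size by linarith
qed simp

lemma ex_expression_inversions:
  "w \<in> symm_group n \<Longrightarrow> \<exists>ks. expression n w ks \<and> length ks = inversions n w"
proof (induction "inversions n w" arbitrary: w rule: less_induct)
  case less
  show ?case
  proof (cases "w = id")
    case True
    then show ?thesis by (auto simp: expression_def intro!: exI[of _ "[]"])
  next
    case False
    then obtain k where k: "k \<in> {1..<n}" "perm_inv w (Suc k) < perm_inv w k"
      using ex_left_descent less.prems by blast
    let ?v = "sref k \<circ> w"
    have v: "?v \<in> symm_group n" "Suc (inversions n ?v) = inversions n w"
      using k less.prems by (auto simp: comp_symm_group sref_symm_group inversions_sref_comp_descent)
    then obtain ks where "expression n ?v ks" "length ks = inversions n ?v"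
      using less.hyps[of ?v] by auto
    then show ?thesis using v(2) k(1)
      by (intro exI[of _ "k # ks"]) (auto simp: expression_def)
  qed
qed

text \<open>
  A simple reflection changes the number of inversions by one, so an expression has at least as many
  letters as its value has inversions. Removing left descents one by one attains this bound.
\<close>

lemma coxeter_length_inversions:
  assumes "w \<in> symm_group n"
  shows "coxeter_length n w = inversions n w"
  unfolding coxeter_length_def
proof (rule Least_equality)
  show "\<exists>ks. expression n w ks \<and> length ks = inversions n w"
    using ex_expression_inversions[OF assms] .
  show "inversions n w \<le> l" if "\<exists>ks. expression n w ks \<and> length ks = l" for l
    using that inversions_simple_prod_le by (auto simp: expression_def)
qed

lemma reduced_expression_iff:
  assumes "w \<in> symm_group n"
  shows "reduced_expression n w ks \<longleftrightarrow>
    set ks \<subseteq> {1..<n} \<and> simple_prod ks = w \<and> length ks = inversions n w"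
  by (simp add: reduced_expression_def expression_def coxeter_length_inversions[OF assms])

lemma ex_reduced_expression: "w \<in> symm_group n \<Longrightarrow> \<exists>ks. reduced_expression n w ks"
  using ex_expression_inversions[of w n] by (auto simp: coxeter_length_inversions reduced_expression_def)

text \<open>
  If the first letter were not a descent, the tail would have fewer letters than the element it
  expresses has inversions.
\<close>

lemma reduced_expression_Cons:
  assumes "w \<in> symm_group n" "reduced_expression n w (k # ks)"
  shows "k \<in> {1..<n}" "reduced_expression n (sref k \<circ> w) ks" "perm_inv w (Suc k) < perm_inv w k"
proof -
  have r: "k \<in> {1..<n}" "set ks \<subseteq> {1..<n}" "w = sref k \<circ> simple_prod ks"
      "Suc (length ks) = inversions n w"
    using assms(2) unfolding reduced_expression_iff[OF assms(1)] by auto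
  have v: "simple_prod ks = sref k \<circ> w" "sref k \<circ> w \<in> symm_group n"
    using comp_symm_group[OF sref_symm_group[OF r(1)] assms(1)] unfolding r(3) by simp_all
  have le: "inversions n (sref k \<circ> w) \<le> length ks"
    using inversions_simple_prod_le[OF r(2)] v by simp
  then have "\<not> inversions n w < inversions n (sref k \<circ> w)" using r(4) by simp
  then show desc: "perm_inv w (Suc k) < perm_inv w k"
    using inversions_sref_comp_less_iff[OF assms(1) r(1)] inv_neq_Suc[OF assms(1), of k] by simp
  show "k \<in> {1..<n}" by (fact r)
  show "reduced_expression n (sref k \<circ> w) ks"
    using inversions_sref_comp_descent[OF assms(1) r(1) desc] r(2,4) v(1)
    unfolding reduced_expression_iff[OF v(2)] by linarith
qed

lemma reduced_expression_ConsI: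
  assumes "w \<in> symm_group n" "k \<in> {1..<n}" "perm_inv w (Suc k) < perm_inv w k"
    "reduced_expression n (sref k \<circ> w) ks"
  shows "reduced_expression n w (k # ks)"
  using assms(2,4) inversions_sref_comp_descent[OF assms(1-3)]
  by (simp add: reduced_expression_iff[OF assms(1)]
      reduced_expression_iff[OF comp_symm_group[OF sref_symm_group[OF assms(2)] assms(1)]])

text \<open>
  The inversions of \<open>w\<close> and of its inverse correspond under \<open>(i, j) \<mapsto> (w j, w i)\<close>.
\<close>

lemma inversions_inv:
  assumes "w \<in> symm_group n"
  shows "inversions n (perm_inv w) = inversions n w"
proof -
  have wp: "w permutes {1..n}" using assms by (rule symm_groupD)
  have le: "inversions n u \<le> inversions n (perm_inv u)" if u: "u permutes {1..n}" for u
    unfolding inversions_def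
  proof (rule card_inj_on_le[where f = "\<lambda>(i, j). (u j, u i)"])
    show "inj_on (\<lambda>(i, j). (u j, u i)) (inversion_set n u)"
      using permutes_inj[OF u] by (auto intro!: inj_onI dest: injD)
    show "(\<lambda>(i, j). (u j, u i)) ` inversion_set n u \<subseteq> inversion_set n (perm_inv u)"
      using permutes_in_image[OF u] permutes_inverses(2)[OF u]
      by (fastforce simp: inversion_set_def)
  qed simp
  show ?thesis using le[OF wp] le[OF permutes_inv[OF wp]] by (simp add: permutes_inv_inv[OF wp])
qed

lemma inversions_comp_sref_less_iff:
  assumes w: "w \<in> symm_group n" and k: "k \<in> {1..<n}"
  shows "inversions n w < inversions n (w \<circ> sref k) \<longleftrightarrow> w k < w (Suc k)"
  using inversions_sref_comp_less_iff[OF inv_symm_group[OF w] k] inversions_inv[OF w]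
    inversions_inv[of "w \<circ> sref k" n] w k
  by (simp add: comp_symm_group sref_symm_group inv_comp_sref permutes_inv_inv[OF symm_groupD])

lemma inversions_comp_sref_cases:
  assumes w: "w \<in> symm_group n" and k: "k \<in> {1..<n}"
  shows "inversions n (w \<circ> sref k) = Suc (inversions n w)
    \<or> Suc (inversions n (w \<circ> sref k)) = inversions n w"
  using inversions_sref_comp_cases[OF inv_symm_group[OF w] k] inversions_inv[OF w]
    inversions_inv[of "w \<circ> sref k" n] w k
  by (simp add: comp_symm_group sref_symm_group inv_comp_sref)

text \<open>
  Most inversions \<open>(a, b)\<close> of \<open>u\<close> are carried along by the transposition. Where this would reverse the
  order of the two positions, one of them is \<open>i\<close> or \<open>j\<close> and the other lies strictly between; such a
  pair is an inversion before and after and is left in place. The inversion \<open>(i, j)\<close> of the new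
  permutation is not reached.
\<close>

lemma inversions_transpose_less:
  assumes u: "u \<in> symm_group n" and ij: "i \<in> {1..n}" "j \<in> {1..n}" "i < j" "u i < u j"
  shows "inversions n u < inversions n (u \<circ> transpose i j)"
proof -
  let ?t = "transpose i j"
  define f where "f = (\<lambda>(a, b). if ?t a < ?t b then (?t a, ?t b) else (a, b))"
  \<comment> \<open>the two branches of \<open>f\<close> have disjoint images: applying the transposition restores or reverses the order\<close>
  have inj: "inj_on f (inversion_set n u)"
  proof (rule inj_onI)
    fix x y assume xy: "x \<in> inversion_set n u" "y \<in> inversion_set n u" "f x = f y"
    obtain a b c d where [simp]: "x = (a, b)" "y = (c, d)" by (cases x, cases y)
    have "a < b" "c < d" using xy by (auto simp: inversion_set_def)
    moreover have "(if ?t a < ?t b then (?t a, ?t b) else (a, b)) =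
        (if ?t c < ?t d then (?t c, ?t d) else (c, d))"
      using xy(3) by (simp add: f_def)
    ultimately have "a = c \<and> b = d"
      by (metis prod.inject transpose_involutory)
    then show "x = y" by simp
  qed
  have sub: "f ` inversion_set n u \<subseteq> inversion_set n (u \<circ> ?t) - {(i, j)}"
  proof (rule image_subsetI)
    fix p assume "p \<in> inversion_set n u"
    moreover obtain a b where p: "p = (a, b)" by (cases p)
    ultimately have ab: "1 \<le> a" "a < b" "b \<le> n" "u b < u a" by (auto simp: inversion_set_def)
    show "f p \<in> inversion_set n (u \<circ> ?t) - {(i, j)}"
    proof (cases "?t a < ?t b")
      case True
      moreover have "1 \<le> ?t a" "?t b \<le> n" using ab ij by (auto simp: transpose_def)
      moreover have "(?t a, ?t b) \<noteq> (i, j)"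
        using ab(2) ij(3) by (metis less_asym prod.inject transpose_apply_first transpose_apply_second transpose_involutory)
      ultimately show ?thesis using ab by (simp add: p f_def inversion_set_def)
    next
      case False
      then consider "a = i" "b < j" | "b = j" "i < a" | "a = i" "b = j"
        using ab(2) ij(3) by (cases "a = i"; cases "b = j") (auto simp: transpose_def split: if_splits)
      then show ?thesis
        using False ab ij by cases (auto simp: p f_def inversion_set_def transpose_def)
    qed
  qed
  have mem: "(i, j) \<in> inversion_set n (u \<circ> ?t)"
    using ij by (auto simp: inversion_set_def)
  have "inversions n u \<le> card (inversion_set n (u \<circ> ?t) - {(i, j)})"
    unfolding inversions_def by (rule card_inj_on_le[OF inj sub]) simp
  also have "\<dots> < inversions n (u \<circ> ?t)"
    unfolding inversions_def using mem by (intro psubset_card_mono) auto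
  finally show ?thesis .
qed

section \<open>The Bruhat order and its lifting property\<close>

text \<open>
  The comparison of lengths becomes a comparison of two values. In this form the effect of multiplying
  by a simple reflection on either side can be read off.
\<close>

lemma bruhat_step_iff:
  "(u, v) \<in> bruhat_step n \<longleftrightarrow>
    u \<in> symm_group n \<and> (\<exists>i\<in>{1..n}. \<exists>j\<in>{1..n}. i < j \<and> u i < u j \<and> v = u \<circ> transpose i j)"
proof
  assume "(u, v) \<in> bruhat_step n"
  then obtain i j where u: "u \<in> symm_group n" and ij: "i \<in> {1..n}" "j \<in> {1..n}"
    and v: "v = u \<circ> transpose i j" and lt: "coxeter_length n u < coxeter_length n v"
    by (auto simp: bruhat_step_def)
  have vS: "v \<in> symm_group n"
    using u ij v by (auto simp: symm_group_def intro!: permutes_compose permutes_swap_id)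
  have less: "inversions n u < inversions n v"
    using lt by (simp add: coxeter_length_inversions u vS)
  have key: "u a < u b" if ab: "a \<in> {1..n}" "b \<in> {1..n}" "a < b" "v = u \<circ> transpose a b" for a b
  proof (rule ccontr)
    assume "\<not> u a < u b"
    moreover have "u a \<noteq> u b"
      using permutes_inj[OF symm_groupD[OF u]] ab(3) by (auto dest: injD)
    ultimately have "v a < v b" using ab(4) by simp
    then have "inversions n v < inversions n (v \<circ> transpose a b)"
      using inversions_transpose_less[OF vS ab(1-3)] by simp
    moreover have "v \<circ> transpose a b = u" using ab(4) by (auto simp: fun_eq_iff)
    ultimately show False using less by simp
  qed
  have "i \<noteq> j" using less v by auto
  then consider "i < j" | "j < i" by linarith
  then show "u \<in> symm_group n \<and>
      (\<exists>i\<in>{1..n}. \<exists>j\<in>{1..n}. i < j \<and> u i < u j \<and> v = u \<circ> transpose i j)"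
  proof cases
    case 1
    then show ?thesis using key[OF ij 1 v] u ij v by blast
  next
    case 2
    moreover have "v = u \<circ> transpose j i" using v by (simp add: transpose_commute)
    ultimately show ?thesis using key[OF ij(2) ij(1)] u ij by blast
  qed
next
  assume "u \<in> symm_group n \<and>
    (\<exists>i\<in>{1..n}. \<exists>j\<in>{1..n}. i < j \<and> u i < u j \<and> v = u \<circ> transpose i j)"
  then obtain i j where u: "u \<in> symm_group n" and ij: "i \<in> {1..n}" "j \<in> {1..n}" "i < j" "u i < u j"
    and v: "v = u \<circ> transpose i j" by blast
  have vS: "v \<in> symm_group n"
    using u ij v by (auto simp: symm_group_def intro!: permutes_compose permutes_swap_id)
  have "coxeter_length n u < coxeter_length n v"
    using inversions_transpose_less[OF u ij]
    unfolding coxeter_length_inversions[OF u] coxeter_length_inversions[OF vS] v[symmetric] .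
  then show "(u, v) \<in> bruhat_step n"
    using u ij v unfolding bruhat_step_def mem_Collect_eq by blast
qed

lemma bruhat_step_symm_group:
  "(u, v) \<in> bruhat_step n \<Longrightarrow> u \<in> symm_group n" "(u, v) \<in> bruhat_step n \<Longrightarrow> v \<in> symm_group n"
  by (auto simp: bruhat_step_iff symm_group_def intro!: permutes_compose permutes_swap_id)

lemma bruhat_step_inversions: "(u, v) \<in> bruhat_step n \<Longrightarrow> inversions n u < inversions n v"
  using inversions_transpose_less by (auto simp: bruhat_step_iff)

lemma bruhat_refl: "u \<in> symm_group n \<Longrightarrow> (u, u) \<in> bruhat n"
  by (simp add: bruhat_def)

lemma bruhat_trans: "(u, v) \<in> bruhat n \<Longrightarrow> (v, w) \<in> bruhat n \<Longrightarrow> (u, w) \<in> bruhat n"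
  by (auto simp: bruhat_def)

lemma bruhat_stepI: "(u, v) \<in> bruhat_step n \<Longrightarrow> (u, v) \<in> bruhat n"
  using bruhat_step_symm_group by (auto simp: bruhat_def)

lemma bruhat_symm_group: "(u, v) \<in> bruhat n \<Longrightarrow> u \<in> symm_group n \<and> v \<in> symm_group n"
  by (auto simp: bruhat_def)

lemma rtrancl_bruhat_step_inversions:
  "(u, v) \<in> (bruhat_step n)\<^sup>* \<Longrightarrow> u = v \<or> inversions n u < inversions n v"
  by (induction rule: rtrancl_induct) (auto dest: bruhat_step_inversions)

lemma partial_order_on_bruhat: "partial_order_on (symm_group n) (bruhat n)"
  unfolding partial_order_on_def preorder_on_def
proof (intro conjI)
  show "bruhat n \<subseteq> symm_group n \<times> symm_group n" by (auto simp: bruhat_def)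
  show "refl_on (symm_group n) (bruhat n)" by (auto simp: refl_on_def bruhat_refl)
  show "trans (bruhat n)" by (auto intro: transI bruhat_trans)
  show "antisym (bruhat n)"
    by (rule antisymI) (auto simp: bruhat_def dest!: rtrancl_bruhat_step_inversions)
qed

lemma sref_less_iff: "(a::nat) \<noteq> b \<Longrightarrow> {a, b} \<noteq> {k, Suc k} \<Longrightarrow> sref k a < sref k b \<longleftrightarrow> a < b"
  by (auto simp: transpose_def)

text \<open>
  Left multiplication by \<open>sref k\<close> preserves the order of the two compared values unless they are \<open>k\<close> and
  \<open>Suc k\<close>; in that case the step from \<open>u\<close> to \<open>v\<close> is itself left multiplication by \<open>sref k\<close>.
\<close>

lemma bruhat_step_sref_comp:
  assumes k: "k \<in> {1..<n}" and st: "(u, v) \<in> bruhat_step n"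
  shows "sref k \<circ> u = v \<or> (sref k \<circ> u, sref k \<circ> v) \<in> bruhat_step n"
proof -
  obtain i j where u: "u \<in> symm_group n" and ij: "i \<in> {1..n}" "j \<in> {1..n}" "i < j" "u i < u j"
    and v: "v = u \<circ> transpose i j"
    using st by (auto simp: bruhat_step_iff)
  have inj: "u x = u y \<longleftrightarrow> x = y" for x y
    using permutes_inj[OF symm_groupD[OF u]] by (auto dest: injD)
  show ?thesis
  proof (cases "{u i, u j} = {k, Suc k}")
    case True
    then have ij': "u i = k" "u j = Suc k" using ij by (auto simp: doubleton_eq_iff)
    have "sref k (u x) = u (transpose i j x)" for x
      using ij' inj[of x i] inj[of x j] by (cases "x = i"; cases "x = j") (auto simp: transpose_def)
    then show ?thesis using v by (auto simp: fun_eq_iff)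
  next
    case False
    then have "sref k (u i) < sref k (u j)" using sref_less_iff[of "u i" "u j" k] ij by auto
    moreover have "sref k \<circ> u \<in> symm_group n" using u k by (simp add: comp_symm_group sref_symm_group)
    moreover have "sref k \<circ> v = (sref k \<circ> u) \<circ> transpose i j" by (simp add: v comp_assoc)
    ultimately have "(sref k \<circ> u, sref k \<circ> v) \<in> bruhat_step n"
      using ij(1-3) unfolding bruhat_step_iff comp_apply by blast
    then show ?thesis ..
  qed
qed

text \<open>
  Right multiplication by \<open>sref k\<close> conjugates the transposition of the step. This preserves the order of
  its two positions unless the transposition is \<open>sref k\<close>, and then it is the step itself.
\<close>

lemma bruhat_step_comp_sref:
  assumes k: "k \<in> {1..<n}" and st: "(u, v) \<in> bruhat_step n"
  shows "u \<circ> sref k = v \<or> (u \<circ> sref k, v \<circ> sref k) \<in> bruhat_step n"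
proof -
  obtain i j where u: "u \<in> symm_group n" and ij: "i \<in> {1..n}" "j \<in> {1..n}" "i < j" "u i < u j"
    and v: "v = u \<circ> transpose i j"
    using st by (auto simp: bruhat_step_iff)
  show ?thesis
  proof (cases "i = k \<and> j = Suc k")
    case True
    then show ?thesis using v by simp
  next
    case False
    let ?i = "sref k i" and ?j = "sref k j"
    have "?i < ?j" using False ij(3) by (auto simp: transpose_def)
    moreover have "?i \<in> {1..n}" "?j \<in> {1..n}"
      unfolding permutes_in_image[OF symm_groupD[OF sref_symm_group[OF k]]] by (fact ij)+
    moreover
    have "(v \<circ> sref k) x = (u \<circ> sref k \<circ> transpose ?i ?j) x" for x
    proof -
      have "transpose i j (sref k x) = sref k (transpose ?i ?j x)"
        by (metis transpose_apply_first transpose_apply_second transpose_apply_other transpose_involutory)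
      then show ?thesis by (simp add: v)
    qed
    then have "v \<circ> sref k = u \<circ> sref k \<circ> transpose ?i ?j" by (rule ext)
    moreover have "(u \<circ> sref k) ?i < (u \<circ> sref k) ?j" using ij(4) by simp
    moreover have "u \<circ> sref k \<in> symm_group n" using u k by (simp add: comp_symm_group sref_symm_group)
    ultimately have "(u \<circ> sref k, v \<circ> sref k) \<in> bruhat_step n"
      unfolding bruhat_step_iff by blast
    then show ?thesis ..
  qed
qed

text \<open>
  The lifting property, for multiplication \<open>f\<close> by a simple reflection on either side. Go down a chain
  from \<open>w\<close> to \<open>v\<close>. A step from \<open>u\<close> to \<open>v'\<close> is carried by \<open>f\<close> to a step, unless it is \<open>f\<close> itself; then
  \<open>f u = v'\<close>, which lies below \<open>w\<close> and so below \<open>f w\<close>.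
\<close>

lemma bruhat_lifting:
  assumes step: "\<And>u v. (u, v) \<in> bruhat_step n \<Longrightarrow> f u = v \<or> (f u, f v) \<in> bruhat_step n"
    and f: "\<And>u. u \<in> symm_group n \<Longrightarrow> f u \<in> symm_group n"
    and v: "(v, w) \<in> bruhat n" and up: "(w, f w) \<in> bruhat n"
  shows "(f v, f w) \<in> bruhat n"
proof -
  have "(v, w) \<in> (bruhat_step n)\<^sup>*" "w \<in> symm_group n" using v by (auto simp: bruhat_def)
  then show ?thesis using up
  proof (induction rule: converse_rtrancl_induct)
    case base
    then show ?case using f by (auto intro: bruhat_refl)
  next
    case (step u v')
    have "(v', w) \<in> bruhat n"
      using step.hyps step.prems bruhat_step_symm_group by (auto simp: bruhat_def)
    then have "(v', f w) \<in> bruhat n" using step.prems(2) bruhat_trans by blast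
    then show ?case
      using assms(1)[OF step.hyps(1)] step.IH[OF step.prems] by (auto intro: bruhat_trans bruhat_stepI)
  qed
qed

lemma bruhat_sref_comp:
  assumes w: "w \<in> symm_group n" and k: "k \<in> {1..<n}" and lt: "inversions n w < inversions n (sref k \<circ> w)"
  shows "(w, sref k \<circ> w) \<in> bruhat n"
proof -
  have wp: "w permutes {1..n}" using w by (rule symm_groupD)
  let ?a = "perm_inv w k" and ?b = "perm_inv w (Suc k)"
  have "?a < ?b" using lt inversions_sref_comp_less_iff[OF w k] by simp
  moreover have "?a \<in> {1..n}" "?b \<in> {1..n}"
    using k permutes_in_image[OF permutes_inv[OF wp]] by auto
  moreover have "w ?a = k" "w ?b = Suc k" using permutes_inverses(1)[OF wp] by auto
  moreover have "sref k (w x) = w (transpose ?a ?b x)" for x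
    using permutes_inverses[OF wp] by (metis transpose_def)
  ultimately show ?thesis
    using w by (intro bruhat_stepI, unfold bruhat_step_iff,
      intro conjI bexI[of _ ?a] bexI[of _ ?b]) (auto simp: fun_eq_iff)
qed

lemma bruhat_comp_sref:
  assumes w: "w \<in> symm_group n" and k: "k \<in> {1..<n}" and lt: "inversions n w < inversions n (w \<circ> sref k)"
  shows "(w, w \<circ> sref k) \<in> bruhat n"
proof (rule bruhat_stepI)
  have "w k < w (Suc k)" using lt inversions_comp_sref_less_iff[OF w k] by simp
  then show "(w, w \<circ> sref k) \<in> bruhat_step n"
    unfolding bruhat_step_iff using w k
    by (intro conjI bexI[of _ k] bexI[of _ "Suc k"]) auto
qed

section \<open>The free algebra\<close>

abbreviation FA :: "nat \<Rightarrow> free_nh set" where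
  "FA n \<equiv> carrier (free_nh_ring n)"

lemma FA_iff: "p \<in> FA n \<longleftrightarrow> (\<forall>w\<in>Poly_Mapping.keys p. set (letters w) \<subseteq> nh_gens n)"
  by (simp add: free_nh_ring_def)

lemma free_nh_ring_simps [simp]:
  "mult (free_nh_ring n) = (*)" "add (free_nh_ring n) = (+)"
  "one (free_nh_ring n) = 1" "zero (free_nh_ring n) = 0"
  by (simp_all add: free_nh_ring_def)

lemma keys_one_free [simp]: "Poly_Mapping.keys (1 :: free_nh) = {0}"
  by (metis keys_single single_one zero_neq_one)

lemma FA_zero [simp]: "0 \<in> FA n"
  by (simp add: FA_iff)

lemma FA_one [simp]: "1 \<in> FA n"
  by (simp add: FA_iff zero_nh_word_def)

lemma FA_add [simp]: "p \<in> FA n \<Longrightarrow> q \<in> FA n \<Longrightarrow> p + q \<in> FA n"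
  using keys_add[of p q] by (auto simp: FA_iff)

lemma FA_uminus [simp]: "p \<in> FA n \<Longrightarrow> - p \<in> FA n"
  by (simp add: FA_iff)

lemma FA_diff [simp]: "p \<in> FA n \<Longrightarrow> q \<in> FA n \<Longrightarrow> p - q \<in> FA n"
  using FA_add[of p n "- q"] by simp

lemma FA_mult [simp]: "p \<in> FA n \<Longrightarrow> q \<in> FA n \<Longrightarrow> p * q \<in> FA n"
  using keys_mult[of p q] by (fastforce simp: FA_iff plus_nh_word_def)

lemma FA_power [simp]: "p \<in> FA n \<Longrightarrow> p ^ k \<in> FA n"
  by (induction k) auto

lemma FA_numeral [simp]: "numeral k \<in> FA n"
  by (induction k) (simp_all only: numeral.simps FA_add FA_one)

lemma FA_sum: "(\<And>i. i \<in> I \<Longrightarrow> f i \<in> FA n) \<Longrightarrow> sum f I \<in> FA n"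
  by (induction I rule: infinite_finite_induct) auto

lemma word_mon_Nil [simp]: "word_mon [] = 1"
  by (simp add: word_mon_def zero_nh_word_def[symmetric])

lemma word_mon_append: "word_mon (gs @ hs) = word_mon gs * word_mon hs"
  by (simp add: word_mon_def mult_single plus_nh_word_def)

lemma word_mon_Cons: "word_mon (g # gs) = word_mon [g] * word_mon gs"
  using word_mon_append[of "[g]" gs] by simp

lemma word_mon_FA: "set gs \<subseteq> nh_gens n \<Longrightarrow> word_mon gs \<in> FA n"
  by (simp add: word_mon_def FA_iff)

lemma xg_FA [simp]: "i \<in> {1..n} \<Longrightarrow> xg i \<in> FA n"
  by (rule word_mon_FA) (simp add: nh_gens_def)

lemma dg_FA [simp]: "i \<in> {1..<n} \<Longrightarrow> dg i \<in> FA n"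
  by (rule word_mon_FA) (simp add: nh_gens_def)

lemma free_nh_ring_ring: "ring (free_nh_ring n)"
proof (rule ringI)
  show "abelian_group (free_nh_ring n)"
    by (rule abelian_groupI) (auto simp: algebra_simps intro: bexI[of _ "- x" for x])
  show "Group.monoid (free_nh_ring n)"
    by (rule monoidI) (auto simp: algebra_simps)
qed (auto simp: algebra_simps)

lemma FA_induct [consumes 1, case_names zero word diff]:
  assumes "p \<in> FA n" "Q 0" "\<And>gs. set gs \<subseteq> nh_gens n \<Longrightarrow> Q (word_mon gs)"
    "\<And>p q. Q p \<Longrightarrow> Q q \<Longrightarrow> Q (p - q)"
  shows "Q p"
proof (rule frag_induction[of p "{w. set (letters w) \<subseteq> nh_gens n}"])
  show "Q (frag_of w)" if "w \<in> {w. set (letters w) \<subseteq> nh_gens n}" for w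
    using assms(3)[of "letters w"] that by (simp add: word_mon_def)
qed (use assms in \<open>auto simp: FA_iff\<close>)

lemma free_induct [case_names zero word diff]:
  fixes p :: free_nh
  assumes "Q 0" "\<And>gs. Q (word_mon gs)" "\<And>p q. Q p \<Longrightarrow> Q q \<Longrightarrow> Q (p - q)"
  shows "Q p"
proof (rule frag_induction[of p UNIV])
  show "Q (frag_of w)" for w
    using assms(2)[of "letters w"] by (simp add: word_mon_def)
qed (use assms in auto)

section \<open>The nilHecke ideal\<close>

lemma nh_rels_FA: "nh_rels n \<subseteq> FA n"
  unfolding nh_rels_def by (auto intro!: FA_diff FA_mult)

lemma nh_ideal_ideal: "ideal (nh_ideal n) (free_nh_ring n)"
  unfolding nh_ideal_def by (rule ring.genideal_ideal[OF free_nh_ring_ring nh_rels_FA])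

lemma nh_ideal_FA: "p \<in> nh_ideal n \<Longrightarrow> p \<in> FA n"
  using additive_subgroup.a_Hcarr[OF ideal.axioms(1)[OF nh_ideal_ideal]] .

lemma nh_rel_ideal: "r \<in> nh_rels n \<Longrightarrow> r \<in> nh_ideal n"
  using ring.genideal_self[OF free_nh_ring_ring nh_rels_FA] by (auto simp: nh_ideal_def)

lemma nh_ideal_zero [simp]: "0 \<in> nh_ideal n"
  using additive_subgroup.zero_closed[OF ideal.axioms(1)[OF nh_ideal_ideal]] by simp

lemma nh_ideal_add: "p \<in> nh_ideal n \<Longrightarrow> q \<in> nh_ideal n \<Longrightarrow> p + q \<in> nh_ideal n"
  using additive_subgroup.a_closed[OF ideal.axioms(1)[OF nh_ideal_ideal]] by simp

lemma nh_ideal_lmult: "a \<in> FA n \<Longrightarrow> p \<in> nh_ideal n \<Longrightarrow> a * p \<in> nh_ideal n"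
  using ideal.I_l_closed[OF nh_ideal_ideal] by simp

lemma nh_ideal_rmult: "p \<in> nh_ideal n \<Longrightarrow> a \<in> FA n \<Longrightarrow> p * a \<in> nh_ideal n"
  using ideal.I_r_closed[OF nh_ideal_ideal] by simp

lemma nh_ideal_uminus: "p \<in> nh_ideal n \<Longrightarrow> - p \<in> nh_ideal n"
  using nh_ideal_lmult[of "- 1" n p] by simp

lemma nh_ideal_diff: "p \<in> nh_ideal n \<Longrightarrow> q \<in> nh_ideal n \<Longrightarrow> p - q \<in> nh_ideal n"
  using nh_ideal_add[of p n "- q"] nh_ideal_uminus by simp

lemma nh_ideal_sum: "(\<And>i. i \<in> I \<Longrightarrow> f i \<in> nh_ideal n) \<Longrightarrow> sum f I \<in> nh_ideal n"
  by (induction I rule: infinite_finite_induct) (auto intro: nh_ideal_add)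

lemmas nh_ideal_intros = nh_ideal_add nh_ideal_diff nh_ideal_uminus nh_ideal_lmult nh_ideal_rmult

text \<open>
  The elements of the ideal with the property \<open>Q\<close> again form an ideal. Negatives arise by multiplying
  with \<open>- 1\<close>.
\<close>

lemma nh_ideal_induct [consumes 1, case_names rel zero add lmult rmult]:
  assumes p: "p \<in> nh_ideal n" and rel: "\<And>r. r \<in> nh_rels n \<Longrightarrow> Q r" and zero: "Q 0"
    and add: "\<And>p q. p \<in> nh_ideal n \<Longrightarrow> q \<in> nh_ideal n \<Longrightarrow> Q p \<Longrightarrow> Q q \<Longrightarrow> Q (p + q)"
    and lmult: "\<And>a p. a \<in> FA n \<Longrightarrow> p \<in> nh_ideal n \<Longrightarrow> Q p \<Longrightarrow> Q (a * p)"
    and rmult: "\<And>a p. a \<in> FA n \<Longrightarrow> p \<in> nh_ideal n \<Longrightarrow> Q p \<Longrightarrow> Q (p * a)"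
  shows "Q p"
proof -
  interpret R: ring "free_nh_ring n" by (rule free_nh_ring_ring)
  let ?I = "{p \<in> nh_ideal n. Q p}"
  have inv: "\<ominus>\<^bsub>free_nh_ring n\<^esub> q = - q" if "q \<in> FA n" for q
    by (rule R.minus_equality) (use that in auto)
  have "subgroup ?I (add_monoid (free_nh_ring n))"
  proof (rule R.add.subgroupI)
    show "?I \<subseteq> FA n" using nh_ideal_FA by auto
    show "?I \<noteq> {}" using zero nh_ideal_zero by blast
    show "\<ominus>\<^bsub>free_nh_ring n\<^esub> q \<in> ?I" if "q \<in> ?I" for q
      using that inv[of q] lmult[of "- 1" q] by (auto simp: nh_ideal_uminus nh_ideal_FA)
    show "q \<oplus>\<^bsub>free_nh_ring n\<^esub> q' \<in> ?I" if "q \<in> ?I" "q' \<in> ?I" for q q'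
      using that add by (auto intro: nh_ideal_add)
  qed
  then have "ideal ?I (free_nh_ring n)"
    using lmult rmult by (intro idealI free_nh_ring_ring) (auto intro: nh_ideal_lmult nh_ideal_rmult)
  then have "nh_ideal n \<subseteq> ?I"
    using nh_rel_ideal rel unfolding nh_ideal_def
    by (intro R.genideal_minimal) (auto simp: nh_ideal_def)
  then show ?thesis using p by auto
qed

definition nh_eq :: "nat \<Rightarrow> free_nh \<Rightarrow> free_nh \<Rightarrow> bool" where
  "nh_eq n p q \<longleftrightarrow> p - q \<in> nh_ideal n"

lemma nh_eq_refl [simp]: "nh_eq n p p"
  by (simp add: nh_eq_def)

lemma nh_eq_sym: "nh_eq n p q \<Longrightarrow> nh_eq n q p"
  using nh_ideal_uminus[of "p - q" n] by (simp add: nh_eq_def)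

lemma nh_eq_trans [trans]: "nh_eq n p q \<Longrightarrow> nh_eq n q r \<Longrightarrow> nh_eq n p r"
  using nh_ideal_add[of "p - q" n "q - r"] by (simp add: nh_eq_def)

lemma nh_eq_add: "nh_eq n p q \<Longrightarrow> nh_eq n p' q' \<Longrightarrow> nh_eq n (p + p') (q + q')"
  using nh_ideal_add[of "p - q" n "p' - q'"] by (simp add: nh_eq_def algebra_simps)

lemma nh_eq_diff: "nh_eq n p q \<Longrightarrow> nh_eq n p' q' \<Longrightarrow> nh_eq n (p - p') (q - q')"
  using nh_ideal_diff[of "p - q" n "p' - q'"] by (simp add: nh_eq_def algebra_simps)

lemma nh_eq_sum: "(\<And>i. i \<in> I \<Longrightarrow> nh_eq n (f i) (g i)) \<Longrightarrow> nh_eq n (sum f I) (sum g I)"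
  by (induction I rule: infinite_finite_induct) (auto intro: nh_eq_add)

lemma nh_eq_lmult: "a \<in> FA n \<Longrightarrow> nh_eq n p q \<Longrightarrow> nh_eq n (a * p) (a * q)"
  using nh_ideal_lmult[of a n "p - q"] by (simp add: nh_eq_def algebra_simps)

lemma nh_eq_rmult: "a \<in> FA n \<Longrightarrow> nh_eq n p q \<Longrightarrow> nh_eq n (p * a) (q * a)"
  using nh_ideal_rmult[of "p - q" n a] by (simp add: nh_eq_def algebra_simps)

lemma nh_eq_0_iff: "nh_eq n p 0 \<longleftrightarrow> p \<in> nh_ideal n"
  by (simp add: nh_eq_def)

lemma nh_rel_xx: "i \<in> {1..n} \<Longrightarrow> j \<in> {1..n} \<Longrightarrow> xg i * xg j - xg j * xg i \<in> nh_ideal n"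
  by (rule nh_rel_ideal) (unfold nh_rels_def, blast)

lemma nh_rel_dd: "i \<in> {1..<n} \<Longrightarrow> dg i * dg i \<in> nh_ideal n"
  by (rule nh_rel_ideal) (unfold nh_rels_def, blast)

lemma nh_rel_braid: "i \<in> {1..<n} \<Longrightarrow> Suc i \<in> {1..<n} \<Longrightarrow>
    dg i * dg (Suc i) * dg i - dg (Suc i) * dg i * dg (Suc i) \<in> nh_ideal n"
  by (rule nh_rel_ideal) (unfold nh_rels_def, blast)

lemma nh_rel_far: "i \<in> {1..<n} \<Longrightarrow> j \<in> {1..<n} \<Longrightarrow> \<bar>int i - int j\<bar> > 1 \<Longrightarrow>
    dg i * dg j - dg j * dg i \<in> nh_ideal n"
  by (rule nh_rel_ideal) (unfold nh_rels_def, blast)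

lemma nh_rel_xd: "i \<in> {1..<n} \<Longrightarrow> j \<in> {1..n} \<Longrightarrow> j \<noteq> i \<Longrightarrow> j \<noteq> Suc i \<Longrightarrow>
    xg j * dg i - dg i * xg j \<in> nh_ideal n"
  by (rule nh_rel_ideal) (unfold nh_rels_def, blast)

lemma nh_rel_nil1: "i \<in> {1..<n} \<Longrightarrow> xg i * dg i - dg i * xg (Suc i) - 1 \<in> nh_ideal n"
  by (rule nh_rel_ideal) (unfold nh_rels_def, blast)

lemma nh_rel_nil2: "i \<in> {1..<n} \<Longrightarrow> dg i * xg i - xg (Suc i) * dg i - 1 \<in> nh_ideal n"
  by (rule nh_rel_ideal) (unfold nh_rels_def, blast)

section \<open>Derivations of the free algebra\<close>

definition derivation :: "(free_nh \<Rightarrow> free_nh) \<Rightarrow> bool" where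
  "derivation T \<longleftrightarrow> (\<forall>p q. T (p + q) = T p + T q) \<and> (\<forall>p q. T (p * q) = T p * q + p * T q)"

lemma derivation_add: "derivation T \<Longrightarrow> T (p + q) = T p + T q"
  and derivation_mult: "derivation T \<Longrightarrow> T (p * q) = T p * q + p * T q"
  by (simp_all add: derivation_def)

lemma derivation_zero: "derivation T \<Longrightarrow> T 0 = 0"
  using derivation_add[of T 0 0] by simp

lemma derivation_one: "derivation T \<Longrightarrow> T 1 = 0"
  using derivation_mult[of T 1 1] by simp

lemma derivation_uminus: "derivation T \<Longrightarrow> T (- p) = - T p"
  using derivation_add[of T "- p" p] derivation_zero[of T] by (simp add: eq_neg_iff_add_eq_0)

lemma derivation_diff: "derivation T \<Longrightarrow> T (p - q) = T p - T q"
  using derivation_add[of T p "- q"] by (simp add: derivation_uminus)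

lemma derivation_numeral: "derivation T \<Longrightarrow> T (numeral k) = 0"
  by (induction k) (simp_all only: numeral.simps derivation_add derivation_one add_0)

lemmas derivation_simps = derivation_add derivation_diff derivation_uminus derivation_mult
  derivation_one derivation_zero derivation_numeral

text \<open>
  The Leibniz rule determines a derivation on words from its values on letters.
\<close>

lemma derivation_eqI:
  assumes "derivation T" "derivation S" "\<And>g. T (word_mon [g]) = S (word_mon [g])"
  shows "T p = S p"
proof (induction p rule: free_induct)
  case (word gs)
  show ?case
  proof (induction gs)
    case (Cons g gs)
    then show ?case
      using assms by (subst (1 2) word_mon_Cons) (simp add: derivation_simps)
  qed (use assms in \<open>simp add: derivation_simps\<close>)
qed (use assms in \<open>simp_all add: derivation_simps\<close>)

lemma derivation_FA:
  assumes T: "derivation T" and g: "\<And>g. g \<in> nh_gens n \<Longrightarrow> T (word_mon [g]) \<in> FA n" and p: "p \<in> FA n"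
  shows "T p \<in> FA n"
  using p
proof (induction p rule: FA_induct)
  case (word gs)
  then show ?case
  proof (induction gs)
    case (Cons g gs)
    then show ?case
      using T g by (subst word_mon_Cons) (simp add: derivation_simps word_mon_FA)
  qed (use T in \<open>simp add: derivation_simps\<close>)
qed (use T in \<open>simp_all add: derivation_simps\<close>)

text \<open>
  By the Leibniz rule it suffices to consider the generators of the ideal, provided that the derivation
  does not leave the subalgebra of the chosen \<open>n\<close>.
\<close>

lemma derivation_nh_ideal:
  assumes T: "derivation T" and A: "\<And>p. p \<in> FA n \<Longrightarrow> T p \<in> FA n"
    and rel: "\<And>r. r \<in> nh_rels n \<Longrightarrow> T r \<in> nh_ideal n" and p: "p \<in> nh_ideal n"
  shows "T p \<in> nh_ideal n"
  using p
proof (induction p rule: nh_ideal_induct)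
  case (lmult a p)
  then show ?case using T A by (simp add: derivation_simps nh_ideal_intros)
next
  case (rmult a p)
  then show ?case using T A by (simp add: derivation_simps nh_ideal_intros)
qed (use T rel in \<open>auto simp: derivation_simps intro: nh_ideal_intros\<close>)

lemma word_der_append:
  "word_der \<delta> (gs @ hs) = word_der \<delta> gs * word_mon hs + word_mon gs * word_der \<delta> hs"
proof (induction gs)
  case (Cons g gs)
  then show ?case
    by (simp add: word_mon_append algebra_simps) (subst word_mon_Cons, simp add: algebra_simps)
qed simp

lemma free_der_word [simp]: "free_der \<delta> (word_mon gs) = word_der \<delta> gs"
  by (simp add: free_der_def word_mon_def)

text \<open>
  Both sides of the Leibniz rule are biadditive, so words suffice.
\<close>

lemma derivationI:
  assumes diff: "\<And>p q. T (p - q) = T p - T q"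
    and word: "\<And>gs hs. T (word_mon gs * word_mon hs) = T (word_mon gs) * word_mon hs + word_mon gs * T (word_mon hs)"
  shows "derivation T"
proof -
  have zero: "T 0 = 0" using diff[of 0 0] by simp
  have add: "T (p + q) = T p + T q" for p q
    using diff[of p "- q"] diff[of 0 q] zero by simp
  have "T (p * q) = T p * q + p * T q" for p q
  proof (induction p rule: free_induct)
    case (word gs)
    show ?case
      by (induction q rule: free_induct) (simp_all add: zero diff assms(2) algebra_simps)
  qed (simp_all add: zero diff algebra_simps)
  then show ?thesis using add by (simp add: derivation_def)
qed

lemma derivation_free_der: "derivation (free_der \<delta>)"
  by (rule derivationI)
     (simp add: free_der_def frag_extend_diff, simp flip: word_mon_append add: word_der_append)

lemma derivation_commutator:
  assumes "derivation T" "derivation S"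
  shows "derivation (\<lambda>p. T (S p) - S (T p))"
  using assms by (simp add: derivation_def algebra_simps)

lemma derivation_double: "derivation T \<Longrightarrow> derivation (\<lambda>p. T p + T p)"
  by (simp add: derivation_def algebra_simps)

lemma derivation_neg: "derivation T \<Longrightarrow> derivation (\<lambda>p. - T p)"
  by (simp add: derivation_def algebra_simps)

lemma free_h_word [simp]: "free_h (word_mon gs) = of_int (word_degree (Word gs)) * word_mon gs"
proof -
  have "Poly_Mapping.single (0 :: nh_word) (of_int (word_degree (Word gs)) :: int) = of_int (word_degree (Word gs))"
    by (rule single_of_int)
  then have "of_int (word_degree (Word gs)) = (Poly_Mapping.single 0 (word_degree (Word gs)) :: free_nh)"
    by simp
  then show ?thesis by (simp add: free_h_def word_mon_def mult_single)
qed

lemma word_degree_simps [simp]: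
  "word_degree (Word []) = 0" "word_degree (Word (g # gs)) = gen_degree g + word_degree (Word gs)"
  "word_degree (Word (gs @ hs)) = word_degree (Word gs) + word_degree (Word hs)"
  by (simp_all add: word_degree_def)

lemma derivation_free_h: "derivation free_h"
proof (rule derivationI)
  show "free_h (p - q) = free_h p - free_h q" for p q
    by (simp add: free_h_def frag_extend_diff)
  show "free_h (word_mon gs * word_mon hs)
      = free_h (word_mon gs) * word_mon hs + word_mon gs * free_h (word_mon hs)" for gs hs
  proof -
    have "word_mon gs * (of_int k * word_mon hs) = of_int k * (word_mon gs * word_mon hs)" for k
      by (metis mult.assoc mult_of_int_commute)
    then show ?thesis
      unfolding word_mon_append[symmetric] free_h_word
      by (simp add: word_mon_append distrib_right mult.assoc)
  qed
qed

lemma free_der_gen [simp]: "free_der \<delta> (word_mon [g]) = \<delta> g"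
  by simp

text \<open>
  Both sides are derivations, so that only generators have to be compared. The same argument gives the
  other two commutators.
\<close>

lemma commutator_hd: "free_h (free_der d_gen p) - free_der d_gen (free_h p) = 2 * free_der d_gen p"
proof -
  have "free_h (free_der d_gen p) - free_der d_gen (free_h p) = free_der d_gen p + free_der d_gen p"
  proof (rule derivation_eqI[of "\<lambda>p. free_h (free_der d_gen p) - free_der d_gen (free_h p)"])
    show "free_h (free_der d_gen (word_mon [g])) - free_der d_gen (free_h (word_mon [g])) =
        free_der d_gen (word_mon [g]) + free_der d_gen (word_mon [g])" for g
      by (cases g) (simp_all add: derivation_simps[OF derivation_free_h] power2_eq_square
          derivation_simps[OF derivation_free_der] algebra_simps mult_2 mult_2_right)
  qed (intro derivation_commutator derivation_double derivation_free_h derivation_free_der)+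
  then show ?thesis by (simp add: mult_2)
qed

lemma commutator_hz: "free_h (free_der z_gen p) - free_der z_gen (free_h p) = - (2 * free_der z_gen p)"
proof -
  have "free_h (free_der z_gen p) - free_der z_gen (free_h p) = - (free_der z_gen p + free_der z_gen p)"
  proof (rule derivation_eqI[of "\<lambda>p. free_h (free_der z_gen p) - free_der z_gen (free_h p)"])
    show "free_h (free_der z_gen (word_mon [g])) - free_der z_gen (free_h (word_mon [g])) =
        - (free_der z_gen (word_mon [g]) + free_der z_gen (word_mon [g]))" for g
      by (cases g) (simp_all add: derivation_simps[OF derivation_free_h] power2_eq_square
          derivation_simps[OF derivation_free_der] algebra_simps mult_2 mult_2_right)
  qed (intro derivation_commutator derivation_neg derivation_double derivation_free_h derivation_free_der)+
  then show ?thesis by (simp add: mult_2)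
qed

lemma commutator_zd: "free_der z_gen (free_der d_gen p) - free_der d_gen (free_der z_gen p) = free_h p"
proof (rule derivation_eqI[of "\<lambda>p. free_der z_gen (free_der d_gen p) - free_der d_gen (free_der z_gen p)"])
  show "free_der z_gen (free_der d_gen (word_mon [g])) - free_der d_gen (free_der z_gen (word_mon [g])) =
      free_h (word_mon [g])" for g
    by (cases g) (simp_all add: derivation_simps[OF derivation_free_der] power2_eq_square algebra_simps mult_2 mult_2_right)
qed (intro derivation_commutator derivation_free_h derivation_free_der)+

lemma free_z_FA: "p \<in> FA n \<Longrightarrow> free_der z_gen p \<in> FA n"
  by (rule derivation_FA[OF derivation_free_der]) (auto simp: nh_gens_def)

lemma free_d_FA: "p \<in> FA n \<Longrightarrow> free_der d_gen p \<in> FA n"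
  by (rule derivation_FA[OF derivation_free_der]) (auto simp: nh_gens_def intro!: FA_diff FA_uminus FA_mult)

lemma free_h_FA: "p \<in> FA n \<Longrightarrow> free_h p \<in> FA n"
  by (rule derivation_FA[OF derivation_free_h])
     (auto simp: nh_gens_def)

lemma nh_rels_cases [consumes 1, case_names xx dd braid far xd nil1 nil2]:
  assumes "r \<in> nh_rels n"
  obtains i j where "i \<in> {1..n}" "j \<in> {1..n}" "r = xg i * xg j - xg j * xg i"
  | i where "i \<in> {1..<n}" "r = dg i * dg i"
  | i where "i \<in> {1..<n}" "Suc i \<in> {1..<n}"
      "r = dg i * dg (Suc i) * dg i - dg (Suc i) * dg i * dg (Suc i)"
  | i j where "i \<in> {1..<n}" "j \<in> {1..<n}" "\<bar>int i - int j\<bar> > 1" "r = dg i * dg j - dg j * dg i"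
  | i j where "i \<in> {1..<n}" "j \<in> {1..n}" "j \<noteq> i" "j \<noteq> Suc i" "r = xg j * dg i - dg i * xg j"
  | i where "i \<in> {1..<n}" "r = xg i * dg i - dg i * xg (Suc i) - 1"
  | i where "i \<in> {1..<n}" "r = dg i * xg i - xg (Suc i) * dg i - 1"
  using assms unfolding nh_rels_def Un_iff mem_Collect_eq
  by (elim disjE exE conjE) (rule that; assumption)+

definition free_homogeneous :: "int \<Rightarrow> free_nh \<Rightarrow> bool" where
  "free_homogeneous k p \<longleftrightarrow> (\<forall>w\<in>Poly_Mapping.keys p. word_degree w = k)"

lemma free_homogeneous_zero [simp]: "free_homogeneous k 0"
  by (simp add: free_homogeneous_def)

lemma free_homogeneous_add:
  "free_homogeneous k p \<Longrightarrow> free_homogeneous k q \<Longrightarrow> free_homogeneous k (p + q)"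
  using keys_add[of p q] by (auto simp: free_homogeneous_def)

lemma free_homogeneous_uminus: "free_homogeneous k p \<Longrightarrow> free_homogeneous k (- p)"
  by (simp add: free_homogeneous_def)

lemma free_homogeneous_diff:
  "free_homogeneous k p \<Longrightarrow> free_homogeneous k q \<Longrightarrow> free_homogeneous k (p - q)"
  using free_homogeneous_add[of k p "- q"] by (simp add: free_homogeneous_uminus)

lemma free_homogeneous_mult:
  "free_homogeneous j p \<Longrightarrow> free_homogeneous k q \<Longrightarrow> m = j + k \<Longrightarrow> free_homogeneous m (p * q)"
  using keys_mult[of p q] by (fastforce simp: free_homogeneous_def word_degree_def plus_nh_word_def)

lemma free_homogeneous_word: "word_degree (Word gs) = k \<Longrightarrow> free_homogeneous k (word_mon gs)"
  by (simp add: free_homogeneous_def word_mon_def)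

lemma free_homogeneous_one: "free_homogeneous 0 1"
  using free_homogeneous_word[of "[]" 0] by simp

text \<open>
  On homogeneous elements the operator is multiplication by the degree; for relations this makes its
  compatibility with the ideal evident.
\<close>

lemma free_h_homogeneous:
  assumes "free_homogeneous k p"
  shows "free_h p = of_int k * p"
proof (rule frag_induction[of p "{w. word_degree w = k}"])
  show "free_h (frag_of w) = of_int k * frag_of w" if "w \<in> {w. word_degree w = k}" for w
    using free_h_word[of "letters w"] that by (simp add: word_mon_def)
  show "free_h (p - q) = of_int k * (p - q)" if "free_h p = of_int k * p" "free_h q = of_int k * q" for p q
    using that by (simp add: derivation_diff[OF derivation_free_h] algebra_simps)
qed (use assms in \<open>auto simp: free_homogeneous_def derivation_zero[OF derivation_free_h]\<close>)

lemma nh_rels_homogeneous: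
  assumes "r \<in> nh_rels n"
  shows "\<exists>k\<in>{4, -4, -6, 0}. free_homogeneous k r"
proof -
  note intros = free_homogeneous_diff free_homogeneous_word free_homogeneous_one
  show ?thesis
    using assms
  proof (cases rule: nh_rels_cases)
    case xx
    show ?thesis
      unfolding xx word_mon_append[symmetric]
      by (intro bexI[of _ "4"] intros) simp_all
  next
    case dd
    show ?thesis
      unfolding dd word_mon_append[symmetric]
      by (intro bexI[of _ "- 4"] intros) simp_all
  next
    case braid
    show ?thesis
      unfolding braid word_mon_append[symmetric]
      by (intro bexI[of _ "- 6"] intros) simp_all
  next
    case far
    show ?thesis
      unfolding far word_mon_append[symmetric]
      by (intro bexI[of _ "- 4"] intros) simp_all
  next
    case xd
    show ?thesis
      unfolding xd word_mon_append[symmetric]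
      by (intro bexI[of _ "0"] intros) simp_all
  next
    case nil1
    show ?thesis
      unfolding nil1 word_mon_append[symmetric]
      by (intro bexI[of _ "0"] intros) simp_all
  next
    case nil2
    show ?thesis
      unfolding nil2 word_mon_append[symmetric]
      by (intro bexI[of _ "0"] intros) simp_all
  qed
qed

lemma free_z_nh_ideal: "p \<in> nh_ideal n \<Longrightarrow> free_der z_gen p \<in> nh_ideal n"
proof (rule derivation_nh_ideal[OF derivation_free_der free_z_FA])
  show "free_der z_gen r \<in> nh_ideal n" if "r \<in> nh_rels n" for r
    using that by (cases rule: nh_rels_cases) (simp_all add: derivation_simps[OF derivation_free_der])
qed

lemma free_h_nh_ideal: "p \<in> nh_ideal n \<Longrightarrow> free_h p \<in> nh_ideal n"
proof (rule derivation_nh_ideal[OF derivation_free_h free_h_FA])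
  show "free_h r \<in> nh_ideal n" if r: "r \<in> nh_rels n" for r
  proof -
    obtain k where k: "k \<in> {4, -4, -6, 0}" "free_homogeneous k r"
      using nh_rels_homogeneous[OF r] by blast
    then have "of_int k \<in> FA n" by auto
    then show ?thesis
      using nh_ideal_lmult[OF _ nh_rel_ideal[OF r]] by (simp add: free_h_homogeneous[OF k(2)])
  qed
qed

text \<open>
  This and the next four identities express the image of a relation under \<open>d\<close> by relations. The letters
  \<open>S\<close> and \<open>T\<close> stand for generators \<open>D i\<close> and \<open>D j\<close>, the lower case letters for variables, and \<open>dS\<close> and \<open>dT\<close>
  for the values of \<open>d\<close>. The abbreviations \<open>r\<close>, \<open>r6\<close>, \<open>r7\<close>, \<open>r6'\<close>, \<open>e\<close> and \<open>q\<close> are defining relations of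
  \<open>NH\<close>. For the braid relation the certificate results from \<open>dS = 1 - 2 * a * S + r6\<close>, which holds in
  every ring, by moving all variables to the left.
\<close>

lemma d_braid_identity:
  fixes a b c S T :: "'a :: ring_1"
  defines "r6 \<equiv> a * S - S * b - 1" and "r7 \<equiv> S * a - b * S - 1" and "r6' \<equiv> b * T - T * c - 1"
    and "e \<equiv> a * T - T * a"
  defines "dS \<equiv> - (a * S) - S * b" and "dT \<equiv> - (b * T) - T * c"
  shows "(dS * T + S * dT) * S + S * T * dS - ((dT * S + T * dS) * T + T * S * dT) =
    S * S + (r6 + r6 + r6 - r7 - r7) * (T * S) + S * ((e + e + r6') * S) + S * T * r6
    - (T * T + T * T + T * T + T * ((r6 + r6 + r6) * T) + (e + e + e + e + r6') * (S * T) + T * S * r6')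
    - (a + a + a + a + b + b) * (S * T * S - T * S * T)"
  unfolding assms by (simp add: algebra_simps)

lemma d_nil2_identity:
  fixes x y S :: "'a :: ring_1"
  defines "r6 \<equiv> x * S - S * y - 1" and "r7 \<equiv> S * x - y * S - 1" and "q \<equiv> y * x - x * y"
  defines "dS \<equiv> - (x * S) - S * y"
  shows "dS * x + S * x ^ 2 - (y ^ 2 * S + y * dS) =
    - (x * (r7 + r7)) + (r6 + r7) * x + y * (r7 - r6) + (q + q) * S"
  unfolding assms by (simp add: algebra_simps power2_eq_square)

lemma d_far_identity:
  fixes x y z w S T :: "'a :: ring_1"
  defines "dS \<equiv> - (x * S) - S * y" and "dT \<equiv> - (z * T) - T * w"
  shows "dS * T + S * dT - (dT * S + T * dS) =
    - (x * (S * T - T * S)) - (x * T - T * x) * S - z * (S * T - T * S) + (z * S - S * z) * T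
    - S * (y * T - T * y) - (S * T - T * S) * y - (S * T - T * S) * w + T * (w * S - S * w)"
  unfolding assms by (simp add: algebra_simps)

lemma d_xd_identity:
  fixes x y z S :: "'a :: ring_1"
  defines "dS \<equiv> - (x * S) - S * y" and "r \<equiv> z * S - S * z"
  shows "z ^ 2 * S + z * dS - (dS * z + S * z ^ 2) =
    z * r + r * z - (z * x - x * z) * S - x * r - r * y - S * (z * y - y * z)"
  unfolding assms by (simp add: algebra_simps power2_eq_square)

lemma d_dd_identity:
  fixes x y S :: "'a :: ring_1"
  defines "r6 \<equiv> x * S - S * y - 1" and "r7 \<equiv> S * x - y * S - 1"
  defines "dS \<equiv> - (x * S) - S * y"
  shows "dS * S + S * dS = - ((x + x) * (S * S)) - S * S * y - y * (S * S) + r6 * S - r7 * S"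
  unfolding assms by (simp add: algebra_simps)

lemma free_d_nh_ideal: "p \<in> nh_ideal n \<Longrightarrow> free_der d_gen p \<in> nh_ideal n"
proof (rule derivation_nh_ideal[OF derivation_free_der free_d_FA])
  note expand = derivation_simps[OF derivation_free_der] free_der_gen d_gen.simps diff_zero
  show "free_der d_gen r \<in> nh_ideal n" if r: "r \<in> nh_rels n" for r
    using r
  proof (cases rule: nh_rels_cases)
    case (xx i j)
    let ?r = "xg i * xg j - xg j * xg i"
    have "xg i \<in> FA n" "xg j \<in> FA n" using xx by simp_all
    moreover have "free_der d_gen r = xg i * ?r + ?r * xg i + ?r * xg j + xg j * ?r"
      by (simp add: xx expand power2_eq_square algebra_simps)
    ultimately show ?thesis
      by (simp only: nh_ideal_intros nh_rel_xx[OF xx(1,2)])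
  next
    case (dd i)
    have "xg i \<in> FA n" "xg (Suc i) \<in> FA n" "dg i \<in> FA n" using dd by simp_all
    then show ?thesis
      by (simp only: dd expand d_dd_identity)
         (simp only: nh_ideal_intros FA_mult FA_add nh_rel_dd[OF dd(1)] nh_rel_nil1[OF dd(1)]
           nh_rel_nil2[OF dd(1)])
  next
    case (braid i)
    have "xg i \<in> FA n" "xg (Suc i) \<in> FA n" "dg i \<in> FA n" "dg (Suc i) \<in> FA n" using braid by simp_all
    moreover have "xg i * dg (Suc i) - dg (Suc i) * xg i \<in> nh_ideal n"
      by (rule nh_rel_xd) (use braid in auto)
    ultimately show ?thesis
      by (simp only: braid(3) expand d_braid_identity)
         (simp only: nh_ideal_intros FA_mult FA_add nh_rel_dd[OF braid(1)] nh_rel_dd[OF braid(2)]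
           nh_rel_nil1[OF braid(1)] nh_rel_nil1[OF braid(2)] nh_rel_nil2[OF braid(1)]
           nh_rel_braid[OF braid(1,2)])
  next
    case (far i j)
    have "xg i \<in> FA n" "xg (Suc i) \<in> FA n" "dg i \<in> FA n"
      "xg j \<in> FA n" "xg (Suc j) \<in> FA n" "dg j \<in> FA n" using far by simp_all
    moreover have "xg i * dg j - dg j * xg i \<in> nh_ideal n" "xg (Suc i) * dg j - dg j * xg (Suc i) \<in> nh_ideal n"
      "xg j * dg i - dg i * xg j \<in> nh_ideal n" "xg (Suc j) * dg i - dg i * xg (Suc j) \<in> nh_ideal n"
      by (rule nh_rel_xd; use far in auto)+
    ultimately show ?thesis
      by (simp only: far(4) expand d_far_identity) (simp only: nh_ideal_intros nh_rel_far[OF far(1-3)])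
  next
    case (xd i j)
    have "xg i \<in> FA n" "xg (Suc i) \<in> FA n" "dg i \<in> FA n" "xg j \<in> FA n" using xd by simp_all
    moreover have "xg j * xg i - xg i * xg j \<in> nh_ideal n" "xg j * xg (Suc i) - xg (Suc i) * xg j \<in> nh_ideal n"
      by (rule nh_rel_xx; use xd in auto)+
    ultimately show ?thesis
      by (simp only: xd(5) expand d_xd_identity) (simp only: nh_ideal_intros nh_rel_xd[OF xd(1-4)])
  next
    case (nil1 i)
    have "free_der d_gen r = 0"
      by (simp add: nil1 expand power2_eq_square algebra_simps)
    then show ?thesis by simp
  next
    case (nil2 i)
    have "xg i \<in> FA n" "xg (Suc i) \<in> FA n" "dg i \<in> FA n" using nil2 by simp_all
    moreover have "xg (Suc i) * xg i - xg i * xg (Suc i) \<in> nh_ideal n"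
      by (rule nh_rel_xx; use nil2 in auto)
    ultimately show ?thesis
      by (simp only: nil2(2) expand d_nil2_identity)
         (simp only: nh_ideal_intros nh_rel_nil1[OF nil2(1)] nh_rel_nil2[OF nil2(1)])
  qed
qed

section \<open>The quotient and its operators\<close>

lemma nh_class_iff: "q \<in> nh_class n p \<longleftrightarrow> nh_eq n q p"
  by (auto simp: nh_class_def a_r_coset_def' nh_eq_def) (metis diff_add_cancel)

lemma nh_class_eq_iff: "nh_class n p = nh_class n q \<longleftrightarrow> nh_eq n p q"
  by (auto simp: nh_class_iff set_eq_iff intro: nh_eq_sym nh_eq_trans)

lemma NH_ring: "ring (NH n)"
  unfolding NH_def by (rule ideal.quotient_is_ring[OF nh_ideal_ideal])

lemma nh_class_hom: "nh_class n \<in> ring_hom (free_nh_ring n) (NH n)"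
  unfolding NH_def nh_class_def[abs_def] by (rule ideal.rcos_ring_hom[OF nh_ideal_ideal])

lemma carrier_NH: "carrier (NH n) = nh_class n ` FA n"
  by (auto simp: NH_def FactRing_def A_RCOSETS_def' nh_class_def)

lemma nh_class_closed [simp]: "p \<in> FA n \<Longrightarrow> nh_class n p \<in> carrier (NH n)"
  by (simp add: carrier_NH)

lemma nh_class_add: "p \<in> FA n \<Longrightarrow> q \<in> FA n \<Longrightarrow> nh_class n p \<oplus>\<^bsub>NH n\<^esub> nh_class n q = nh_class n (p + q)"
  using ring_hom_add[OF nh_class_hom] by simp

lemma nh_class_mult: "p \<in> FA n \<Longrightarrow> q \<in> FA n \<Longrightarrow> nh_class n p \<otimes>\<^bsub>NH n\<^esub> nh_class n q = nh_class n (p * q)"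
  using ring_hom_mult[OF nh_class_hom] by simp

lemma nh_class_zero: "\<zero>\<^bsub>NH n\<^esub> = nh_class n 0"
proof -
  interpret NH: ring "NH n" by (rule NH_ring)
  have "nh_class n 0 \<oplus>\<^bsub>NH n\<^esub> nh_class n 0 = nh_class n 0" by (simp add: nh_class_add)
  then show ?thesis using NH.add.l_cancel_one nh_class_closed[OF FA_zero] by metis
qed

text \<open>
  The union in the definition of \<open>nh_induced\<close> ranges over a single class, because the derivation
  preserves the ideal.
\<close>

lemma nh_induced_class:
  assumes T: "derivation T" and J: "\<And>p. p \<in> nh_ideal n \<Longrightarrow> T p \<in> nh_ideal n"
  shows "nh_induced n T (nh_class n p) = nh_class n (T p)"
proof -
  have "nh_class n (T q) = nh_class n (T p)" if "q \<in> nh_class n p" for q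
    using that J[of "q - p"] by (simp add: nh_class_iff nh_class_eq_iff nh_eq_def derivation_diff[OF T])
  moreover have "p \<in> nh_class n p" by (simp add: nh_class_iff)
  ultimately show ?thesis unfolding nh_induced_def by blast
qed

lemma nh_d_class: "nh_d n (nh_class n p) = nh_class n (free_der d_gen p)"
  unfolding nh_d_def by (rule nh_induced_class[OF derivation_free_der free_d_nh_ideal])

lemma nh_z_class: "nh_z n (nh_class n p) = nh_class n (free_der z_gen p)"
  unfolding nh_z_def by (rule nh_induced_class[OF derivation_free_der free_z_nh_ideal])

lemma nh_h_class: "nh_h n (nh_class n p) = nh_class n (free_h p)"
  unfolding nh_h_def by (rule nh_induced_class[OF derivation_free_h free_h_nh_ideal])

section \<open>Homogeneous components\<close>

definition free_component :: "int \<Rightarrow> free_nh \<Rightarrow> free_nh" where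
  "free_component k = frag_extend (\<lambda>w. if word_degree w = k then frag_of w else 0)"

lemma free_component_zero [simp]: "free_component k 0 = 0"
  by (simp add: free_component_def)

lemma free_component_diff: "free_component k (p - q) = free_component k p - free_component k q"
  by (simp add: free_component_def frag_extend_diff)

lemma free_component_add: "free_component k (p + q) = free_component k p + free_component k q"
  by (simp add: free_component_def frag_extend_add)

lemma free_component_sum: "free_component k (sum f I) = (\<Sum>i\<in>I. free_component k (f i))"
  by (induction I rule: infinite_finite_induct) (simp_all add: free_component_add)

lemma free_component_word:
  "free_component k (word_mon gs) = (if word_degree (Word gs) = k then word_mon gs else 0)"
  by (simp add: free_component_def word_mon_def)

lemma free_component_homogeneous:
  assumes "free_homogeneous j p"
  shows "free_component k p = (if j = k then p else 0)"
proof (cases "j = k")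
  case True
  have "free_component k p = frag_extend frag_of p"
    unfolding free_component_def by (rule frag_extend_eq) (use assms True in \<open>auto simp: free_homogeneous_def\<close>)
  then show ?thesis using True frag_expansion[of p] by simp
next
  case False
  then show ?thesis
    unfolding free_component_def using assms
    by (auto intro!: frag_extend_eq_0 simp: free_homogeneous_def)
qed

lemma homogeneous_free_component: "free_homogeneous k (free_component k p)"
  using keys_frag_extend[of "\<lambda>w. if word_degree w = k then frag_of w else 0" p]
  unfolding free_homogeneous_def free_component_def by (fastforce split: if_splits)

lemma free_component_FA: "p \<in> FA n \<Longrightarrow> free_component k p \<in> FA n"
  using keys_frag_extend[of "\<lambda>w. if word_degree w = k then frag_of w else 0" p]
  unfolding FA_iff free_component_def by (fastforce split: if_splits)

lemma free_component_outside: "k \<notin> word_degree ` Poly_Mapping.keys p \<Longrightarrow> free_component k p = 0"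
  unfolding free_component_def by (rule frag_extend_eq_0) auto

lemma sum_free_component:
  assumes "finite K" "word_degree ` Poly_Mapping.keys p \<subseteq> K"
  shows "(\<Sum>k\<in>K. free_component k p) = p"
proof (rule frag_induction[of p "{w. word_degree w \<in> K}"])
  show "(\<Sum>k\<in>K. free_component k (frag_of w)) = frag_of w" if "w \<in> {w. word_degree w \<in> K}" for w
    using that assms(1) by (simp add: free_component_def)
  show "(\<Sum>k\<in>K. free_component k (p - q)) = p - q"
    if "(\<Sum>k\<in>K. free_component k p) = p" "(\<Sum>k\<in>K. free_component k q) = q" for p q
    using that by (simp add: free_component_diff sum_subtractf)
qed (use assms in auto)

lemma free_component_word_mult:
  "free_component k (word_mon gs * p) = word_mon gs * free_component (k - word_degree (Word gs)) p"
  by (induction p rule: free_induct)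
     (auto simp: free_component_diff free_component_word algebra_simps simp flip: word_mon_append)

lemma free_component_mult_word:
  "free_component k (p * word_mon gs) = free_component (k - word_degree (Word gs)) p * word_mon gs"
  by (induction p rule: free_induct)
     (auto simp: free_component_diff free_component_word algebra_simps simp flip: word_mon_append)

text \<open>
  The defining relations are homogeneous, and multiplication by a word only shifts the index of a
  component.
\<close>

lemma free_component_nh_ideal: "p \<in> nh_ideal n \<Longrightarrow> free_component k p \<in> nh_ideal n"
proof (induction arbitrary: k rule: nh_ideal_induct)
  case (rel r)
  then obtain j where "free_homogeneous j r" using nh_rels_homogeneous by blast
  then show ?case using rel by (simp add: free_component_homogeneous nh_rel_ideal)
next
  case (lmult a p)
  from lmult(1) show ?case
    by (induction a rule: FA_induct)
       (simp_all add: free_component_word_mult free_component_diff left_diff_distrib nh_ideal_diff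
         nh_ideal_lmult word_mon_FA lmult.IH)
next
  case (rmult a p)
  from rmult(1) show ?case
    by (induction a rule: FA_induct)
       (simp_all add: free_component_mult_word free_component_diff right_diff_distrib nh_ideal_diff
         nh_ideal_rmult word_mon_FA rmult.IH)
qed (simp_all add: free_component_add nh_ideal_add)

lemma nh_grading_def': "nh_grading n k = nh_class n ` {p \<in> FA n. free_homogeneous k p}"
  by (simp add: nh_grading_def free_homogeneous_def)

section \<open>Independence of the reduced word\<close>

abbreviation partial_word :: "nat list \<Rightarrow> free_nh" where
  "partial_word ks \<equiv> word_mon (map D ks)"

lemma partial_word_Cons: "partial_word (k # ks) = dg k * partial_word ks"
  using word_mon_Cons[of "D k" "map D ks"] by simp

lemma partial_word_FA: "set ks \<subseteq> {1..<n} \<Longrightarrow> partial_word ks \<in> FA n"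
  by (rule word_mon_FA) (auto simp: nh_gens_def)

lemma nh_eq_far: "i \<in> {1..<n} \<Longrightarrow> j \<in> {1..<n} \<Longrightarrow> \<bar>int i - int j\<bar> > 1 \<Longrightarrow> nh_eq n (dg i * dg j) (dg j * dg i)"
  unfolding nh_eq_def by (rule nh_rel_far)

lemma nh_eq_braid: "i \<in> {1..<n} \<Longrightarrow> j \<in> {1..<n} \<Longrightarrow> j = Suc i \<or> i = Suc j \<Longrightarrow>
    nh_eq n (dg i * dg j * dg i) (dg j * dg i * dg j)"
  using nh_rel_braid[of i n] nh_rel_braid[of j n] by (auto simp: nh_eq_def intro: nh_eq_sym[unfolded nh_eq_def])

lemma sref_far_commute: "\<bar>int i - int j\<bar> > 1 \<Longrightarrow> sref i \<circ> (sref j \<circ> w) = sref j \<circ> (sref i \<circ> w)"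
  by (auto simp: fun_eq_iff transpose_def)

lemma sref_braid: "j = Suc i \<or> i = Suc j \<Longrightarrow>
    sref i \<circ> (sref j \<circ> (sref i \<circ> w)) = sref j \<circ> (sref i \<circ> (sref j \<circ> w))"
  by (auto simp: fun_eq_iff transpose_def)

text \<open>
  Matsumoto's theorem for the symmetric group, by induction on the length. If two reduced words of \<open>w\<close>
  begin with \<open>k\<close> and \<open>j\<close>, then both are left descents of \<open>w\<close>. According to whether \<open>k\<close> and \<open>j\<close> are equal,
  distant or adjacent, \<open>w\<close> has reduced words that begin with \<open>k\<close>, with \<open>k j\<close> and \<open>j k\<close>, or with \<open>k j k\<close> and
  \<open>j k j\<close>, and that agree afterwards. These two are equal or equivalent by one relation, and the induction hypothesis
  compares each of them with the given word that has the same first letter.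
\<close>

lemma reduced_words_nh_eq:
  "w \<in> symm_group n \<Longrightarrow> reduced_expression n w ks \<Longrightarrow> reduced_expression n w js \<Longrightarrow>
    nh_eq n (partial_word ks) (partial_word js)"
proof (induction "inversions n w" arbitrary: w ks js rule: less_induct)
  case less
  note w = less.prems(1)
  have len: "length ks = inversions n w" "length js = inversions n w"
    using less.prems by (simp_all add: reduced_expression_iff)
  show ?case
  proof (cases "inversions n w")
    case 0
    then show ?thesis using len by simp
  next
    case (Suc l)
    then obtain k ks' j js' where ks: "ks = k # ks'" and js: "js = j # js'"
      using len by (cases ks; cases js) auto
    have k: "k \<in> {1..<n}" "reduced_expression n (sref k \<circ> w) ks'" "perm_inv w (Suc k) < perm_inv w k"
      using reduced_expression_Cons[OF w] less.prems(2) ks by auto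
    have j: "j \<in> {1..<n}" "reduced_expression n (sref j \<circ> w) js'" "perm_inv w (Suc j) < perm_inv w j"
      using reduced_expression_Cons[OF w] less.prems(3) js by auto
    have kw: "sref k \<circ> w \<in> symm_group n" "inversions n (sref k \<circ> w) < inversions n w"
      using w k inversions_sref_comp_descent[OF w k(1,3)] by (simp_all add: comp_symm_group sref_symm_group)
    have jw: "sref j \<circ> w \<in> symm_group n" "inversions n (sref j \<circ> w) < inversions n w"
      using w j inversions_sref_comp_descent[OF w j(1,3)] by (simp_all add: comp_symm_group sref_symm_group)
    have IHk: "nh_eq n (partial_word ks) (dg k * partial_word c)" if "reduced_expression n (sref k \<circ> w) c" for c
      unfolding ks partial_word_Cons
      using less.hyps[OF kw(2) kw(1) k(2) that] k(1) by (intro nh_eq_lmult) auto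
    have IHj: "nh_eq n (partial_word js) (dg j * partial_word c)" if "reduced_expression n (sref j \<circ> w) c" for c
      unfolding js partial_word_Cons
      using less.hyps[OF jw(2) jw(1) j(2) that] j(1) by (intro nh_eq_lmult) auto
    have F: "dg k \<in> FA n" "dg j \<in> FA n" using k(1) j(1) by auto
    have red_FA: "partial_word c \<in> FA n" if "reduced_expression n v c" for v c
      using that by (intro partial_word_FA) (simp add: reduced_expression_def expression_def)
    consider "k = j" | "\<bar>int k - int j\<bar> > 1" | "j = Suc k \<or> k = Suc j" by linarith
    then show ?thesis
    proof cases
      case 1
      have "nh_eq n (partial_word js) (dg j * partial_word js')" unfolding js partial_word_Cons by (rule nh_eq_refl)
      then show ?thesis using nh_eq_trans[OF IHk[of js'] nh_eq_sym] j(2) 1 by simp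
    next
      case 2
      let ?u = "sref j \<circ> (sref k \<circ> w)"
      have u: "?u \<in> symm_group n" by (rule comp_symm_group[OF sref_symm_group[OF j(1)] kw(1)])
      obtain c where c: "reduced_expression n ?u c" using ex_reduced_expression[OF u] by blast
      have r1: "reduced_expression n (sref k \<circ> w) (j # c)"
        using 2 j(3) c by (intro reduced_expression_ConsI[OF kw(1) j(1)]) (auto simp: inv_sref_comp[OF w])
      have r2: "reduced_expression n (sref j \<circ> w) (k # c)"
        using 2 k(3) c sref_far_commute[OF 2, of w]
        by (intro reduced_expression_ConsI[OF jw(1) k(1)]) (auto simp: inv_sref_comp[OF w])
      have m: "nh_eq n (dg k * partial_word (j # c)) (dg j * partial_word (k # c))"
        using nh_eq_rmult[OF red_FA[OF c] nh_eq_far[OF k(1) j(1) 2]] by (simp only: partial_word_Cons mult.assoc)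
      show ?thesis by (rule nh_eq_trans[OF IHk[OF r1] nh_eq_trans[OF m nh_eq_sym[OF IHj[OF r2]]]])
    next
      case 3
      let ?u = "sref k \<circ> (sref j \<circ> (sref k \<circ> w))"
      have jkw: "sref j \<circ> (sref k \<circ> w) \<in> symm_group n"
        by (rule comp_symm_group[OF sref_symm_group[OF j(1)] kw(1)])
      have kjw: "sref k \<circ> (sref j \<circ> w) \<in> symm_group n"
        by (rule comp_symm_group[OF sref_symm_group[OF k(1)] jw(1)])
      have u: "?u \<in> symm_group n" by (rule comp_symm_group[OF sref_symm_group[OF k(1)] jkw])
      have u': "?u = sref j \<circ> (sref k \<circ> (sref j \<circ> w))" using 3 by (intro sref_braid) auto
      obtain c where c: "reduced_expression n ?u c" using ex_reduced_expression[OF u] by blast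
      have "reduced_expression n (sref j \<circ> (sref k \<circ> w)) (k # c)"
        using 3 j(3) k(3) c
        by (intro reduced_expression_ConsI[OF jkw k(1)]) (auto simp: inv_sref_comp[OF w] inv_sref_comp[OF kw(1)])
      then have r1: "reduced_expression n (sref k \<circ> w) (j # k # c)"
        using 3 j(3) k(3)
        by (intro reduced_expression_ConsI[OF kw(1) j(1)]) (auto simp: inv_sref_comp[OF w])
      have "reduced_expression n (sref k \<circ> (sref j \<circ> w)) (j # c)"
        using 3 j(3) k(3) c u'
        by (intro reduced_expression_ConsI[OF kjw j(1)]) (auto simp: inv_sref_comp[OF w] inv_sref_comp[OF jw(1)])
      then have r2: "reduced_expression n (sref j \<circ> w) (k # j # c)"
        using 3 j(3) k(3)
        by (intro reduced_expression_ConsI[OF jw(1) k(1)]) (auto simp: inv_sref_comp[OF w])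
      have m: "nh_eq n (dg k * partial_word (j # k # c)) (dg j * partial_word (k # j # c))"
        using nh_eq_rmult[OF red_FA[OF c] nh_eq_braid[OF k(1) j(1) 3]] by (simp only: partial_word_Cons mult.assoc)
      show ?thesis by (rule nh_eq_trans[OF IHk[OF r1] nh_eq_trans[OF m nh_eq_sym[OF IHj[OF r2]]]])
    qed
  qed
qed

text \<open>
  The choice of the reduced word is the one made for \<open>nh_psi\<close>, of which this is a representative.
\<close>

definition psi :: "nat \<Rightarrow> (nat \<Rightarrow> nat) \<Rightarrow> free_nh" where
  "psi n w = partial_word (SOME ks. reduced_expression n w ks)"

lemma psi_nh_eq:
  assumes "w \<in> symm_group n" "reduced_expression n w ks"
  shows "nh_eq n (psi n w) (partial_word ks)"
  unfolding psi_def
  by (rule reduced_words_nh_eq[OF assms(1) someI assms(2)]) (fact assms(2))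

lemma psi_some:
  assumes "w \<in> symm_group n"
  obtains ks where "reduced_expression n w ks" "psi n w = partial_word ks"
  using someI_ex[OF ex_reduced_expression[OF assms]] unfolding psi_def by blast

lemma psi_FA: "w \<in> symm_group n \<Longrightarrow> psi n w \<in> FA n"
  by (metis psi_some partial_word_FA reduced_expression_iff)

lemma psi_id: "nh_eq n (psi n id) 1"
  using psi_nh_eq[of id n "[]"] by (simp add: reduced_expression_iff)

lemma psi_sref_comp:
  assumes w: "w \<in> symm_group n" and k: "k \<in> {1..<n}" and up: "inversions n w < inversions n (sref k \<circ> w)"
  shows "nh_eq n (dg k * psi n w) (psi n (sref k \<circ> w))"
proof -
  obtain ks where ks: "reduced_expression n w ks" "psi n w = partial_word ks" using psi_some[OF w] .
  have "inversions n (sref k \<circ> w) = Suc (inversions n w)"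
    using inversions_sref_comp_cases[OF w k] up by auto
  moreover have kw: "sref k \<circ> w \<in> symm_group n" using w k by (simp add: comp_symm_group sref_symm_group)
  ultimately have "reduced_expression n (sref k \<circ> w) (k # ks)"
    using ks(1) k by (simp add: reduced_expression_iff[OF w] reduced_expression_iff[OF kw])
  then show ?thesis using psi_nh_eq[OF kw] ks(2) partial_word_Cons nh_eq_sym by metis
qed

lemma psi_comp_sref:
  assumes w: "w \<in> symm_group n" and k: "k \<in> {1..<n}" and up: "inversions n w < inversions n (w \<circ> sref k)"
  shows "nh_eq n (psi n w * dg k) (psi n (w \<circ> sref k))"
proof -
  obtain ks where ks: "reduced_expression n w ks" "psi n w = partial_word ks" using psi_some[OF w] .
  have "inversions n (w \<circ> sref k) = Suc (inversions n w)"
    using inversions_comp_sref_cases[OF w k] up by auto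
  moreover have kw: "w \<circ> sref k \<in> symm_group n" using w k by (simp add: comp_symm_group sref_symm_group)
  ultimately have "reduced_expression n (w \<circ> sref k) (ks @ [k])"
    using ks(1) k by (simp add: reduced_expression_iff[OF w] reduced_expression_iff[OF kw] simple_prod_append)
  then have "nh_eq n (psi n (w \<circ> sref k)) (partial_word (ks @ [k]))" using psi_nh_eq[OF kw] by blast
  then show ?thesis using ks(2) nh_eq_sym by (simp add: word_mon_append)
qed

text \<open>
  Here \<open>\<psi> w\<close> begins with \<open>D k\<close> up to equivalence, and \<open>D k\<close> squares to zero.
\<close>

lemma psi_sref_comp_zero:
  assumes w: "w \<in> symm_group n" and k: "k \<in> {1..<n}" and down: "inversions n (sref k \<circ> w) < inversions n w"
  shows "nh_eq n (dg k * psi n w) 0"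
proof -
  let ?v = "sref k \<circ> w"
  have v: "?v \<in> symm_group n" using w k by (simp add: comp_symm_group sref_symm_group)
  have "nh_eq n (dg k * (dg k * psi n ?v)) (dg k * psi n w)"
    using psi_sref_comp[OF v k] down k by (intro nh_eq_lmult) simp_all
  moreover have "nh_eq n (dg k * (dg k * psi n ?v)) 0"
    using nh_ideal_rmult[OF nh_rel_dd[OF k] psi_FA[OF v]] by (simp add: nh_eq_0_iff mult.assoc)
  ultimately show ?thesis using nh_eq_sym nh_eq_trans by blast
qed

lemma psi_comp_sref_zero:
  assumes w: "w \<in> symm_group n" and k: "k \<in> {1..<n}" and down: "inversions n (w \<circ> sref k) < inversions n w"
  shows "nh_eq n (psi n w * dg k) 0"
proof -
  let ?v = "w \<circ> sref k"
  have v: "?v \<in> symm_group n" using w k by (simp add: comp_symm_group sref_symm_group)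
  have "nh_eq n (psi n ?v * dg k * dg k) (psi n w * dg k)"
    using psi_comp_sref[OF v k] down k by (intro nh_eq_rmult) simp_all
  moreover have "nh_eq n (psi n ?v * dg k * dg k) 0"
    using nh_ideal_lmult[OF psi_FA[OF v] nh_rel_dd[OF k]] by (simp add: nh_eq_0_iff mult.assoc)
  ultimately show ?thesis using nh_eq_sym nh_eq_trans by blast
qed

section \<open>The polynomial ring\<close>

lemma frag_induct [case_names zero one diff]:
  fixes p :: "'a \<Rightarrow>\<^sub>0 int"
  assumes "Q 0" "\<And>a. Q (frag_of a)" "\<And>p q. Q p \<Longrightarrow> Q q \<Longrightarrow> Q (p - q)"
  shows "Q p"
  by (rule frag_induction[of p UNIV Q]) (use assms in auto)

abbreviation PR :: "nat \<Rightarrow> polyn set" where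
  "PR n \<equiv> carrier (poly_ring n)"

lemma PR_iff: "r \<in> PR n \<longleftrightarrow> (\<forall>a\<in>Poly_Mapping.keys r. Poly_Mapping.keys a \<subseteq> {1..n})"
  by (simp add: poly_ring_def)

lemma poly_ring_simps [simp]:
  "mult (poly_ring n) = (*)" "add (poly_ring n) = (+)"
  "one (poly_ring n) = 1" "zero (poly_ring n) = 0"
  by (simp_all add: poly_ring_def)

lemma keys_one_poly [simp]: "Poly_Mapping.keys (1 :: polyn) = {0}"
  by (metis keys_single single_one zero_neq_one)

lemma PR_zero [simp]: "0 \<in> PR n"
  by (simp add: PR_iff)

lemma PR_one [simp]: "1 \<in> PR n"
  by (simp add: PR_iff)

lemma PR_add [simp]: "p \<in> PR n \<Longrightarrow> q \<in> PR n \<Longrightarrow> p + q \<in> PR n"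
  using keys_add[of p q] by (auto simp: PR_iff)

lemma PR_uminus [simp]: "p \<in> PR n \<Longrightarrow> - p \<in> PR n"
  by (simp add: PR_iff)

lemma PR_diff [simp]: "p \<in> PR n \<Longrightarrow> q \<in> PR n \<Longrightarrow> p - q \<in> PR n"
  using PR_add[of p n "- q"] by simp

lemma PR_mult [simp]:
  assumes "p \<in> PR n" "q \<in> PR n"
  shows "p * q \<in> PR n"
  unfolding PR_iff
proof
  fix c assume "c \<in> Poly_Mapping.keys (p * q)"
  then obtain a b where "c = a + b" "a \<in> Poly_Mapping.keys p" "b \<in> Poly_Mapping.keys q"
    using keys_mult[of p q] by auto
  then show "Poly_Mapping.keys c \<subseteq> {1..n}"
    using keys_add[of a b] assms unfolding PR_iff by blast
qed

lemma PR_power [simp]: "p \<in> PR n \<Longrightarrow> p ^ k \<in> PR n"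
  by (induction k) auto

lemma PR_sum: "(\<And>i. i \<in> I \<Longrightarrow> f i \<in> PR n) \<Longrightarrow> sum f I \<in> PR n"
  by (induction I rule: infinite_finite_induct) auto

lemma PR_pvar [simp]: "i \<in> {1..n} \<Longrightarrow> pvar i \<in> PR n"
  by (simp add: PR_iff pvar_def)

lemma poly_ring_cring: "cring (poly_ring n)"
proof (rule cringI)
  show "abelian_group (poly_ring n)"
    by (rule abelian_groupI) (auto simp: algebra_simps intro: bexI[of _ "- x" for x])
  show "comm_monoid (poly_ring n)"
    by (rule comm_monoidI) (auto simp: algebra_simps)
qed (auto simp: algebra_simps)

lemma frag_of_add_exp: "frag_of (a + b) = (frag_of a * frag_of b :: polyn)"
  by (simp add: mult_single)

text \<open>
  Suited to maps that are determined by their values on variables: products are reached by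
  multiplying with one variable at a time.
\<close>

lemma PR_induct [consumes 1, case_names one pvar diff]:
  assumes r: "r \<in> PR n" and one: "Q 1"
    and pvar: "\<And>i r. i \<in> {1..n} \<Longrightarrow> r \<in> PR n \<Longrightarrow> Q r \<Longrightarrow> Q (pvar i * r)"
    and diff: "\<And>r s. r \<in> PR n \<Longrightarrow> s \<in> PR n \<Longrightarrow> Q r \<Longrightarrow> Q s \<Longrightarrow> Q (r - s)"
  shows "Q r"
proof -
  have mon: "Q (frag_of a)" if "Poly_Mapping.keys a \<subseteq> {1..n}" for a
    using that
  proof (induction "\<Sum>i\<in>{1..n}. Poly_Mapping.lookup a i" arbitrary: a rule: less_induct)
    case less
    show ?case
    proof (cases "a = 0")
      case True
      then show ?thesis using one by simp
    next
      case False
      then obtain i where i: "i \<in> Poly_Mapping.keys a" by (metis all_not_in_conv keys_eq_empty)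
      define b where "b = a - Poly_Mapping.single i 1"
      have pos: "Poly_Mapping.lookup a i > 0" using i by (simp add: in_keys_iff)
      have a: "a = Poly_Mapping.single i 1 + b"
        by (rule poly_mapping_eqI) (use pos in \<open>auto simp: b_def lookup_add lookup_minus lookup_single when_def\<close>)
      have sub: "Poly_Mapping.keys b \<subseteq> {1..n}"
        using less.prems by (auto simp: a in_keys_iff lookup_add)
      have "(\<Sum>i\<in>{1..n}. Poly_Mapping.lookup b i) < (\<Sum>i\<in>{1..n}. Poly_Mapping.lookup a i)"
      proof (rule sum_strict_mono_ex1)
        show "\<exists>j\<in>{1..n}. Poly_Mapping.lookup b j < Poly_Mapping.lookup a j"
          using i less.prems pos by (intro bexI[of _ i]) (auto simp: b_def lookup_minus)
      qed (simp_all add: b_def lookup_minus)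
      then have "Q (frag_of b)" using less.hyps sub by blast
      moreover have "i \<in> {1..n}" using less.prems i by blast
      moreover have "frag_of b \<in> PR n" using sub by (simp add: PR_iff)
      ultimately have "Q (pvar i * frag_of b)" by (intro pvar)
      then show ?thesis by (simp add: a frag_of_add_exp pvar_def)
    qed
  qed
  have "Q r \<and> r \<in> PR n"
  proof (rule frag_induction[of r "{a. Poly_Mapping.keys a \<subseteq> {1..n}}"])
    show "Poly_Mapping.keys r \<subseteq> {a. Poly_Mapping.keys a \<subseteq> {1..n}}" using r by (auto simp: PR_iff)
    show "Q 0 \<and> 0 \<in> PR n" using diff[OF PR_one PR_one one one] by simp
    show "Q (frag_of a) \<and> frag_of a \<in> PR n" if "a \<in> {a. Poly_Mapping.keys a \<subseteq> {1..n}}" for a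
      using that mon[of a] by (simp add: PR_iff)
    show "Q (p - q) \<and> p - q \<in> PR n" if "Q p \<and> p \<in> PR n" "Q q \<and> q \<in> PR n" for p q
      using that diff[of p q] by simp
  qed
  then show ?thesis ..
qed

lemma exp_degree_add: "exp_degree (a + b) = exp_degree a + exp_degree b"
proof -
  let ?S = "Poly_Mapping.keys a \<union> Poly_Mapping.keys b"
  have "exp_degree c = 2 * (\<Sum>i\<in>?S. int (Poly_Mapping.lookup c i))" if "Poly_Mapping.keys c \<subseteq> ?S" for c
    unfolding exp_degree_def
    by (intro arg_cong[where f = "(*) 2"] sum.mono_neutral_left) (use that in \<open>auto simp: in_keys_iff\<close>)
  then show ?thesis
    using keys_add[of a b] by (simp add: lookup_add sum.distrib)
qed

lemma pdiff_diff: "pdiff i (r - s) = pdiff i r - pdiff i s"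
  by (simp add: pdiff_def frag_extend_diff)

lemma pdiff_one: "pdiff i 1 = 0"
proof -
  have "pdiff i (frag_of 0) = 0" unfolding pdiff_def frag_extend_of by simp
  then show ?thesis by simp
qed

lemma pdiff_pvar_mult: "pdiff j (pvar i * r) = (if i = j then r else 0) + pvar i * pdiff j r"
proof (induction r rule: frag_induct)
  case (one a)
  have "pdiff j (pvar i * frag_of a) =
      Poly_Mapping.single (Poly_Mapping.single i 1 + a - Poly_Mapping.single j 1)
        (int (Poly_Mapping.lookup (Poly_Mapping.single i 1 + a) j))"
    by (simp add: pvar_def mult_single pdiff_def)
  also have "\<dots> = (if i = j then frag_of a else 0) + pvar i * pdiff j (frag_of a)"
  proof (cases "i = j")
    case True
    have "Poly_Mapping.single i 1 + a - Poly_Mapping.single i 1 = a" by simp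
    moreover have "Poly_Mapping.single i 1 + (a - Poly_Mapping.single i 1) = a"
      if "Poly_Mapping.lookup a i > 0"
      by (rule poly_mapping_eqI) (use that in \<open>auto simp: lookup_add lookup_minus lookup_single when_def\<close>)
    ultimately show ?thesis
      using True by (cases "Poly_Mapping.lookup a i = 0")
        (auto simp: pvar_def pdiff_def mult_single lookup_add simp flip: single_add)
  next
    case False
    have "Poly_Mapping.single i 1 + a - Poly_Mapping.single j 1 =
        Poly_Mapping.single i 1 + (a - Poly_Mapping.single j 1)"
      by (rule poly_mapping_eqI) (use False in \<open>auto simp: lookup_add lookup_minus lookup_single when_def\<close>)
    then show ?thesis
      using False by (simp add: pvar_def pdiff_def mult_single lookup_add lookup_single)
  qed
  finally show ?case .
qed (auto simp: pdiff_diff algebra_simps, simp_all add: pdiff_def)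

lemma PR_pdiff: "r \<in> PR n \<Longrightarrow> pdiff i r \<in> PR n"
  by (induction r rule: PR_induct) (auto simp: pdiff_one pdiff_pvar_mult pdiff_diff)

section \<open>Polynomials inside the nilHecke algebra\<close>

text \<open>
  A representative of \<open>nh_of_poly\<close>. It is additive but multiplicative only modulo the ideal, since
  \<open>exp_word\<close> lists the variables in increasing order.
\<close>

definition lift :: "nat \<Rightarrow> polyn \<Rightarrow> free_nh" where
  "lift n = frag_extend (\<lambda>a. word_mon (exp_word n a))"

lemma nh_of_poly_lift: "nh_of_poly n r = nh_class n (lift n r)"
  by (simp add: nh_of_poly_def lift_def)

lemma exp_word_gens: "set (exp_word n a) \<subseteq> nh_gens n"
  by (auto simp: exp_word_def nh_gens_def)

lemma lift_zero [simp]: "lift n 0 = 0"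
  and lift_add: "lift n (r + s) = lift n r + lift n s"
  and lift_diff: "lift n (r - s) = lift n r - lift n s"
  by (simp_all add: lift_def frag_extend_add frag_extend_diff)

lemma lift_mon: "lift n (frag_of a) = word_mon (exp_word n a)"
  by (simp add: lift_def)

lemma lift_one [simp]: "lift n 1 = 1"
proof -
  have "exp_word n 0 = []" by (simp add: exp_word_def concat_eq_Nil_conv del: upt_Suc)
  then have "lift n (frag_of 0) = 1" by (simp only: lift_mon word_mon_Nil)
  then show ?thesis by simp
qed

lemma lift_FA [simp]: "lift n r \<in> FA n"
proof (induction r rule: frag_induct)
  case (one a)
  then show ?case by (simp add: lift_mon word_mon_FA[OF exp_word_gens])
qed (simp_all add: lift_diff)

lemma word_mon_exp_word:
  "word_mon (exp_word n a) = prod_list (map (\<lambda>i. xg i ^ Poly_Mapping.lookup a i) [1..<Suc n])"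
proof -
  have "word_mon (concat (map (\<lambda>i. replicate (Poly_Mapping.lookup a i) (X i)) is)) =
      prod_list (map (\<lambda>i. xg i ^ Poly_Mapping.lookup a i) is)" for "is"
  proof (induction "is")
    case (Cons i "is")
    have "word_mon (replicate k (X i)) = xg i ^ k" for k
      by (induction k) (simp, metis replicate_Suc word_mon_Cons power_Suc)
    then show ?case using Cons by (simp add: word_mon_append)
  qed simp
  then show ?thesis by (simp add: exp_word_def)
qed

lemma lift_pvar [simp]:
  assumes "i \<in> {1..n}"
  shows "lift n (pvar i) = xg i"
proof -
  have "lift n (pvar i) = prod_list (map (\<lambda>j. xg j ^ Poly_Mapping.lookup (Poly_Mapping.single i 1) j) [1..<Suc n])"
    by (simp only: pvar_def lift_mon word_mon_exp_word)
  also have "[1..<Suc n] = [1..<i] @ i # [Suc i..<Suc n]"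
    using assms upt_add_eq_append[of 1 i "Suc n - i"] upt_conv_Cons[of i "Suc n"] by (simp del: upt_Suc)
  also have "prod_list (map (\<lambda>j. xg j ^ Poly_Mapping.lookup (Poly_Mapping.single i 1) j) \<dots>) = xg i"
  proof -
    have one: "prod_list (map (\<lambda>j. xg j ^ Poly_Mapping.lookup (Poly_Mapping.single i 1) j) is) = 1"
      if "i \<notin> set is" for "is"
      using that by (induction "is") (auto simp: lookup_single)
    show ?thesis
      using one[of "[1..<i]"] one[of "[Suc i..<Suc n]"] by (simp del: upt_Suc)
  qed
  finally show ?thesis .
qed

lemma nh_commute_power:
  assumes "x \<in> FA n" "y \<in> FA n" "nh_eq n (x * y) (y * x)"
  shows "nh_eq n (x ^ k * y) (y * x ^ k)"
proof (induction k)
  case (Suc k)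
  have "nh_eq n (x * (x ^ k * y)) (x * (y * x ^ k))"
    using Suc assms by (intro nh_eq_lmult)
  moreover have "nh_eq n (x * y * x ^ k) (y * x * x ^ k)"
    using assms by (intro nh_eq_rmult) auto
  ultimately show ?case by (simp add: mult.assoc) (erule (1) nh_eq_trans)
qed simp

lemma nh_commute_prod_list:
  assumes y: "y \<in> FA n" and fs: "\<And>x. x \<in> set xs \<Longrightarrow> x \<in> FA n \<and> nh_eq n (x * y) (y * x)"
  shows "prod_list xs \<in> FA n \<and> nh_eq n (prod_list xs * y) (y * prod_list xs)"
  using fs
proof (induction xs)
  case (Cons x xs)
  then have IH: "prod_list xs \<in> FA n" "nh_eq n (prod_list xs * y) (y * prod_list xs)"
    and x: "x \<in> FA n" "nh_eq n (x * y) (y * x)" by auto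
  have "nh_eq n (x * (prod_list xs * y)) (x * (y * prod_list xs))"
    using IH x by (intro nh_eq_lmult)
  moreover have "nh_eq n (x * y * prod_list xs) (y * x * prod_list xs)"
    using IH x by (intro nh_eq_rmult) auto
  ultimately show ?case using IH x by (simp add: mult.assoc) (erule (1) nh_eq_trans)
qed simp

lemma nh_eq_xx: "i \<in> {1..n} \<Longrightarrow> j \<in> {1..n} \<Longrightarrow> nh_eq n (xg i * xg j) (xg j * xg i)"
  unfolding nh_eq_def by (rule nh_rel_xx)

text \<open>
  On monomials, the powers of the variables have to be reordered, which the commutation relations
  permit; the rest is biadditivity.
\<close>

lemma lift_mult: "nh_eq n (lift n (r * s)) (lift n r * lift n s)"
proof -
  have list: "nh_eq n (prod_list (map (\<lambda>i. xg i ^ (f i + g i)) is))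
      (prod_list (map (\<lambda>i. xg i ^ f i) is) * prod_list (map (\<lambda>i. xg i ^ g i) is))"
    if "set is \<subseteq> {1..n}" for f g :: "nat \<Rightarrow> nat" and "is"
    using that
  proof (induction "is")
    case (Cons i "is")
    have i: "i \<in> {1..n}" "set is \<subseteq> {1..n}" using Cons.prems by auto
    let ?F = "prod_list (map (\<lambda>i. xg i ^ f i) is)" and ?G = "prod_list (map (\<lambda>i. xg i ^ g i) is)"
    have pow: "nh_eq n (xg j ^ f j * xg i ^ g i) (xg i ^ g i * xg j ^ f j)" if "j \<in> set is" for j
    proof -
      have j: "xg j \<in> FA n" "xg i ^ g i \<in> FA n" using that i by auto
      have "nh_eq n (xg i ^ g i * xg j) (xg j * xg i ^ g i)"
        using that i by (intro nh_commute_power nh_eq_xx) auto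
      then show ?thesis by (rule nh_commute_power[OF j nh_eq_sym])
    qed
    have xi: "xg i \<in> FA n" using i by simp
    have F': "?F \<in> FA n \<and> nh_eq n (?F * xg i ^ g i) (xg i ^ g i * ?F)"
    proof (rule nh_commute_prod_list)
      show "xg i ^ g i \<in> FA n" using xi by (rule FA_power)
      fix x assume "x \<in> set (map (\<lambda>j. xg j ^ f j) is)"
      then obtain j where "j \<in> set is" "x = xg j ^ f j" by auto
      moreover have "xg j \<in> FA n" if "j \<in> set is" for j using that i by auto
      ultimately show "x \<in> FA n \<and> nh_eq n (x * xg i ^ g i) (xg i ^ g i * x)"
        using pow by (simp only: FA_power simp_thms)
    qed
    then have F: "?F \<in> FA n" "nh_eq n (?F * xg i ^ g i) (xg i ^ g i * ?F)" by auto
    have G: "?G \<in> FA n"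
    proof -
      have "?G \<in> FA n \<and> nh_eq n (?G * 1) (1 * ?G)"
      proof (rule nh_commute_prod_list)
        fix x assume "x \<in> set (map (\<lambda>j. xg j ^ g j) is)"
        then obtain j where "j \<in> set is" "x = xg j ^ g j" by auto
        then show "x \<in> FA n \<and> nh_eq n (x * 1) (1 * x)" using i by auto
      qed simp
      then show ?thesis ..
    qed
    have "nh_eq n (xg i ^ f i * xg i ^ g i * prod_list (map (\<lambda>i. xg i ^ (f i + g i)) is))
        (xg i ^ f i * xg i ^ g i * (?F * ?G))"
      using Cons.IH i by (intro nh_eq_lmult) auto
    also have "nh_eq n (xg i ^ f i * xg i ^ g i * (?F * ?G)) (xg i ^ f i * (?F * xg i ^ g i) * ?G)"
      using nh_eq_lmult[of "xg i ^ f i" n, OF _ nh_eq_rmult[OF G nh_eq_sym[OF F(2)]]] i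
      by (simp add: mult.assoc)
    finally show ?case by (simp add: power_add mult.assoc)
  qed simp
  have mon: "nh_eq n (lift n (frag_of a * frag_of b)) (lift n (frag_of a) * lift n (frag_of b))" for a b
    using list[of "[1..<Suc n]" "Poly_Mapping.lookup a" "Poly_Mapping.lookup b"]
    by (simp only: frag_of_add_exp[symmetric] lift_mon word_mon_exp_word lookup_add set_upt atLeastLessThanSuc_atLeastAtMost order_refl)
  have left: "nh_eq n (lift n (frag_of a * s)) (lift n (frag_of a) * lift n s)" for a
    by (induction s rule: frag_induct)
       (simp_all add: mon right_diff_distrib lift_diff nh_eq_diff)
  show ?thesis
    by (induction r rule: frag_induct)
       (simp_all add: left left_diff_distrib lift_diff nh_eq_diff)
qed

lemma lift_pvar_mult:
  assumes "i \<in> {1..n}"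
  shows "nh_eq n (lift n (pvar i * r)) (xg i * lift n r)"
  using lift_mult[of n "pvar i" r] assms by simp

text \<open>
  Two derivations along \<open>lift\<close> agree if they agree on the variables. Here \<open>c i\<close> is the prescribed
  value of \<open>t\<close> on the variable \<open>i\<close>.
\<close>

lemma derivation_lift:
  assumes T: "derivation T" and TJ: "\<And>p. p \<in> nh_ideal n \<Longrightarrow> T p \<in> nh_ideal n"
    and TA: "\<And>p. p \<in> FA n \<Longrightarrow> T p \<in> FA n"
    and t1: "t 1 = 0" and tdiff: "\<And>r s. t (r - s) = t r - t s"
    and tmult: "\<And>i r. i \<in> {1..n} \<Longrightarrow> t (pvar i * r) = c i * r + pvar i * t r"
    and gen: "\<And>i. i \<in> {1..n} \<Longrightarrow> nh_eq n (T (xg i)) (lift n (c i))"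
    and r: "r \<in> PR n"
  shows "nh_eq n (T (lift n r)) (lift n (t r))"
  using r
proof (induction r rule: PR_induct)
  case one
  then show ?case using t1 by (simp add: derivation_one[OF T])
next
  case (pvar i r)
  have "nh_eq n (T (lift n (pvar i * r))) (T (xg i * lift n r))"
    using TJ[OF lift_pvar_mult[OF pvar(1), of r, unfolded nh_eq_def]]
    by (simp add: nh_eq_def derivation_diff[OF T])
  also have "T (xg i * lift n r) = T (xg i) * lift n r + xg i * T (lift n r)"
    by (rule derivation_mult[OF T])
  also have "nh_eq n \<dots> (lift n (c i) * lift n r + xg i * lift n (t r))"
    using pvar by (intro nh_eq_add nh_eq_lmult nh_eq_rmult gen) auto
  also have "nh_eq n \<dots> (lift n (c i * r) + lift n (pvar i * t r))"
    using pvar(1) by (intro nh_eq_add) (rule nh_eq_sym[OF lift_mult], rule nh_eq_sym[OF lift_pvar_mult])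
  finally show ?case using pvar by (simp add: tmult lift_add)
next
  case (diff r s)
  then show ?case by (simp add: derivation_diff[OF T] tdiff lift_diff nh_eq_diff)
qed

lemma lift_poly_d:
  assumes "r \<in> PR n"
  shows "nh_eq n (free_der d_gen (lift n r)) (lift n (poly_d n r))"
proof (rule derivation_lift[OF derivation_free_der free_d_nh_ideal free_d_FA _ _ _ _ assms])
  show "poly_d n (pvar i * r) = pvar i ^ 2 * r + pvar i * poly_d n r" if "i \<in> {1..n}" for i r
    using that by (simp add: poly_d_def pdiff_pvar_mult distrib_left sum.distrib sum_distrib_left
        mult.left_commute if_distrib[of "(*) _"] cong: if_cong)
  show "nh_eq n (free_der d_gen (xg i)) (lift n (pvar i ^ 2))" if "i \<in> {1..n}" for i
    using that nh_eq_sym[OF lift_pvar_mult[of i n "pvar i"]] by (simp add: power2_eq_square)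
qed (simp_all add: poly_d_def pdiff_one pdiff_diff right_diff_distrib sum_subtractf)

lemma lift_poly_z:
  assumes "r \<in> PR n"
  shows "nh_eq n (free_der z_gen (lift n r)) (lift n (poly_z n r))"
proof (rule derivation_lift[OF derivation_free_der free_z_nh_ideal free_z_FA _ _ _ _ assms])
  show "poly_z n (pvar i * r) = 1 * r + pvar i * poly_z n r" if "i \<in> {1..n}" for i r
    using that by (simp add: poly_z_def pdiff_pvar_mult sum.distrib sum_distrib_left)
qed (simp_all add: poly_z_def pdiff_one pdiff_diff sum_subtractf)

lemma poly_h_diff: "poly_h (r - s) = poly_h r - poly_h s"
  by (simp add: poly_h_def frag_extend_diff)

lemma poly_h_one: "poly_h 1 = 0"
proof -
  have "poly_h (frag_of 0) = 0" unfolding poly_h_def frag_extend_of by (simp add: exp_degree_def)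
  then show ?thesis by simp
qed

lemma poly_h_pvar_mult: "poly_h (pvar i * r) = 2 * pvar i * r + pvar i * poly_h r"
proof (induction r rule: frag_induct)
  case (one a)
  have "exp_degree (Poly_Mapping.single i 1) = 2" by (simp add: exp_degree_def)
  then have "poly_h (pvar i * frag_of a) = Poly_Mapping.single (Poly_Mapping.single i 1 + a) (2 + exp_degree a)"
    by (simp add: poly_h_def pvar_def mult_single exp_degree_add)
  moreover have "2 * pvar i * frag_of a = Poly_Mapping.single (Poly_Mapping.single i 1 + a) 2"
    by (simp add: pvar_def mult_single flip: single_numeral)
  moreover have "pvar i * poly_h (frag_of a) = Poly_Mapping.single (Poly_Mapping.single i 1 + a) (exp_degree a)"
    by (simp add: poly_h_def pvar_def mult_single)
  ultimately show ?case by (simp add: single_add)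
qed (auto simp: poly_h_diff algebra_simps, simp_all add: poly_h_def)

lemma lift_poly_h:
  assumes "r \<in> PR n"
  shows "nh_eq n (free_h (lift n r)) (lift n (poly_h r))"
proof (rule derivation_lift[OF derivation_free_h free_h_nh_ideal free_h_FA _ _ _ _ assms])
  show "nh_eq n (free_h (xg i)) (lift n (2 * pvar i))" if "i \<in> {1..n}" for i
  proof -
    have "lift n (2 * pvar i) = 2 * xg i" by (simp only: mult_2 lift_add lift_pvar[OF that])
    then show ?thesis by simp
  qed
qed (simp_all add: poly_h_one poly_h_diff poly_h_pvar_mult)

lemma PR_poly_d: "r \<in> PR n \<Longrightarrow> poly_d n r \<in> PR n"
  by (auto simp: poly_d_def intro!: PR_sum PR_pdiff PR_mult)

lemma PR_poly_z: "r \<in> PR n \<Longrightarrow> poly_z n r \<in> PR n"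
  by (auto simp: poly_z_def intro!: PR_sum PR_pdiff)

lemma word_degree_exp_word:
  assumes "Poly_Mapping.keys a \<subseteq> {1..n}"
  shows "word_degree (Word (exp_word n a)) = exp_degree a"
proof -
  have "word_degree (Word (concat (map (\<lambda>i. replicate (f i) (X i)) is))) = 2 * (\<Sum>i\<leftarrow>is. int (f i))" for f "is"
    by (induction "is") (simp_all add: word_degree_def sum_list_replicate)
  then have "word_degree (Word (exp_word n a)) = 2 * (\<Sum>i\<in>{1..n}. int (Poly_Mapping.lookup a i))"
    by (simp add: exp_word_def sum_list_distinct_conv_sum_set atLeastLessThanSuc_atLeastAtMost del: upt_Suc)
  also have "\<dots> = exp_degree a"
    unfolding exp_degree_def using assms
    by (intro arg_cong[where f = "(*) 2"] sum.mono_neutral_right) (auto simp: in_keys_iff)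
  finally show ?thesis .
qed

lemma lift_homogeneous:
  assumes "r \<in> poly_grading n k"
  shows "free_homogeneous k (lift n r)"
  unfolding free_homogeneous_def
proof
  fix w assume "w \<in> Poly_Mapping.keys (lift n r)"
  then obtain a where a: "a \<in> Poly_Mapping.keys r" "w \<in> Poly_Mapping.keys (word_mon (exp_word n a))"
    using keys_frag_extend[of "\<lambda>a. word_mon (exp_word n a)" r] unfolding lift_def by blast
  then have "w = Word (exp_word n a)" by (simp add: word_mon_def)
  moreover have "Poly_Mapping.keys a \<subseteq> {1..n}" "exp_degree a = k"
    using a(1) assms by (simp_all add: poly_grading_def PR_iff)
  ultimately show "word_degree w = k" by (simp add: word_degree_exp_word)
qed

section \<open>Divided differences on the orbit of a generic point\<close>

definition frag_eval :: "('a \<Rightarrow> 'k :: comm_ring_1) \<Rightarrow> ('a \<Rightarrow>\<^sub>0 int) \<Rightarrow> 'k" where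
  "frag_eval f p = (\<Sum>a\<in>Poly_Mapping.keys p. of_int (Poly_Mapping.lookup p a) * f a)"

lemma frag_eval_superset:
  assumes "finite S" "Poly_Mapping.keys p \<subseteq> S"
  shows "frag_eval f p = (\<Sum>a\<in>S. of_int (Poly_Mapping.lookup p a) * f a)"
  unfolding frag_eval_def
  by (rule sum.mono_neutral_left) (use assms in \<open>auto simp: in_keys_iff\<close>)

lemma frag_eval_diff: "frag_eval f (p - q) = frag_eval f p - frag_eval f q"
proof -
  let ?S = "Poly_Mapping.keys p \<union> Poly_Mapping.keys q"
  have "Poly_Mapping.keys (p - q) \<subseteq> ?S" by (rule keys_diff)
  then show ?thesis
    by (simp add: frag_eval_superset[of ?S] lookup_minus left_diff_distrib sum_subtractf)
qed

lemma frag_eval_zero [simp]: "frag_eval f 0 = 0"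
  by (simp add: frag_eval_def)

lemma frag_eval_of [simp]: "frag_eval f (frag_of a) = f a"
  by (simp add: frag_eval_def)

text \<open>
  A map \<open>u\<close> stands for the point with coordinates \<open>x (u 1), x (u 2), ...\<close> over the field of rational
  functions. Thus \<open>id\<close> is the generic point, and permutations give the points of its orbit. Divided
  differences are meaningful at injective \<open>u\<close>, for which the coordinates are distinct.
\<close>

type_synonym orbit_fun = "(nat \<Rightarrow> nat) \<Rightarrow> polyn fract"

definition orbit_var :: "nat \<Rightarrow> polyn fract" where
  "orbit_var i = Fract (pvar i) 1"

lemma orbit_var_eq_iff [simp]: "orbit_var i = orbit_var j \<longleftrightarrow> i = j"
proof
  assume "orbit_var i = orbit_var j"
  then have "pvar i = pvar j" by (simp add: orbit_var_def eq_fract)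
  then show "i = j" unfolding pvar_def frag_of_eq by (metis lookup_single_eq lookup_single_not_eq zero_neq_one)
qed simp

text \<open>
  The letter \<open>X i\<close> acts as the \<open>i\<close>-th coordinate function and \<open>D i\<close> as the divided difference.
\<close>

fun gen_op :: "nh_gen \<Rightarrow> orbit_fun \<Rightarrow> orbit_fun" where
  "gen_op (X i) g = (\<lambda>u. orbit_var (u i) * g u)"
| "gen_op (D i) g = (\<lambda>u. (g u - g (u \<circ> sref i)) / (orbit_var (u i) - orbit_var (u (Suc i))))"

definition word_op :: "nh_gen list \<Rightarrow> orbit_fun \<Rightarrow> orbit_fun" where
  "word_op gs g = foldr gen_op gs g"

definition free_op :: "free_nh \<Rightarrow> orbit_fun \<Rightarrow> orbit_fun" where
  "free_op p g = (\<lambda>u. frag_eval (\<lambda>w. word_op (letters w) g u) p)"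

lemma word_op_simps [simp]:
  "word_op [] g = g" "word_op (a # gs) g = gen_op a (word_op gs g)"
  "word_op (gs @ hs) g = word_op gs (word_op hs g)"
  by (simp_all add: word_op_def)

lemma gen_op_diff: "gen_op a (\<lambda>v. g v - h v) = (\<lambda>u. gen_op a g u - gen_op a h u)"
  by (cases a) (auto simp: algebra_simps diff_divide_distrib add_divide_distrib)

lemma word_op_diff: "word_op gs (\<lambda>v. g v - h v) = (\<lambda>u. word_op gs g u - word_op gs h u)"
  by (induction gs) (simp_all add: gen_op_diff)

lemma word_op_zero: "word_op gs (\<lambda>v. 0) = (\<lambda>u. 0)"
  using word_op_diff[of gs "\<lambda>v. 0" "\<lambda>v. 0"] by simp

lemma free_op_word [simp]: "free_op (word_mon gs) g = word_op gs g"
  by (simp add: free_op_def word_mon_def)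

lemma free_op_one [simp]: "free_op 1 g = g"
  using free_op_word[of "[]" g] by (simp del: free_op_word)

lemma free_op_diff: "free_op (p - q) g = (\<lambda>u. free_op p g u - free_op q g u)"
  by (simp add: free_op_def frag_eval_diff)

lemma free_op_zero [simp]: "free_op 0 g = (\<lambda>u. 0)"
  by (simp add: free_op_def)

lemma free_op_add: "free_op (p + q) g = (\<lambda>u. free_op p g u + free_op q g u)"
  using free_op_diff[of p "- q" g] free_op_diff[of 0 q g] by simp

lemma free_op_sum: "free_op (sum f I) g = (\<lambda>u. \<Sum>i\<in>I. free_op (f i) g u)"
  by (induction I rule: infinite_finite_induct) (simp_all add: free_op_add)

lemma free_op_mult: "free_op (p * q) g = free_op p (free_op q g)"
proof (induction p rule: free_induct)
  case (word gs)
  show ?case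
    by (induction q rule: free_induct)
       (simp_all add: right_diff_distrib free_op_diff word_op_diff word_op_zero flip: word_mon_append)
qed (simp_all add: left_diff_distrib free_op_diff)

lemma inj_comp_sref: "inj u \<Longrightarrow> inj (u \<circ> sref i)"
  by (simp add: inj_compose)

text \<open>
  The braid relation for divided differences at the point \<open>(a, b, c)\<close>. The other variables are the values
  of a function at the six points of the orbit, indexed by the exchanges of positions that lead there.
\<close>

lemma braid_fraction_identity:
  fixes a b c :: "'k :: field"
  assumes "a \<noteq> b" "b \<noteq> c" "a \<noteq> c"
  shows "(((g0 - g1) / (a - b) - (g2 - g21) / (a - c)) / (b - c)
        - ((g1 - g0) / (b - a) - (g12 - g121) / (b - c)) / (a - c)) / (a - b)
      = (((g0 - g2) / (b - c) - (g1 - g12) / (a - c)) / (a - b)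
        - ((g2 - g0) / (c - b) - (g21 - g121) / (a - b)) / (a - c)) / (b - c)"
proof -
  define x y where "x = a - b" and "y = b - c"
  have *: "a - b = x" "b - c = y" "a - c = x + y" "b - a = - x" "c - b = - y"
    by (simp_all add: x_def y_def)
  have "x \<noteq> 0" "y \<noteq> 0" "x + y \<noteq> 0" using assms by (simp_all add: x_def y_def)
  then show ?thesis unfolding * by (simp add: divide_simps) (simp add: algebra_simps)
qed

lemma far_fraction_identity:
  fixes x y :: "'k :: field"
  shows "((g0 - g1) / x - (g2 - g3) / x) / y = ((g0 - g2) / y - (g1 - g3) / y) / x"
  by (simp add: diff_divide_distrib mult.commute)

text \<open>
  At a point with distinct coordinates no denominator vanishes, and the relations are identities
  between rational expressions.
\<close>

lemma free_op_nh_rels: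
  assumes r: "r \<in> nh_rels n" and u: "inj u"
  shows "free_op r g u = 0"
proof -
  have ne: "orbit_var (u i) - orbit_var (u j) \<noteq> 0" if "i \<noteq> j" for i j
    using that u by (simp add: inj_eq)
  show ?thesis
    using r
  proof (cases rule: nh_rels_cases)
    case (xx i j)
    then show ?thesis by (simp add: free_op_diff free_op_mult)
  next
    case (dd i)
    have "(g u - g (u \<circ> sref i)) / (orbit_var (u i) - orbit_var (u (Suc i))) =
        (g (u \<circ> sref i) - g u) / (orbit_var (u (Suc i)) - orbit_var (u i))"
      by (metis minus_diff_eq minus_divide_divide)
    then show ?thesis by (simp add: dd free_op_mult)
  next
    case (braid i)
    let ?s = "sref i" and ?t = "sref (Suc i)"
    have perm: "u \<circ> ?s \<circ> ?t \<circ> ?s = u \<circ> ?t \<circ> ?s \<circ> ?t"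
      by (auto simp: fun_eq_iff transpose_def)
    have "inj u" by fact
    then have "orbit_var (u i) \<noteq> orbit_var (u (Suc i))" "orbit_var (u (Suc i)) \<noteq> orbit_var (u (Suc (Suc i)))"
      "orbit_var (u i) \<noteq> orbit_var (u (Suc (Suc i)))"
      by (simp_all add: inj_eq)
    from braid_fraction_identity[OF this, of "g u" "g (u \<circ> ?s)" "g (u \<circ> ?t)" "g (u \<circ> ?t \<circ> ?s)"
        "g (u \<circ> ?s \<circ> ?t)" "g (u \<circ> ?s \<circ> ?t \<circ> ?s)"]
    show ?thesis by (simp add: braid free_op_diff free_op_mult perm)
  next
    case (far i j)
    have "u \<circ> sref i \<circ> sref j = u \<circ> sref j \<circ> sref i"
      using far(3) by (auto simp: fun_eq_iff transpose_def)
    moreover have "j \<noteq> i" "j \<noteq> Suc i" "i \<noteq> Suc j" using far(3) by auto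
    ultimately show ?thesis
      using far_fraction_identity by (simp add: far(4) free_op_diff free_op_mult)
  next
    case (xd i j)
    then show ?thesis
      by (simp add: xd(5) free_op_diff free_op_mult right_diff_distrib diff_divide_distrib)
  next
    case (nil1 i)
    have "orbit_var (u i) - orbit_var (u (Suc i)) \<noteq> 0" by (rule ne) simp
    then show ?thesis
      by (simp add: nil1 free_op_diff free_op_mult) (simp add: divide_simps, simp add: algebra_simps)
  next
    case (nil2 i)
    have "orbit_var (u i) - orbit_var (u (Suc i)) \<noteq> 0" by (rule ne) simp
    then show ?thesis
      by (simp add: nil2 free_op_diff free_op_mult) (simp add: divide_simps, simp add: algebra_simps)
  qed
qed

lemma word_op_vanish:
  assumes "\<And>v. inj v \<Longrightarrow> g v = 0" "inj u"
  shows "word_op gs g u = 0"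
  using assms(2)
proof (induction gs arbitrary: u)
  case (Cons a gs)
  have "word_op gs g (u \<circ> sref i) = 0" for i by (rule Cons.IH[OF inj_comp_sref[OF Cons.prems]])
  then show ?case using Cons by (cases a) (simp_all del: o_apply)
qed (simp add: assms(1))

text \<open>
  Operators do not mix injective with other points, so that the latter can be ignored.
\<close>

lemma free_op_vanish:
  assumes "\<And>v. inj v \<Longrightarrow> g v = 0" "inj u"
  shows "free_op p g u = 0"
  by (induction p rule: free_induct) (simp_all add: word_op_vanish[OF assms] free_op_diff)

lemma free_op_nh_ideal:
  assumes "p \<in> nh_ideal n" "inj u"
  shows "free_op p g u = 0"
  using assms
  by (induction arbitrary: u g rule: nh_ideal_induct)
     (simp_all add: free_op_nh_rels free_op_add free_op_mult free_op_vanish)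

lemma free_op_nh_eq: "nh_eq n p q \<Longrightarrow> inj u \<Longrightarrow> free_op p g u = free_op q g u"
  using free_op_nh_ideal[of "p - q" n u g] by (simp add: nh_eq_def free_op_diff)

text \<open>
  Polynomials act by multiplication with their values; at the generic point a polynomial is its own
  value.
\<close>

lemma free_op_lift:
  assumes "r \<in> PR n" "inj u"
  shows "\<exists>e. (\<forall>g. free_op (lift n r) g u = e * g u) \<and> (u = id \<longrightarrow> e = Fract r 1)"
  using assms(1)
proof (induction r rule: PR_induct)
  case one
  then show ?case by (intro exI[of _ 1]) (simp add: One_fract_def)
next
  case (pvar i r)
  then obtain e where e: "\<And>g. free_op (lift n r) g u = e * g u" "u = id \<longrightarrow> e = Fract r 1" by blast
  have "free_op (lift n (pvar i * r)) g u = orbit_var (u i) * e * g u" for g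
    using free_op_nh_eq[OF lift_pvar_mult[OF pvar(1)] assms(2)] by (simp add: free_op_mult e)
  then show ?case using e(2) by (intro exI[of _ "orbit_var (u i) * e"]) (auto simp: orbit_var_def)
next
  case (diff r s)
  then obtain e f where "\<And>g. free_op (lift n r) g u = e * g u" "u = id \<longrightarrow> e = Fract r 1"
      "\<And>g. free_op (lift n s) g u = f * g u" "u = id \<longrightarrow> f = Fract s 1" by blast
  then show ?case
    by (intro exI[of _ "e - f"]) (auto simp: lift_diff free_op_diff algebra_simps)
qed

text \<open>
  Expanding \<open>D k\<close> for the first letter \<open>k\<close>, the value at \<open>u\<close> involves the remaining operator at \<open>u\<close> and at
  \<open>u \<circ> sref k\<close>. The former sees only translations by elements shorter than \<open>w\<close>. The latter sees, besides
  such translations, the translation by \<open>sref k \<circ> (sref k \<circ> w) = w\<close>, with a nonzero coefficient by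
  induction.
\<close>

lemma word_op_triangular:
  "w \<in> symm_group n \<Longrightarrow> reduced_expression n w ks \<Longrightarrow>
    \<exists>c. \<forall>u. inj u \<longrightarrow> c u \<noteq> 0 \<and> (\<forall>g. (\<forall>v\<in>symm_group n. inversions n v < inversions n w \<longrightarrow> g (u \<circ> v) = 0)
      \<longrightarrow> word_op (map D ks) g u = c u * g (u \<circ> w))"
proof (induction ks arbitrary: w)
  case Nil
  then have "w = id" by (simp add: reduced_expression_def expression_def)
  then show ?case by (intro exI[of _ "\<lambda>u. 1"]) simp
next
  case (Cons k ks)
  note k = reduced_expression_Cons[OF Cons.prems]
  let ?w = "sref k \<circ> w"
  have w: "?w \<in> symm_group n" using comp_symm_group[OF sref_symm_group[OF k(1)] Cons.prems(1)] .
  have len: "Suc (inversions n ?w) = inversions n w"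
    using inversions_sref_comp_descent[OF Cons.prems(1) k(1,3)] .
  obtain c where c: "\<And>u. inj u \<Longrightarrow> c u \<noteq> 0"
    "\<And>u g. inj u \<Longrightarrow> (\<And>v. v \<in> symm_group n \<Longrightarrow> inversions n v < inversions n ?w \<Longrightarrow> g (u \<circ> v) = 0) \<Longrightarrow>
      word_op (map D ks) g u = c u * g (u \<circ> ?w)"
    using Cons.IH[OF w k(2)] by blast
  define c' where "c' = (\<lambda>u. - c (u \<circ> sref k) / (orbit_var (u k) - orbit_var (u (Suc k))))"
  have "c' u \<noteq> 0" if "inj u" for u
    using that c(1)[OF inj_comp_sref[OF that]] by (simp add: c'_def inj_eq)
  moreover have "word_op (map D (k # ks)) g u = c' u * g (u \<circ> w)"
    if u: "inj u" and g: "\<And>v. v \<in> symm_group n \<Longrightarrow> inversions n v < inversions n w \<Longrightarrow> g (u \<circ> v) = 0" for u g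
  proof -
    have "word_op (map D ks) g u = c u * g (u \<circ> ?w)"
      using len by (intro c(2)[OF u] g) auto
    also have "g (u \<circ> ?w) = 0" using w len by (intro g) auto
    finally have 1: "word_op (map D ks) g u = 0" by simp
    have 2: "word_op (map D ks) g (u \<circ> sref k) = c (u \<circ> sref k) * g (u \<circ> sref k \<circ> ?w)"
    proof (rule c(2)[OF inj_comp_sref[OF u]])
      fix v assume v: "v \<in> symm_group n" "inversions n v < inversions n ?w"
      have "g (u \<circ> (sref k \<circ> v)) = 0"
        using v len inversions_sref_comp_cases[OF v(1) k(1)] comp_symm_group[OF sref_symm_group[OF k(1)] v(1)]
        by (intro g) auto
      then show "g (u \<circ> sref k \<circ> v) = 0" by (simp add: comp_assoc)
    qed
    have "u \<circ> sref k \<circ> ?w = u \<circ> w" by (simp add: comp_assoc)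
    then show ?thesis using 1 2 by (simp add: c'_def)
  qed
  ultimately show ?case by blast
qed

lemma psi_op_triangular:
  assumes "w \<in> symm_group n" "inj u"
  obtains c where "c \<noteq> 0"
    "\<And>g. (\<And>v. v \<in> symm_group n \<Longrightarrow> inversions n v < inversions n w \<Longrightarrow> g (u \<circ> v) = 0)
      \<Longrightarrow> free_op (psi n w) g u = c * g (u \<circ> w)"
proof -
  obtain ks where ks: "reduced_expression n w ks" "psi n w = partial_word ks" using psi_some[OF assms(1)] .
  show ?thesis using word_op_triangular[OF assms(1) ks(1)] assms(2) that unfolding ks(2) free_op_word by blast
qed

definition side_mult :: "bool \<Rightarrow> free_nh \<Rightarrow> free_nh \<Rightarrow> free_nh" where
  "side_mult b p q = (if b then p * q else q * p)"

text \<open>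
  Let \<open>m\<close> have maximal length among the elements with a nonzero coefficient. Evaluate the relation at a
  point \<open>u\<close> on the indicator function of \<open>u \<circ> m\<close>. By triangularity only the term of \<open>m\<close> survives, and
  it contributes the coefficient of \<open>m\<close> up to a nonzero factor.
\<close>

lemma psi_independent:
  assumes c: "\<And>w. w \<in> symm_group n \<Longrightarrow> c w \<in> PR n"
    and sum: "(\<Sum>w\<in>symm_group n. side_mult b (lift n (c w)) (psi n w)) \<in> nh_ideal n"
    and w: "w \<in> symm_group n"
  shows "c w = 0"
proof (rule ccontr)
  assume "c w \<noteq> 0"
  let ?S = "{v \<in> symm_group n. c v \<noteq> 0}"
  have "finite ?S" "?S \<noteq> {}" using w \<open>c w \<noteq> 0\<close> by auto
  then obtain m where m: "m \<in> symm_group n" "c m \<noteq> 0"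
    and max: "\<And>v. v \<in> symm_group n \<Longrightarrow> c v \<noteq> 0 \<Longrightarrow> inversions n v \<le> inversions n m"
  proof -
    have fin: "finite (inversions n ` ?S)" using \<open>finite ?S\<close> by (rule finite_imageI)
    have "Max (inversions n ` ?S) \<in> inversions n ` ?S"
      using fin \<open>?S \<noteq> {}\<close> by (intro Max_in) auto
    then obtain m where "m \<in> ?S" "Max (inversions n ` ?S) = inversions n m" by auto
    then show thesis using Max_ge[OF fin] by (intro that[of m]) auto
  qed
  \<comment> \<open>the coefficient is evaluated at \<open>u\<close> or, on the right, at \<open>u \<circ> m\<close>; this has to be the generic point\<close>
  define u where "u = (if b then id else perm_inv m)"
  define g :: orbit_fun where "g = (\<lambda>v. if v = u \<circ> m then 1 else 0)"
  have bij: "bij m" using m(1) permutes_bij symm_groupD by blast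
  have u: "inj u" using bij by (simp add: u_def bij_imp_bij_inv bij_is_inj)
  have um: "\<not> b \<Longrightarrow> u \<circ> m = id" using bij by (simp add: u_def bij_is_inj)
  have cancel: "u \<circ> v = u \<circ> m \<longleftrightarrow> v = m" for v
    using u by (auto simp: fun_eq_iff inj_eq)
  have term0: "free_op (side_mult b (lift n (c v)) (psi n v)) g u = 0"
    if v: "v \<in> symm_group n" "v \<noteq> m" for v
  proof (cases "c v = 0")
    case True
    then show ?thesis using word_op_zero free_op_vanish[of "\<lambda>v. 0" u] u
      by (cases b) (auto simp: side_mult_def free_op_mult)
  next
    case False
    have le: "inversions n v \<le> inversions n m" using max v False by blast
    obtain k where k: "\<And>g. (\<And>v'. v' \<in> symm_group n \<Longrightarrow> inversions n v' < inversions n v \<Longrightarrow> g (u \<circ> v') = 0)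
      \<Longrightarrow> free_op (psi n v) g u = k * g (u \<circ> v)"
      using psi_op_triangular[OF v(1) u] by metis
    have supp: "free_op (psi n v) h u = 0" if h: "\<And>v'. v' \<in> symm_group n \<Longrightarrow> v' \<noteq> m \<Longrightarrow> h (u \<circ> v') = 0" for h
    proof -
      have "free_op (psi n v) h u = k * h (u \<circ> v)"
      proof (rule k)
        show "h (u \<circ> v') = 0" if "v' \<in> symm_group n" "inversions n v' < inversions n v" for v'
          using that le by (intro h) auto
      qed
      then show ?thesis using h[OF v] by simp
    qed
    show ?thesis
    proof (cases b)
      case True
      obtain e where "\<And>g. free_op (lift n (c v)) g u = e * g u"
        using free_op_lift[OF c[OF v(1)] u] by blast
      then show ?thesis using True supp[of g] cancel by (simp add: side_mult_def free_op_mult g_def)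
    next
      case False
      have "free_op (lift n (c v)) g (u \<circ> v') = 0" if v': "v' \<in> symm_group n" "v' \<noteq> m" for v'
      proof -
        have "inj (u \<circ> v')" using u v'(1) by (meson inj_compose permutes_inj symm_groupD)
        then obtain e where "\<And>g. free_op (lift n (c v)) g (u \<circ> v') = e * g (u \<circ> v')"
          using free_op_lift[OF c[OF v(1)]] by blast
        then show ?thesis using v' cancel by (simp add: g_def)
      qed
      then show ?thesis using False supp by (simp add: side_mult_def free_op_mult)
    qed
  qed
  obtain k where k: "k \<noteq> 0" "\<And>g. (\<And>v'. v' \<in> symm_group n \<Longrightarrow> inversions n v' < inversions n m \<Longrightarrow> g (u \<circ> v') = 0)
      \<Longrightarrow> free_op (psi n m) g u = k * g (u \<circ> m)"
    using psi_op_triangular[OF m(1) u] by metis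
  have "(0 :: polyn fract) = free_op (\<Sum>w\<in>symm_group n. side_mult b (lift n (c w)) (psi n w)) g u"
    using free_op_nh_ideal[OF sum u] by simp
  also have "\<dots> = (\<Sum>v\<in>symm_group n. free_op (side_mult b (lift n (c v)) (psi n v)) g u)"
    by (simp add: free_op_sum)
  also have "\<dots> = free_op (side_mult b (lift n (c m)) (psi n m)) g u"
    using m(1) term0 by (subst sum.remove[of _ m]) auto
  also have "\<dots> = k * Fract (c m) 1"
  proof (cases b)
    case True
    have "free_op (lift n (c m)) h u = Fract (c m) 1 * h u" for h
      using free_op_lift[OF c[OF m(1)] u] True by (auto simp: u_def)
    moreover have "free_op (psi n m) g u = k * g (u \<circ> m)"
      by (rule k(2)) (auto simp: g_def cancel)
    ultimately show ?thesis using True by (simp add: side_mult_def free_op_mult g_def)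
  next
    case False
    have eval: "free_op (lift n (c m)) g (u \<circ> m) = Fract (c m) 1"
      using free_op_lift[OF c[OF m(1)], of id] False by (auto simp: um g_def)
    have "free_op (psi n m) (free_op (lift n (c m)) g) u = k * free_op (lift n (c m)) g (u \<circ> m)"
    proof (rule k(2))
      fix v' assume v': "v' \<in> symm_group n" "inversions n v' < inversions n m"
      have "inj (u \<circ> v')" using u v'(1) by (meson inj_compose permutes_inj symm_groupD)
      then obtain e where "\<And>g. free_op (lift n (c m)) g (u \<circ> v') = e * g (u \<circ> v')"
        using free_op_lift[OF c[OF m(1)]] by blast
      then show "free_op (lift n (c m)) g (u \<circ> v') = 0" using v' cancel by (auto simp: g_def)
    qed
    then show ?thesis using False eval by (simp add: side_mult_def free_op_mult)
  qed
  finally have "Fract (c m) 1 = 0" using k(1) by simp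
  then show False using m(2) by (simp add: Zero_fract_def eq_fract)
qed

section \<open>Spanning and the action of d, from either side\<close>

lemma side_mult_simps:
  "side_mult b (p + p') q = side_mult b p q + side_mult b p' q" "side_mult b p (q + q') = side_mult b p q + side_mult b p q'"
  "side_mult b (p - p') q = side_mult b p q - side_mult b p' q" "side_mult b p (q - q') = side_mult b p q - side_mult b p q'"
  "side_mult b 1 q = q" "side_mult b p 1 = p" "side_mult b 0 q = 0" "side_mult b p 0 = 0"
  "side_mult b (- p) q = - side_mult b p q" "side_mult b p (- q) = - side_mult b p q"
  by (simp_all add: side_mult_def algebra_simps)

lemma side_mult_assoc: "side_mult b (side_mult b p q) r = side_mult b p (side_mult b q r)"
  by (simp add: side_mult_def mult.assoc)

lemma side_mult_FA [simp]: "p \<in> FA n \<Longrightarrow> q \<in> FA n \<Longrightarrow> side_mult b p q \<in> FA n"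
  by (simp add: side_mult_def)

lemma side_mult_sum_right: "side_mult b p (sum f I) = (\<Sum>i\<in>I. side_mult b p (f i))"
  by (simp add: side_mult_def sum_distrib_left sum_distrib_right)

lemma nh_eq_side_mult_left: "a \<in> FA n \<Longrightarrow> nh_eq n p q \<Longrightarrow> nh_eq n (side_mult b a p) (side_mult b a q)"
  by (simp add: side_mult_def nh_eq_lmult nh_eq_rmult)

lemma nh_eq_side_mult_right: "a \<in> FA n \<Longrightarrow> nh_eq n p q \<Longrightarrow> nh_eq n (side_mult b p a) (side_mult b q a)"
  by (simp add: side_mult_def nh_eq_lmult nh_eq_rmult)

lemma derivation_side_mult: "derivation T \<Longrightarrow> T (side_mult b p q) = side_mult b (T p) q + side_mult b p (T q)"
  by (simp add: side_mult_def derivation_mult add.commute)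

lemma lift_side_mult: "nh_eq n (lift n (r * s)) (side_mult b (lift n r) (lift n s))"
  using lift_mult[of n r s] lift_mult[of n s r] by (simp add: side_mult_def mult.commute)

definition side_refl :: "bool \<Rightarrow> nat \<Rightarrow> (nat \<Rightarrow> nat) \<Rightarrow> nat \<Rightarrow> nat" where
  "side_refl b k w = (if b then sref k \<circ> w else w \<circ> sref k)"

lemma side_refl_symm_group: "k \<in> {1..<n} \<Longrightarrow> w \<in> symm_group n \<Longrightarrow> side_refl b k w \<in> symm_group n"
  by (simp add: side_refl_def comp_symm_group sref_symm_group)

lemma side_refl_involutive [simp]: "side_refl b k (side_refl b k w) = w"
  by (simp add: side_refl_def)

lemma side_refl_cases:
  assumes "w \<in> symm_group n" "k \<in> {1..<n}"
  shows "inversions n (side_refl b k w) < inversions n w \<or> inversions n w < inversions n (side_refl b k w)"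
  using inversions_sref_comp_cases[OF assms] inversions_comp_sref_cases[OF assms] by (auto simp: side_refl_def)

lemma psi_side_refl:
  assumes "w \<in> symm_group n" "k \<in> {1..<n}" "inversions n w < inversions n (side_refl b k w)"
  shows "nh_eq n (side_mult b (dg k) (psi n w)) (psi n (side_refl b k w))"
  using assms psi_sref_comp psi_comp_sref by (cases b) (simp_all add: side_mult_def side_refl_def)

lemma psi_side_refl_zero:
  assumes "w \<in> symm_group n" "k \<in> {1..<n}" "inversions n (side_refl b k w) < inversions n w"
  shows "nh_eq n (side_mult b (dg k) (psi n w)) 0"
  using assms psi_sref_comp_zero psi_comp_sref_zero by (cases b) (simp_all add: side_mult_def side_refl_def)

lemma bruhat_side_refl:
  assumes "w \<in> symm_group n" "k \<in> {1..<n}" "inversions n w < inversions n (side_refl b k w)"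
  shows "(w, side_refl b k w) \<in> bruhat n"
  using assms bruhat_sref_comp bruhat_comp_sref by (cases b) (simp_all add: side_refl_def)

lemma bruhat_side_refl_lifting:
  assumes k: "k \<in> {1..<n}" and v: "(v, w) \<in> bruhat n" and up: "inversions n w < inversions n (side_refl b k w)"
  shows "(side_refl b k v, side_refl b k w) \<in> bruhat n"
proof (rule bruhat_lifting[OF _ _ v])
  show "side_refl b k u = v \<or> (side_refl b k u, side_refl b k v) \<in> bruhat_step n" if "(u, v) \<in> bruhat_step n" for u v
    using that bruhat_step_sref_comp[OF k that] bruhat_step_comp_sref[OF k that] by (simp add: side_refl_def)
  show "side_refl b k u \<in> symm_group n" if "u \<in> symm_group n" for u
    using that k by (rule side_refl_symm_group[rotated])
  show "(w, side_refl b k w) \<in> bruhat n"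
    using bruhat_symm_group[OF v] k up by (intro bruhat_side_refl) auto
qed

lemma ex_side_refl_descent:
  assumes w: "w \<in> symm_group n" "w \<noteq> id"
  shows "\<exists>k\<in>{1..<n}. inversions n (side_refl b k w) < inversions n w"
proof (cases b)
  case True
  obtain k where k: "k \<in> {1..<n}" "perm_inv w (Suc k) < perm_inv w k"
    using ex_left_descent[OF w] by blast
  then show ?thesis
    using inversions_sref_comp_descent[OF w(1) k] True by (intro bexI[of _ k]) (auto simp: side_refl_def)
next
  case False
  have "\<exists>k\<in>{1..<n}. \<not> w k < w (Suc k)"
    using permutation_no_descent_id[OF symm_groupD[OF w(1)]] w(2) by blast
  then obtain k where k: "k \<in> {1..<n}" "\<not> w k < w (Suc k)" by blast
  then have "\<not> inversions n w < inversions n (w \<circ> sref k)"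
    using inversions_comp_sref_less_iff[OF w(1) k(1)] by simp
  then show ?thesis
    using inversions_comp_sref_cases[OF w(1) k(1)] False k(1) by (intro bexI[of _ k]) (auto simp: side_refl_def)
qed

lemma side_mult_dg_xg:
  assumes i: "i \<in> {1..<n}" and j: "j \<in> {1..n}"
  shows "\<exists>j'\<in>{1..n}. \<exists>c\<in>PR n. nh_eq n (side_mult b (dg i) (xg j)) (side_mult b (xg j') (dg i) + lift n c)"
proof -
  have neg: "lift n (- 1) = - 1" using lift_diff[of n 0 1] by simp
  have neg_PR: "- 1 \<in> PR n" by simp
  consider "j = i" | "j = Suc i" | "j \<noteq> i" "j \<noteq> Suc i" by blast
  then show ?thesis
  proof cases
    case 1
    have "nh_eq n (side_mult b (dg i) (xg i)) (side_mult b (xg (Suc i)) (dg i) + 1)"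
      using nh_rel_nil1[OF i] nh_rel_nil2[OF i] by (simp add: side_mult_def nh_eq_def algebra_simps)
    then show ?thesis using 1 i by (intro bexI[of _ "Suc i"] bexI[of _ 1]) simp_all
  next
    case 2
    have "nh_eq n (side_mult b (dg i) (xg (Suc i))) (side_mult b (xg i) (dg i) + - 1)"
      using nh_ideal_uminus[OF nh_rel_nil1[OF i]] nh_ideal_uminus[OF nh_rel_nil2[OF i]]
      by (simp add: side_mult_def nh_eq_def algebra_simps)
    then show ?thesis using 2 i neg neg_PR by (intro bexI[of _ i] bexI[of _ "- 1"]) simp_all
  next
    case 3
    have "nh_eq n (side_mult b (dg i) (xg j)) (side_mult b (xg j) (dg i))"
      using nh_rel_xd[OF i j 3] nh_ideal_uminus[OF nh_rel_xd[OF i j 3]]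
      by (simp add: side_mult_def nh_eq_def)
    then show ?thesis using j by (intro bexI[of _ j] bexI[of _ 0]) simp_all
  qed
qed

text \<open>
  The variable case is a defining relation; a product is treated one variable at a time.
\<close>

lemma side_mult_dg_lift:
  assumes i: "i \<in> {1..<n}" and r: "r \<in> PR n"
  shows "\<exists>s\<in>PR n. \<exists>t\<in>PR n. nh_eq n (side_mult b (dg i) (lift n r)) (side_mult b (lift n s) (dg i) + lift n t)"
  using r
proof (induction r rule: PR_induct)
  case one
  then show ?case by (intro bexI[of _ 1] bexI[of _ 0]) (simp_all add: side_mult_simps)
next
  case (pvar j r)
  then obtain s t where st: "s \<in> PR n" "t \<in> PR n"
    "nh_eq n (side_mult b (dg i) (lift n r)) (side_mult b (lift n s) (dg i) + lift n t)" by blast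
  obtain j' c where jc: "j' \<in> {1..n}" "c \<in> PR n"
    "nh_eq n (side_mult b (dg i) (xg j)) (side_mult b (xg j') (dg i) + lift n c)"
    using side_mult_dg_xg[OF i pvar(1)] by blast
  have F: "dg i \<in> FA n" "xg j' \<in> FA n" using i jc by simp_all
  have "nh_eq n (side_mult b (dg i) (lift n (pvar j * r))) (side_mult b (dg i) (side_mult b (xg j) (lift n r)))"
    using lift_side_mult[of n "pvar j" r b] pvar(1) F by (intro nh_eq_side_mult_left) simp_all
  also have "side_mult b (dg i) (side_mult b (xg j) (lift n r)) = side_mult b (side_mult b (dg i) (xg j)) (lift n r)"
    by (simp add: side_mult_assoc)
  also have "nh_eq n \<dots> (side_mult b (side_mult b (xg j') (dg i) + lift n c) (lift n r))"
    using jc by (intro nh_eq_side_mult_right) simp_all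
  also have "\<dots> = side_mult b (xg j') (side_mult b (dg i) (lift n r)) + side_mult b (lift n c) (lift n r)"
    by (simp add: side_mult_simps side_mult_assoc)
  also have "nh_eq n \<dots> (side_mult b (xg j') (side_mult b (lift n s) (dg i) + lift n t) + lift n (c * r))"
    by (rule nh_eq_add[OF nh_eq_side_mult_left[OF F(2) st(3)] nh_eq_sym[OF lift_side_mult]])
  also have "\<dots> = side_mult b (side_mult b (xg j') (lift n s)) (dg i) + (side_mult b (xg j') (lift n t) + lift n (c * r))"
    by (simp add: side_mult_simps side_mult_assoc add.assoc)
  also have "nh_eq n \<dots> (side_mult b (lift n (pvar j' * s)) (dg i) + (lift n (pvar j' * t) + lift n (c * r)))"
    using nh_eq_sym[OF lift_side_mult[of n "pvar j'" _ b]] jc(1) F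
    by (intro nh_eq_add nh_eq_side_mult_right) simp_all
  finally show ?case
    using st jc pvar by (intro bexI[of _ "pvar j' * s"] bexI[of _ "pvar j' * t + c * r"]) (simp_all add: lift_add)
next
  case (diff r r')
  then obtain s t s' t' where st: "s \<in> PR n" "t \<in> PR n" "s' \<in> PR n" "t' \<in> PR n"
    "nh_eq n (side_mult b (dg i) (lift n r)) (side_mult b (lift n s) (dg i) + lift n t)"
    "nh_eq n (side_mult b (dg i) (lift n r')) (side_mult b (lift n s') (dg i) + lift n t')" by blast
  have "nh_eq n (side_mult b (dg i) (lift n (r - r'))) (side_mult b (lift n (s - s')) (dg i) + lift n (t - t'))"
    using nh_eq_diff[OF st(5,6)] by (simp add: side_mult_simps lift_diff algebra_simps)
  then show ?case using st by (intro bexI[of _ "s - s'"] bexI[of _ "t - t'"]) simp_all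
qed

definition psi_span :: "bool \<Rightarrow> nat \<Rightarrow> (nat \<Rightarrow> nat) set \<Rightarrow> free_nh set" where
  "psi_span b n W = {p. \<exists>c. (\<forall>w\<in>W. c w \<in> PR n) \<and> nh_eq n p (\<Sum>w\<in>W. side_mult b (lift n (c w)) (psi n w))}"

lemma psi_span_nh_eq: "nh_eq n p q \<Longrightarrow> q \<in> psi_span b n W \<Longrightarrow> p \<in> psi_span b n W"
  using nh_eq_trans by (fastforce simp: psi_span_def)

lemma psi_span_zero [simp]: "0 \<in> psi_span b n W"
  unfolding psi_span_def by (intro CollectI exI[of _ "\<lambda>w. 0"]) (simp add: side_mult_simps)

lemma psi_span_diff:
  assumes "p \<in> psi_span b n W" "q \<in> psi_span b n W"
  shows "p - q \<in> psi_span b n W"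
proof -
  obtain c d where "\<forall>w\<in>W. c w \<in> PR n" "nh_eq n p (\<Sum>w\<in>W. side_mult b (lift n (c w)) (psi n w))"
    "\<forall>w\<in>W. d w \<in> PR n" "nh_eq n q (\<Sum>w\<in>W. side_mult b (lift n (d w)) (psi n w))"
    using assms by (auto simp: psi_span_def)
  then show ?thesis
    unfolding psi_span_def
    by (intro CollectI exI[of _ "\<lambda>w. c w - d w"]) (simp add: lift_diff side_mult_simps sum_subtractf nh_eq_diff)
qed

lemma psi_span_add:
  "p \<in> psi_span b n W \<Longrightarrow> q \<in> psi_span b n W \<Longrightarrow> p + q \<in> psi_span b n W"
  using psi_span_diff[OF _ psi_span_diff[OF psi_span_zero]] by fastforce

lemma psi_span_sum: "(\<And>i. i \<in> I \<Longrightarrow> f i \<in> psi_span b n W) \<Longrightarrow> sum f I \<in> psi_span b n W"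
  by (induction I rule: infinite_finite_induct) (auto intro: psi_span_add)

lemma psi_span_lift:
  assumes "W \<subseteq> symm_group n" "r \<in> PR n" "p \<in> psi_span b n W"
  shows "side_mult b (lift n r) p \<in> psi_span b n W"
proof -
  obtain c where c: "\<forall>w\<in>W. c w \<in> PR n" "nh_eq n p (\<Sum>w\<in>W. side_mult b (lift n (c w)) (psi n w))"
    using assms by (auto simp: psi_span_def)
  have "nh_eq n (side_mult b (lift n r) p) (side_mult b (lift n r) (\<Sum>w\<in>W. side_mult b (lift n (c w)) (psi n w)))"
    by (intro nh_eq_side_mult_left c) simp
  also have "\<dots> = (\<Sum>w\<in>W. side_mult b (side_mult b (lift n r) (lift n (c w))) (psi n w))"
    by (simp add: side_mult_sum_right side_mult_assoc)
  also have "nh_eq n \<dots> (\<Sum>w\<in>W. side_mult b (lift n (r * c w)) (psi n w))"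
    using assms(1) by (intro nh_eq_sum nh_eq_side_mult_right nh_eq_sym[OF lift_side_mult] psi_FA) auto
  finally show ?thesis
    unfolding psi_span_def using c(1) assms(2) by (intro CollectI exI[of _ "\<lambda>w. r * c w"]) simp
qed

lemma psi_span_psi:
  assumes "W \<subseteq> symm_group n" "w \<in> W"
  shows "psi n w \<in> psi_span b n W"
proof -
  have "finite W" using assms(1) finite_symm_group finite_subset by blast
  have "(\<Sum>v\<in>W. side_mult b (lift n (if v = w then 1 else 0)) (psi n v)) = (\<Sum>v\<in>W. if v = w then psi n v else 0)"
    by (intro sum.cong) (auto simp: side_mult_simps)
  also have "\<dots> = psi n w" using \<open>finite W\<close> assms(2) by simp
  finally show ?thesis
    unfolding psi_span_def by (intro CollectI exI[of _ "\<lambda>v. if v = w then 1 else 0"]) simp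
qed

text \<open>
  Moving \<open>D i\<close> past the coefficient of \<open>\<psi> w\<close> leaves a multiple of \<open>\<psi> w\<close> and a multiple of the product of
  \<open>D i\<close> with \<open>\<psi> w\<close>, which is zero or a new basis element.
\<close>

lemma psi_span_dg:
  assumes W': "W' \<subseteq> symm_group n" "W \<subseteq> W'" and i: "i \<in> {1..<n}"
    and up: "\<And>w. w \<in> W \<Longrightarrow> inversions n w < inversions n (side_refl b i w) \<Longrightarrow> side_refl b i w \<in> W'"
    and p: "p \<in> psi_span b n W"
  shows "side_mult b (dg i) p \<in> psi_span b n W'"
proof -
  obtain c where c: "\<forall>w\<in>W. c w \<in> PR n" "nh_eq n p (\<Sum>w\<in>W. side_mult b (lift n (c w)) (psi n w))"
    using p by (auto simp: psi_span_def)
  have di: "dg i \<in> FA n" using i by simp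
  have term_in: "side_mult b (dg i) (side_mult b (lift n (c w)) (psi n w)) \<in> psi_span b n W'" if w: "w \<in> W" for w
  proof -
    have wS: "w \<in> symm_group n" using w W' by auto
    obtain s t where st: "s \<in> PR n" "t \<in> PR n"
      "nh_eq n (side_mult b (dg i) (lift n (c w))) (side_mult b (lift n s) (dg i) + lift n t)"
      using side_mult_dg_lift[OF i] c(1) w by blast
    have dpsi: "side_mult b (dg i) (psi n w) \<in> psi_span b n W'"
    proof (cases "inversions n w < inversions n (side_refl b i w)")
      case True
      then show ?thesis
        using psi_span_nh_eq[OF psi_side_refl[OF wS i True] psi_span_psi[OF W'(1) up[OF w True]]] by blast
    next
      case False
      then have "inversions n (side_refl b i w) < inversions n w" using side_refl_cases[OF wS i] by blast
      then show ?thesis using psi_span_nh_eq[OF psi_side_refl_zero[OF wS i]] by simp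
    qed
    have "nh_eq n (side_mult b (dg i) (side_mult b (lift n (c w)) (psi n w)))
        (side_mult b (side_mult b (lift n s) (dg i) + lift n t) (psi n w))"
      using nh_eq_side_mult_right[OF psi_FA[OF wS] st(3), where b = b] by (simp add: side_mult_assoc)
    moreover have "side_mult b (side_mult b (lift n s) (dg i) + lift n t) (psi n w) \<in> psi_span b n W'"
      unfolding side_mult_simps side_mult_assoc
      using st(1,2) dpsi w W' by (intro psi_span_add psi_span_lift psi_span_psi) auto
    ultimately show ?thesis by (rule psi_span_nh_eq)
  qed
  have "nh_eq n (side_mult b (dg i) p) (\<Sum>w\<in>W. side_mult b (dg i) (side_mult b (lift n (c w)) (psi n w)))"
    using nh_eq_side_mult_left[OF di c(2), of b] by (simp add: side_mult_sum_right)
  moreover have "(\<Sum>w\<in>W. side_mult b (dg i) (side_mult b (lift n (c w)) (psi n w))) \<in> psi_span b n W'"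
    by (intro psi_span_sum term_in)
  ultimately show ?thesis by (rule psi_span_nh_eq)
qed

lemma psi_span_gen:
  assumes "g \<in> nh_gens n" "p \<in> psi_span b n (symm_group n)"
  shows "side_mult b (word_mon [g]) p \<in> psi_span b n (symm_group n)"
proof (cases g)
  case (X i)
  then have "i \<in> {1..n}" using assms(1) by (auto simp: nh_gens_def)
  then show ?thesis using psi_span_lift[OF order_refl PR_pvar assms(2)] X by simp
next
  case (D i)
  then have "i \<in> {1..<n}" using assms(1) by (auto simp: nh_gens_def)
  then show ?thesis
    unfolding D by (intro psi_span_dg[OF order_refl order_refl _ _ assms(2)] side_refl_symm_group)
qed

text \<open>
  Words are built by adding letters on the side of the action: at the front on the left, at the end on
  the right.
\<close>

lemma psi_span_top:
  assumes "p \<in> FA n"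
  shows "p \<in> psi_span b n (symm_group n)"
  using assms
proof (induction p rule: FA_induct)
  case (word gs)
  have one: "1 \<in> psi_span b n (symm_group n)"
    by (rule psi_span_nh_eq[OF nh_eq_sym[OF psi_id] psi_span_psi]) auto
  show ?case
  proof (cases b)
    case True
    show ?thesis
      using word
    proof (induction gs)
      case (Cons g gs)
      have "word_mon (g # gs) = side_mult b (word_mon [g]) (word_mon gs)"
        using True word_mon_Cons[of g gs] by (simp add: side_mult_def)
      then show ?case using Cons psi_span_gen[of g n "word_mon gs" b] by simp
    qed (simp add: one)
  next
    case False
    show ?thesis
      using word
    proof (induction gs rule: rev_induct)
      case (snoc g gs)
      have "word_mon (gs @ [g]) = side_mult b (word_mon [g]) (word_mon gs)"
        using False by (simp add: side_mult_def word_mon_append)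
      then show ?case using snoc psi_span_gen[of g n "word_mon gs" b] by simp
    qed (simp add: one)
  qed
qed (simp_all add: psi_span_diff)

lemma psi_eq_one: "psi n id = 1"
  by (rule psi_some[OF id_symm_group[of n]]) (simp add: reduced_expression_iff)

text \<open>
  The relation \<open>x * D - D * x' = 1\<close> turns \<open>d (D k) = - x * D - D * x'\<close> into \<open>1 - 2 * x * D\<close> and, with the
  coefficients on the right, into \<open>- 1 - D * (2 * x')\<close>.
\<close>

lemma free_d_dg:
  assumes k: "k \<in> {1..<n}"
  shows "\<exists>s\<in>PR n. \<exists>t\<in>PR n. nh_eq n (free_der d_gen (dg k)) (side_mult b (lift n s) (dg k) + lift n t)"
proof -
  have K: "k \<in> {1..n}" "Suc k \<in> {1..n}" using k by auto
  define s where "s = (if b then - (pvar k + pvar k) else - (pvar (Suc k) + pvar (Suc k)))"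
  define t :: polyn where "t = (if b then 1 else - 1)"
  have neg: "lift n (- r) = - lift n r" for r using lift_diff[of n 0 r] by simp
  have "nh_eq n (free_der d_gen (dg k)) (side_mult b (lift n s) (dg k) + lift n t)"
  proof -
    have "free_der d_gen (dg k) - (side_mult b (lift n s) (dg k) + lift n t) =
        (if b then 1 else - 1) * (xg k * dg k - dg k * xg (Suc k) - 1)"
    proof -
      have "lift n s = (if b then - (xg k + xg k) else - (xg (Suc k) + xg (Suc k)))"
        unfolding s_def by (cases b) (simp_all only: neg lift_add lift_pvar[OF K(1)] lift_pvar[OF K(2)] if_True if_False)
      moreover have "lift n t = (if b then 1 else - 1)" by (simp add: t_def neg)
      ultimately show ?thesis by (simp add: side_mult_def algebra_simps)
    qed
    then show ?thesis
      using nh_rel_nil1[OF k] nh_ideal_uminus[OF nh_rel_nil1[OF k]] by (simp add: nh_eq_def)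
  qed
  moreover have "s \<in> PR n"
    unfolding s_def by (cases b) (simp_all only: if_True if_False PR_uminus PR_add PR_pvar[OF K(1)] PR_pvar[OF K(2)])
  moreover have "t \<in> PR n" by (simp add: t_def)
  ultimately show ?thesis by blast
qed

text \<open>
  Induction on the length, with \<open>w = side_refl b k v\<close> and \<open>v\<close> shorter than \<open>w\<close>. In
  \<open>d (D k * \<psi> v) = d (D k) * \<psi> v + D k * d (\<psi> v)\<close> the first summand involves \<open>\<psi> v\<close> and \<open>\<psi> w\<close> only. In the second,
  \<open>d (\<psi> v)\<close> involves elements \<open>u\<close> below \<open>v\<close>, and multiplication by \<open>D k\<close> can only add
  \<open>side_refl b k u\<close>, which is below \<open>w\<close> by the lifting property.
\<close>

lemma free_d_psi:
  "w \<in> symm_group n \<Longrightarrow> free_der d_gen (psi n w) \<in> psi_span b n {v. (v, w) \<in> bruhat n}"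
proof (induction "inversions n w" arbitrary: w rule: less_induct)
  case less
  show ?case
  proof (cases "w = id")
    case True
    then show ?thesis by (simp add: psi_eq_one derivation_simps[OF derivation_free_der])
  next
    case False
    note w = less.prems
    obtain k where k: "k \<in> {1..<n}" and down: "inversions n (side_refl b k w) < inversions n w"
      using ex_side_refl_descent[OF w False] by blast
    define v where "v = side_refl b k w"
    have v: "v \<in> symm_group n" using side_refl_symm_group[OF k w] by (simp add: v_def)
    have wv: "w = side_refl b k v" by (simp add: v_def)
    have up: "inversions n v < inversions n (side_refl b k v)" using down by (simp add: v_def)
    have vw: "(v, w) \<in> bruhat n" using bruhat_side_refl[OF v k up] by (simp add: wv)
    let ?W = "{u. (u, w) \<in> bruhat n}"
    have W: "?W \<subseteq> symm_group n" using bruhat_symm_group by blast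
    have wW: "w \<in> ?W" "v \<in> ?W" using bruhat_refl[OF w] vw by auto
    have psi_w: "nh_eq n (psi n w) (side_mult b (dg k) (psi n v))"
      using nh_eq_sym[OF psi_side_refl[OF v k up]] by (simp add: wv)
    have eq: "nh_eq n (free_der d_gen (psi n w)) (free_der d_gen (side_mult b (dg k) (psi n v)))"
      using free_d_nh_ideal[OF psi_w[unfolded nh_eq_def]]
      by (simp add: nh_eq_def derivation_diff[OF derivation_free_der])
    obtain s t where st: "s \<in> PR n" "t \<in> PR n"
      "nh_eq n (free_der d_gen (dg k)) (side_mult b (lift n s) (dg k) + lift n t)"
      using free_d_dg[OF k] by blast
    have "side_mult b (dg k) (psi n v) \<in> psi_span b n ?W"
      by (rule psi_span_nh_eq[OF nh_eq_sym[OF psi_w] psi_span_psi[OF W wW(1)]])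
    then have "side_mult b (side_mult b (lift n s) (dg k) + lift n t) (psi n v) \<in> psi_span b n ?W"
      unfolding side_mult_simps side_mult_assoc
      by (intro psi_span_add psi_span_lift[OF W] st psi_span_psi[OF W wW(2)])
    then have 1: "side_mult b (free_der d_gen (dg k)) (psi n v) \<in> psi_span b n ?W"
      by (rule psi_span_nh_eq[OF nh_eq_side_mult_right[OF psi_FA[OF v] st(3)]])
    have 2: "side_mult b (dg k) (free_der d_gen (psi n v)) \<in> psi_span b n ?W"
    proof (rule psi_span_dg[OF W _ k])
      show "free_der d_gen (psi n v) \<in> psi_span b n {u. (u, v) \<in> bruhat n}"
        using up by (intro less.hyps v) (simp add: wv)
      show "{u. (u, v) \<in> bruhat n} \<subseteq> ?W" using vw bruhat_trans by blast
      show "side_refl b k u \<in> ?W" if "u \<in> {u. (u, v) \<in> bruhat n}" for u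
        using bruhat_side_refl_lifting[OF k _ up] that by (simp add: wv)
    qed
    have "free_der d_gen (side_mult b (dg k) (psi n v)) \<in> psi_span b n ?W"
      unfolding derivation_side_mult[OF derivation_free_der] by (rule psi_span_add[OF 1 2])
    then show ?thesis by (rule psi_span_nh_eq[OF eq])
  qed
qed

section \<open>The left and the right module\<close>

definition NH_module :: "bool \<Rightarrow> nat \<Rightarrow> (polyn, free_nh set) sl2_module" where
  "NH_module b n = (if b then NH_left n else NH_right n)"

lemma NH_module_sel [simp]:
  "carrier (NH_module b n) = carrier (NH n)" "add (NH_module b n) = add (NH n)"
  "zero (NH_module b n) = zero (NH n)" "act_d (NH_module b n) = nh_d n"
  "act_h (NH_module b n) = nh_h n" "act_z (NH_module b n) = nh_z n"
  "grading (NH_module b n) = nh_grading n"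
  by (simp_all add: NH_module_def NH_left_def NH_right_def)

lemma smult_NH_module:
  assumes "p \<in> FA n"
  shows "r \<odot>\<^bsub>NH_module b n\<^esub> nh_class n p = nh_class n (side_mult b (lift n r) p)"
  using assms by (simp add: NH_module_def NH_left_def NH_right_def nh_of_poly_lift nh_class_mult side_mult_def)

lemma NH_module_abelian_group: "abelian_group (NH_module b n)"
proof -
  interpret NH: ring "NH n" by (rule NH_ring)
  show ?thesis
    by (rule abelian_groupI) (auto simp: NH.a_ac intro: NH.l_neg bexI[of _ "\<ominus>\<^bsub>NH n\<^esub> x" for x])
qed

lemma NH_module_carrierE:
  assumes "m \<in> carrier (NH_module b n)"
  obtains p where "p \<in> FA n" "m = nh_class n p"
  using assms by (auto simp: carrier_NH)

lemma a_inv_NH_module: "p \<in> FA n \<Longrightarrow> \<ominus>\<^bsub>NH_module b n\<^esub> nh_class n p = nh_class n (- p)"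
proof -
  assume p: "p \<in> FA n"
  interpret M: abelian_group "NH_module b n" by (rule NH_module_abelian_group)
  show ?thesis
    using p by (intro M.minus_equality) (simp_all add: nh_class_add nh_class_zero)
qed

lemma a_minus_NH_module:
  "p \<in> FA n \<Longrightarrow> q \<in> FA n \<Longrightarrow> nh_class n p \<ominus>\<^bsub>NH_module b n\<^esub> nh_class n q = nh_class n (p - q)"
  by (simp add: a_minus_def a_inv_NH_module nh_class_add)

lemma add_pow_NH_module_2:
  assumes p: "p \<in> FA n"
  shows "[(2::int)] \<cdot>\<^bsub>NH_module b n\<^esub> nh_class n p = nh_class n (2 * p)"
    and "[(-2::int)] \<cdot>\<^bsub>NH_module b n\<^esub> nh_class n p = nh_class n (- (2 * p))"
proof -
  interpret M: abelian_group "NH_module b n" by (rule NH_module_abelian_group)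
  have "[(2::nat)] \<cdot>\<^bsub>NH_module b n\<^esub> nh_class n p = nh_class n (p + p)"
    using p by (simp add: numeral_2_eq_2 nh_class_add nh_class_zero)
  then have nat: "[(2::nat)] \<cdot>\<^bsub>NH_module b n\<^esub> nh_class n p = nh_class n (2 * p)"
    by (simp add: mult_2)
  show two: "[(2::int)] \<cdot>\<^bsub>NH_module b n\<^esub> nh_class n p = nh_class n (2 * p)"
    using nat p by (simp add: add_pow_def int_pow_def nat_pow_def)
  show "[(-2::int)] \<cdot>\<^bsub>NH_module b n\<^esub> nh_class n p = nh_class n (- (2 * p))"
    using M.add.int_pow_neg[of "nh_class n p" 2] p by (simp add: two a_inv_NH_module)
qed

lemma finsum_NH_module:
  assumes "finite I" "\<And>i. i \<in> I \<Longrightarrow> q i \<in> FA n"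
  shows "(\<Oplus>\<^bsub>NH_module b n\<^esub>i\<in>I. nh_class n (q i)) = nh_class n (\<Sum>i\<in>I. q i)"
proof -
  interpret M: abelian_group "NH_module b n" by (rule NH_module_abelian_group)
  show ?thesis
    using assms
  proof (induction I rule: finite_induct)
    case (insert i I)
    have "(\<Oplus>\<^bsub>NH_module b n\<^esub>j\<in>insert i I. nh_class n (q j)) =
        nh_class n (q i) \<oplus>\<^bsub>NH_module b n\<^esub> (\<Oplus>\<^bsub>NH_module b n\<^esub>j\<in>I. nh_class n (q j))"
      using insert by (intro M.finsum_insert) auto
    then show ?case using insert by (simp add: nh_class_add FA_sum)
  qed (simp add: nh_class_zero)
qed

lemma nh_class_cong: "nh_eq n p q \<Longrightarrow> nh_class n p = nh_class n q"
  by (simp add: nh_class_eq_iff)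

lemma NH_module_module: "module (poly_ring n) (NH_module b n)"
proof (rule moduleI[OF poly_ring_cring NH_module_abelian_group])
  fix r s m assume r: "r \<in> PR n" and s: "s \<in> PR n" and m: "m \<in> carrier (NH_module b n)"
  obtain p where p: "p \<in> FA n" "m = nh_class n p" using NH_module_carrierE[OF m] .
  show "r \<odot>\<^bsub>NH_module b n\<^esub> m \<in> carrier (NH_module b n)"
    using p by (simp add: smult_NH_module)
  show "(r \<oplus>\<^bsub>poly_ring n\<^esub> s) \<odot>\<^bsub>NH_module b n\<^esub> m
      = r \<odot>\<^bsub>NH_module b n\<^esub> m \<oplus>\<^bsub>NH_module b n\<^esub> s \<odot>\<^bsub>NH_module b n\<^esub> m"
    using p by (simp add: smult_NH_module nh_class_add lift_add side_mult_simps)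
  have "nh_eq n (side_mult b (lift n (r * s)) p) (side_mult b (lift n r) (side_mult b (lift n s) p))"
    using nh_eq_side_mult_right[OF p(1) lift_side_mult[of n r s b], where b = b] by (simp add: side_mult_assoc)
  then show "(r \<otimes>\<^bsub>poly_ring n\<^esub> s) \<odot>\<^bsub>NH_module b n\<^esub> m
      = r \<odot>\<^bsub>NH_module b n\<^esub> (s \<odot>\<^bsub>NH_module b n\<^esub> m)"
    using p by (simp add: smult_NH_module nh_class_eq_iff)
next
  fix r m m' assume r: "r \<in> PR n" and m: "m \<in> carrier (NH_module b n)" "m' \<in> carrier (NH_module b n)"
  obtain p q where "p \<in> FA n" "m = nh_class n p" "q \<in> FA n" "m' = nh_class n q"
    using NH_module_carrierE[OF m(1)] NH_module_carrierE[OF m(2)] by metis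
  then show "r \<odot>\<^bsub>NH_module b n\<^esub> (m \<oplus>\<^bsub>NH_module b n\<^esub> m')
      = r \<odot>\<^bsub>NH_module b n\<^esub> m \<oplus>\<^bsub>NH_module b n\<^esub> r \<odot>\<^bsub>NH_module b n\<^esub> m'"
    by (simp add: smult_NH_module nh_class_add side_mult_simps)
next
  fix m assume "m \<in> carrier (NH_module b n)"
  then obtain p where "p \<in> FA n" "m = nh_class n p" by (rule NH_module_carrierE)
  then show "\<one>\<^bsub>poly_ring n\<^esub> \<odot>\<^bsub>NH_module b n\<^esub> m = m"
    by (simp add: smult_NH_module side_mult_simps)
qed

text \<open>
  The components of a class are the classes of the components of a representative. They are well
  defined because the ideal contains the components of its elements.
\<close>

lemma NH_module_grading_decomp: "direct_sum_decomp (NH_module b n) UNIV (nh_grading n)"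
  unfolding direct_sum_decomp_def
proof
  fix m assume "m \<in> carrier (NH_module b n)"
  then obtain p where p: "p \<in> FA n" "m = nh_class n p" by (rule NH_module_carrierE)
  let ?f = "\<lambda>k. nh_class n (free_component k p)"
  let ?P = "\<lambda>f. f \<in> (\<Pi>\<^sub>E i\<in>UNIV. nh_grading n i) \<and> finite {i \<in> UNIV. f i \<noteq> \<zero>\<^bsub>NH_module b n\<^esub>} \<and>
      m = (\<Oplus>\<^bsub>NH_module b n\<^esub>i\<in>{i \<in> UNIV. f i \<noteq> \<zero>\<^bsub>NH_module b n\<^esub>}. f i)"
  show "\<exists>!f. ?P f"
  proof (rule ex1I[of ?P ?f])
    let ?K = "word_degree ` Poly_Mapping.keys p"
    let ?F = "{i \<in> UNIV. ?f i \<noteq> \<zero>\<^bsub>NH_module b n\<^esub>}"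
    have sub: "?F \<subseteq> ?K"
      using free_component_outside[of _ p] by (auto simp: nh_class_zero)
    have fin: "finite ?F" using sub by (rule finite_subset) simp
    have "(\<Oplus>\<^bsub>NH_module b n\<^esub>i\<in>?F. ?f i) = nh_class n (\<Sum>i\<in>?F. free_component i p)"
      using fin p by (intro finsum_NH_module free_component_FA)
    also have "\<dots> = nh_class n (\<Sum>i\<in>?K. free_component i p)"
    proof (rule nh_class_cong)
      have "(\<Sum>i\<in>?K. free_component i p) - (\<Sum>i\<in>?F. free_component i p) = (\<Sum>i\<in>?K - ?F. free_component i p)"
        using sub by (simp add: sum_diff)
      moreover have "(\<Sum>i\<in>?K - ?F. free_component i p) \<in> nh_ideal n"
        by (intro nh_ideal_sum) (auto simp: nh_class_zero nh_class_eq_iff nh_eq_0_iff)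
      ultimately show "nh_eq n (\<Sum>i\<in>?F. free_component i p) (\<Sum>i\<in>?K. free_component i p)"
        using nh_eq_sym[of n "sum (\<lambda>i. free_component i p) ?K"] by (simp add: nh_eq_def)
    qed
    also have "\<dots> = m" using p by (simp add: sum_free_component)
    finally show "?P ?f"
      using fin p by (auto simp: nh_grading_def' homogeneous_free_component free_component_FA)
  next
    fix f assume f: "?P f"
    let ?F = "{i \<in> UNIV. f i \<noteq> \<zero>\<^bsub>NH_module b n\<^esub>}"
    have "\<forall>k. \<exists>q. q \<in> FA n \<and> free_homogeneous k q \<and> f k = nh_class n q"
      using f by (auto simp: nh_grading_def' PiE_def Pi_def)
    then obtain q where q: "\<And>k. q k \<in> FA n" "\<And>k. free_homogeneous k (q k)" "\<And>k. f k = nh_class n (q k)"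
      by metis
    have fin: "finite ?F" using f by blast
    have "m = (\<Oplus>\<^bsub>NH_module b n\<^esub>i\<in>?F. nh_class n (q i))" using f q(3) by simp
    also have "\<dots> = nh_class n (\<Sum>i\<in>?F. q i)" using fin q by (intro finsum_NH_module)
    finally have eq: "p - (\<Sum>i\<in>?F. q i) \<in> nh_ideal n"
      using p by (simp add: nh_class_eq_iff nh_eq_def)
    show "f = ?f"
    proof
      fix k
      have "free_component k (\<Sum>i\<in>?F. q i) = (\<Sum>i\<in>?F. if i = k then q i else 0)"
        by (simp add: free_component_sum free_component_homogeneous[OF q(2)])
      also have "\<dots> = (if k \<in> ?F then q k else 0)" using fin by simp
      finally have "nh_eq n (free_component k p) (if k \<in> ?F then q k else 0)"
        using free_component_nh_ideal[OF eq, of k] by (simp add: nh_eq_def free_component_diff)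
      then have "?f k = nh_class n (if k \<in> ?F then q k else 0)" by (rule nh_class_cong)
      also have "\<dots> = f k" using q(3) by (auto simp: nh_class_zero)
      finally show "f k = ?f k" ..
    qed
  qed
qed

text \<open>
  Each axiom is checked on representatives in the free algebra. The Leibniz rules rest on the fact that
  the derivations restrict to the standard ones on polynomials.
\<close>

lemma NH_module_graded_sl2_module: "graded_sl2_module n (NH_module b n)"
proof -
  interpret M: abelian_group "NH_module b n" by (rule NH_module_abelian_group)
  let ?M = "NH_module b n"
  note T = derivation_free_der derivation_free_h
  note FA = free_d_FA free_z_FA free_h_FA
  show ?thesis
  proof (intro graded_sl2_module.intro graded_sl2_module_axioms.intro NH_module_module)
    fix k
    have sub: "nh_grading n k \<subseteq> carrier ?M"
      by (auto simp: nh_grading_def')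
    show "subgroup (grading ?M k) (add_monoid ?M)"
    proof (rule M.add.subgroupI)
      show "grading ?M k \<subseteq> carrier ?M" using sub by simp
      have "nh_class n 0 \<in> nh_grading n k" by (auto simp: nh_grading_def')
      then show "grading ?M k \<noteq> {}" by auto
      show "\<ominus>\<^bsub>?M\<^esub> m \<in> grading ?M k" if "m \<in> grading ?M k" for m
        using that by (auto simp: nh_grading_def' a_inv_NH_module intro!: imageI free_homogeneous_uminus)
      show "m \<oplus>\<^bsub>?M\<^esub> m' \<in> grading ?M k" if "m \<in> grading ?M k" "m' \<in> grading ?M k" for m m'
        using that by (auto simp: nh_grading_def' nh_class_add intro!: imageI free_homogeneous_add)
    qed
  next
    show "direct_sum_decomp ?M UNIV (grading ?M)"
      using NH_module_grading_decomp by simp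
  next
    fix r j m k assume r: "r \<in> poly_grading n j" and m: "m \<in> grading ?M k"
    then obtain p where p: "p \<in> FA n" "free_homogeneous k p" "m = nh_class n p"
      by (auto simp: nh_grading_def')
    have "free_homogeneous (j + k) (side_mult b (lift n r) p)"
      using lift_homogeneous[OF r] p(2) unfolding side_mult_def
      by (auto intro: free_homogeneous_mult)
    then show "r \<odot>\<^bsub>?M\<^esub> m \<in> grading ?M (j + k)"
      using p by (auto simp: nh_grading_def' smult_NH_module)
  next
    show "act_d ?M \<in> hom (add_monoid ?M) (add_monoid ?M)"
      by (rule homI) (auto simp: carrier_NH nh_d_class nh_class_add FA derivation_add[OF T(1)])
    show "act_h ?M \<in> hom (add_monoid ?M) (add_monoid ?M)"
      by (rule homI) (auto simp: carrier_NH nh_h_class nh_class_add FA derivation_add[OF T(2)])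
    show "act_z ?M \<in> hom (add_monoid ?M) (add_monoid ?M)"
      by (rule homI) (auto simp: carrier_NH nh_z_class nh_class_add FA derivation_add[OF T(1)])
  next
    fix m assume "m \<in> carrier ?M"
    then obtain p where p: "p \<in> FA n" "m = nh_class n p" by (rule NH_module_carrierE)
    show "act_h ?M (act_d ?M m) \<ominus>\<^bsub>?M\<^esub> act_d ?M (act_h ?M m) = [(2::int)] \<cdot>\<^bsub>?M\<^esub> act_d ?M m"
      using p by (simp add: nh_d_class nh_h_class a_minus_NH_module add_pow_NH_module_2 FA commutator_hd)
    show "act_h ?M (act_z ?M m) \<ominus>\<^bsub>?M\<^esub> act_z ?M (act_h ?M m) = [(-2::int)] \<cdot>\<^bsub>?M\<^esub> act_z ?M m"
      using p by (simp add: nh_z_class nh_h_class a_minus_NH_module add_pow_NH_module_2 FA commutator_hz)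
    show "act_z ?M (act_d ?M m) \<ominus>\<^bsub>?M\<^esub> act_d ?M (act_z ?M m) = act_h ?M m"
      using p by (simp add: nh_z_class nh_d_class nh_h_class a_minus_NH_module FA commutator_zd)
  next
    fix r m assume r: "r \<in> PR n" and m: "m \<in> carrier ?M"
    obtain p where p: "p \<in> FA n" "m = nh_class n p" using NH_module_carrierE[OF m] .
    have leibniz: "nh_class n (T (side_mult b (lift n r) p)) =
        nh_class n (side_mult b (lift n r') p) \<oplus>\<^bsub>?M\<^esub> nh_class n (side_mult b (lift n r) (T p))"
      if "derivation T" "T p \<in> FA n" "nh_eq n (T (lift n r)) (lift n r')" for T r'
      using p that nh_eq_side_mult_right[OF p(1) that(3), of b]
      by (auto simp: nh_class_add nh_class_eq_iff derivation_side_mult intro: nh_eq_add)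
    show "act_d ?M (r \<odot>\<^bsub>?M\<^esub> m) = poly_d n r \<odot>\<^bsub>?M\<^esub> m \<oplus>\<^bsub>?M\<^esub> r \<odot>\<^bsub>?M\<^esub> act_d ?M m"
      using leibniz[OF T(1) _ lift_poly_d[OF r]] p by (simp add: smult_NH_module nh_d_class FA)
    show "act_h ?M (r \<odot>\<^bsub>?M\<^esub> m) = poly_h r \<odot>\<^bsub>?M\<^esub> m \<oplus>\<^bsub>?M\<^esub> r \<odot>\<^bsub>?M\<^esub> act_h ?M m"
      using leibniz[OF T(2) _ lift_poly_h[OF r]] p by (simp add: smult_NH_module nh_h_class FA)
    show "act_z ?M (r \<odot>\<^bsub>?M\<^esub> m) = poly_z n r \<odot>\<^bsub>?M\<^esub> m \<oplus>\<^bsub>?M\<^esub> r \<odot>\<^bsub>?M\<^esub> act_z ?M m"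
      using leibniz[OF T(1) _ lift_poly_z[OF r]] p by (simp add: smult_NH_module nh_z_class FA)
  qed
qed

section \<open>The nilCoxeter basis is downfree\<close>

lemma nh_psi_class: "nh_psi n w = nh_class n (psi n w)"
  by (simp add: nh_psi_def psi_def)

lemma smult_nh_psi:
  "w \<in> symm_group n \<Longrightarrow> r \<odot>\<^bsub>NH_module b n\<^esub> nh_psi n w = nh_class n (side_mult b (lift n r) (psi n w))"
  by (simp add: nh_psi_class smult_NH_module psi_FA)

lemma finsum_nh_psi:
  assumes "W \<subseteq> symm_group n"
  shows "(\<Oplus>\<^bsub>NH_module b n\<^esub>w\<in>W. c w \<odot>\<^bsub>NH_module b n\<^esub> nh_psi n w) =
    nh_class n (\<Sum>w\<in>W. side_mult b (lift n (c w)) (psi n w))"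
proof -
  interpret M: abelian_group "NH_module b n" by (rule NH_module_abelian_group)
  have "(\<Oplus>\<^bsub>NH_module b n\<^esub>w\<in>W. c w \<odot>\<^bsub>NH_module b n\<^esub> nh_psi n w) =
      (\<Oplus>\<^bsub>NH_module b n\<^esub>w\<in>W. nh_class n (side_mult b (lift n (c w)) (psi n w)))"
    using assms by (intro M.finsum_cong') (auto simp: smult_nh_psi psi_FA)
  also have "\<dots> = nh_class n (\<Sum>w\<in>W. side_mult b (lift n (c w)) (psi n w))"
    using assms finite_subset[OF assms finite_symm_group]
    by (intro finsum_NH_module) (auto simp: psi_FA)
  finally show ?thesis .
qed

lemma nh_psi_coefficients_unique:
  assumes c: "\<And>w. w \<in> symm_group n \<Longrightarrow> c w \<in> PR n" and d: "\<And>w. w \<in> symm_group n \<Longrightarrow> d w \<in> PR n"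
    and eq: "nh_class n (\<Sum>w\<in>symm_group n. side_mult b (lift n (c w)) (psi n w)) =
      nh_class n (\<Sum>w\<in>symm_group n. side_mult b (lift n (d w)) (psi n w))"
    and w: "w \<in> symm_group n"
  shows "c w = d w"
proof -
  have "(\<Sum>w\<in>symm_group n. side_mult b (lift n (c w - d w)) (psi n w)) \<in> nh_ideal n"
    using eq by (simp add: nh_class_eq_iff nh_eq_def lift_diff side_mult_simps sum_subtractf)
  from psi_independent[OF _ this w] c d show ?thesis by simp
qed

lemma psi_homogeneous: "w \<in> symm_group n \<Longrightarrow> \<exists>k. free_homogeneous k (psi n w)"
  by (metis psi_some free_homogeneous_word)

lemma homogeneous_nh_psi: "w \<in> symm_group n \<Longrightarrow> homogeneous (NH_module b n) (nh_psi n w)"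
  using psi_homogeneous psi_FA by (fastforce simp: homogeneous_def nh_grading_def' nh_psi_class)

lemma ex_nh_psi_coefficients:
  assumes "m \<in> carrier (NH_module b n)"
  obtains c where "c \<in> (\<Pi>\<^sub>E w\<in>symm_group n. PR n)"
    "m = nh_class n (\<Sum>w\<in>symm_group n. side_mult b (lift n (c w)) (psi n w))"
proof -
  obtain p where p: "p \<in> FA n" "m = nh_class n p" using NH_module_carrierE[OF assms] .
  then obtain c where c: "\<forall>w\<in>symm_group n. c w \<in> PR n"
    "nh_eq n p (\<Sum>w\<in>symm_group n. side_mult b (lift n (c w)) (psi n w))"
    using psi_span_top[of p n b] by (auto simp: psi_span_def)
  show thesis
    by (rule that[of "restrict c (symm_group n)"]) (use p c in \<open>auto simp: nh_class_eq_iff\<close>)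
qed

lemma homogeneous_basis_nh_psi: "homogeneous_basis n (NH_module b n) (symm_group n) (nh_psi n)"
  unfolding homogeneous_basis_def
proof (intro conjI ballI)
  show "finite (symm_group n)" by simp
  show "nh_psi n w \<in> carrier (NH_module b n)" if "w \<in> symm_group n" for w
    using that by (simp add: nh_psi_class psi_FA)
  show "homogeneous (NH_module b n) (nh_psi n w)" if "w \<in> symm_group n" for w
    using that by (rule homogeneous_nh_psi)
  fix m assume m: "m \<in> carrier (NH_module b n)"
  obtain c where c: "c \<in> (\<Pi>\<^sub>E w\<in>symm_group n. PR n)"
    "m = nh_class n (\<Sum>w\<in>symm_group n. side_mult b (lift n (c w)) (psi n w))"
    using ex_nh_psi_coefficients[OF m] .
  show "\<exists>!c. c \<in> (\<Pi>\<^sub>E w\<in>symm_group n. PR n) \<and>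
      m = (\<Oplus>\<^bsub>NH_module b n\<^esub>w\<in>symm_group n. c w \<odot>\<^bsub>NH_module b n\<^esub> nh_psi n w)"
    unfolding finsum_nh_psi[OF order_refl]
  proof (rule ex1I[of _ c])
    fix d assume d: "d \<in> (\<Pi>\<^sub>E w\<in>symm_group n. PR n) \<and>
      m = nh_class n (\<Sum>w\<in>symm_group n. side_mult b (lift n (d w)) (psi n w))"
    show "d = c"
    proof (rule PiE_ext)
      show "d w = c w" if "w \<in> symm_group n" for w
        by (rule nh_psi_coefficients_unique[OF _ _ _ that]) (use c d in auto)
    qed (use c d in auto)
  qed (use c in auto)
qed

text \<open>
  The components of an element are the multiples of the basis elements in its expansion. In the
  definition of a decomposition the sum extends over the nonzero components only, which does not change
  its value.
\<close>

lemma nh_psi_splitting: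
  "direct_sum_decomp (NH_module b n) (symm_group n) (\<lambda>w. rank_one_span n (NH_module b n) (nh_psi n w))"
  unfolding direct_sum_decomp_def
proof
  interpret M: abelian_group "NH_module b n" by (rule NH_module_abelian_group)
  fix m assume m: "m \<in> carrier (NH_module b n)"
  let ?N = "\<lambda>w. rank_one_span n (NH_module b n) (nh_psi n w)"
  let ?P = "\<lambda>f. f \<in> (\<Pi>\<^sub>E w\<in>symm_group n. ?N w) \<and>
      finite {w \<in> symm_group n. f w \<noteq> \<zero>\<^bsub>NH_module b n\<^esub>} \<and>
      m = (\<Oplus>\<^bsub>NH_module b n\<^esub>w\<in>{w \<in> symm_group n. f w \<noteq> \<zero>\<^bsub>NH_module b n\<^esub>}. f w)"
  have support: "(\<Oplus>\<^bsub>NH_module b n\<^esub>w\<in>{w \<in> symm_group n. f w \<noteq> \<zero>\<^bsub>NH_module b n\<^esub>}. f w) =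
      nh_class n (\<Sum>w\<in>symm_group n. side_mult b (lift n (c w)) (psi n w))"
    if "\<And>w. w \<in> symm_group n \<Longrightarrow> f w = nh_class n (side_mult b (lift n (c w)) (psi n w))" for f c
  proof -
    have "(\<Oplus>\<^bsub>NH_module b n\<^esub>w\<in>{w \<in> symm_group n. f w \<noteq> \<zero>\<^bsub>NH_module b n\<^esub>}. f w) =
        (\<Oplus>\<^bsub>NH_module b n\<^esub>w\<in>symm_group n. f w)"
      using that by (intro M.add.finprod_mono_neutral_cong_left) (auto simp: psi_FA)
    also have "\<dots> = (\<Oplus>\<^bsub>NH_module b n\<^esub>w\<in>symm_group n. nh_class n (side_mult b (lift n (c w)) (psi n w)))"
      using that by (intro M.finsum_cong') (auto simp: psi_FA)
    also have "\<dots> = nh_class n (\<Sum>w\<in>symm_group n. side_mult b (lift n (c w)) (psi n w))"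
      by (intro finsum_NH_module) (auto simp: psi_FA)
    finally show ?thesis .
  qed
  obtain c where c: "c \<in> (\<Pi>\<^sub>E w\<in>symm_group n. PR n)"
    "m = nh_class n (\<Sum>w\<in>symm_group n. side_mult b (lift n (c w)) (psi n w))"
    using ex_nh_psi_coefficients[OF m] .
  let ?f = "\<lambda>w\<in>symm_group n. c w \<odot>\<^bsub>NH_module b n\<^esub> nh_psi n w"
  show "\<exists>!f. ?P f"
  proof (rule ex1I[of ?P ?f])
    have "?f \<in> (\<Pi>\<^sub>E w\<in>symm_group n. ?N w)"
      using c(1) by (auto simp: rank_one_span_def)
    then show "?P ?f"
      using c(2) support[of ?f c] by (simp add: smult_nh_psi)
  next
    fix f assume f: "?P f"
    have "\<forall>w\<in>symm_group n. \<exists>r. r \<in> PR n \<and> f w = r \<odot>\<^bsub>NH_module b n\<^esub> nh_psi n w"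
      using f by (auto simp: rank_one_span_def PiE_def Pi_def)
    then obtain d where d: "\<And>w. w \<in> symm_group n \<Longrightarrow> d w \<in> PR n \<and> f w = d w \<odot>\<^bsub>NH_module b n\<^esub> nh_psi n w"
      by metis
    then have fd: "f w = nh_class n (side_mult b (lift n (d w)) (psi n w))" if "w \<in> symm_group n" for w
      using that by (simp add: smult_nh_psi)
    have "m = nh_class n (\<Sum>w\<in>symm_group n. side_mult b (lift n (d w)) (psi n w))"
      using f support[of f d, OF fd] by auto
    then have "d w = c w" if "w \<in> symm_group n" for w
      using c d by (intro nh_psi_coefficients_unique[OF _ _ _ that]) auto
    then have "f w = ?f w" if "w \<in> symm_group n" for w using d[OF that] that by simp
    moreover have "f \<in> extensional (symm_group n)" using f by (simp add: PiE_def)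
    ultimately show "f = ?f" by (intro extensionalityI[of f "symm_group n"]) auto
  qed
qed

lemma graded_free_rank_one_nh_psi:
  assumes w: "w \<in> symm_group n"
  shows "graded_free_rank_one n (NH_module b n) (rank_one_span n (NH_module b n) (nh_psi n w))"
  unfolding graded_free_rank_one_def
proof (intro bexI[of _ "nh_psi n w"] conjI homogeneous_nh_psi[OF w] refl inj_onI)
  show "nh_psi n w \<in> carrier (NH_module b n)" using w by (simp add: nh_psi_class psi_FA)
  fix r s assume rs: "r \<in> PR n" "s \<in> PR n"
    and eq: "r \<odot>\<^bsub>NH_module b n\<^esub> nh_psi n w = s \<odot>\<^bsub>NH_module b n\<^esub> nh_psi n w"
  have single: "(\<Sum>v\<in>symm_group n. side_mult b (lift n (if v = w then t else 0)) (psi n v)) = side_mult b (lift n t) (psi n w)" for t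
  proof -
    have "(\<Sum>v\<in>symm_group n. side_mult b (lift n (if v = w then t else 0)) (psi n v)) =
        (\<Sum>v\<in>symm_group n. if v = w then side_mult b (lift n t) (psi n v) else 0)"
      by (intro sum.cong) (auto simp: side_mult_simps)
    then show ?thesis using w by simp
  qed
  have "(if w = w then r else 0) = (if w = w then s else 0)"
  proof (rule nh_psi_coefficients_unique[where b = b and c = "\<lambda>v. if v = w then r else 0"
        and d = "\<lambda>v. if v = w then s else 0"])
    show "nh_class n (\<Sum>v\<in>symm_group n. side_mult b (lift n (if v = w then r else 0)) (psi n v)) =
        nh_class n (\<Sum>v\<in>symm_group n. side_mult b (lift n (if v = w then s else 0)) (psi n v))"
      using eq by (simp only: single smult_nh_psi[OF w])
  qed (use rs w in simp_all)
  then show "r = s" by simp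
qed

lemma free_z_psi:
  assumes "w \<in> symm_group n"
  shows "free_der z_gen (psi n w) = 0"
proof -
  have "word_der z_gen (map D ks) = 0" for ks by (induction ks) simp_all
  then show ?thesis using psi_some[OF assms] by (metis free_der_word)
qed

text \<open>
  Since \<open>z\<close> is zero on \<open>\<psi> w\<close>, it acts on the coefficient only.
\<close>

lemma nh_z_preserves_span:
  assumes w: "w \<in> symm_group n" and m: "m \<in> rank_one_span n (NH_module b n) (nh_psi n w)"
  shows "nh_z n m \<in> rank_one_span n (NH_module b n) (nh_psi n w)"
proof -
  obtain r where r: "r \<in> PR n" "m = nh_class n (side_mult b (lift n r) (psi n w))"
    using m w by (auto simp: rank_one_span_def smult_nh_psi)
  have "nh_z n m = nh_class n (side_mult b (free_der z_gen (lift n r)) (psi n w))"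
    by (simp add: r nh_z_class derivation_side_mult[OF derivation_free_der] free_z_psi[OF w] side_mult_simps)
  also have "\<dots> = nh_class n (side_mult b (lift n (poly_z n r)) (psi n w))"
    by (intro nh_class_cong nh_eq_side_mult_right psi_FA[OF w] lift_poly_z r)
  also have "\<dots> = poly_z n r \<odot>\<^bsub>NH_module b n\<^esub> nh_psi n w" by (simp add: smult_nh_psi[OF w])
  finally show ?thesis using PR_poly_z[OF r(1)] by (auto simp: rank_one_span_def)
qed

text \<open>
  By the Leibniz rule, \<open>d (r * \<psi> w)\<close> is a multiple of \<open>\<psi> w\<close> plus \<open>r\<close> times \<open>d (\<psi> w)\<close>.
\<close>

lemma nh_d_lowers_span:
  assumes w: "w \<in> symm_group n" and m: "m \<in> rank_one_span n (NH_module b n) (nh_psi n w)"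
  shows "nh_d n m \<in> sum_of_family (NH_module b n) {v \<in> symm_group n. (v, w) \<in> bruhat n}
    (\<lambda>v. rank_one_span n (NH_module b n) (nh_psi n v))"
proof -
  have W_eq: "{v \<in> symm_group n. (v, w) \<in> bruhat n} = {v. (v, w) \<in> bruhat n}"
    using bruhat_symm_group by blast
  let ?W = "{v. (v, w) \<in> bruhat n}"
  have W: "?W \<subseteq> symm_group n" "w \<in> ?W" using bruhat_symm_group bruhat_refl[OF w] by auto
  obtain r where r: "r \<in> PR n" "m = nh_class n (side_mult b (lift n r) (psi n w))"
    using m w by (auto simp: rank_one_span_def smult_nh_psi)
  have "free_der d_gen (side_mult b (lift n r) (psi n w)) =
      side_mult b (free_der d_gen (lift n r)) (psi n w) + side_mult b (lift n r) (free_der d_gen (psi n w))"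
    by (rule derivation_side_mult[OF derivation_free_der])
  also have "\<dots> \<in> psi_span b n ?W"
  proof (rule psi_span_add)
    show "side_mult b (free_der d_gen (lift n r)) (psi n w) \<in> psi_span b n ?W"
      by (rule psi_span_nh_eq[OF nh_eq_side_mult_right[OF psi_FA[OF w] lift_poly_d[OF r(1)]]
            psi_span_lift[OF W(1) PR_poly_d[OF r(1)] psi_span_psi[OF W]]])
    show "side_mult b (lift n r) (free_der d_gen (psi n w)) \<in> psi_span b n ?W"
      by (rule psi_span_lift[OF W(1) r(1) free_d_psi[OF w]])
  qed
  finally obtain c where c: "\<forall>v\<in>?W. c v \<in> PR n"
    "nh_eq n (free_der d_gen (side_mult b (lift n r) (psi n w))) (\<Sum>v\<in>?W. side_mult b (lift n (c v)) (psi n v))"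
    by (auto simp: psi_span_def)
  have "nh_d n m = nh_class n (\<Sum>v\<in>?W. side_mult b (lift n (c v)) (psi n v))"
    using c(2) by (simp add: r(2) nh_d_class nh_class_eq_iff)
  also have "\<dots> = (\<Oplus>\<^bsub>NH_module b n\<^esub>v\<in>?W. c v \<odot>\<^bsub>NH_module b n\<^esub> nh_psi n v)"
    by (rule finsum_nh_psi[OF W(1), symmetric])
  finally show ?thesis
    unfolding W_eq sum_of_family_def using c(1)
    by (intro CollectI exI[of _ "\<lambda>v. c v \<odot>\<^bsub>NH_module b n\<^esub> nh_psi n v"] conjI)
       (auto simp: rank_one_span_def)
qed

lemma downfree_basis_nh_psi: "downfree_basis n (NH_module b n) (symm_group n) (nh_psi n) (bruhat n)"
  unfolding downfree_basis_def
proof (intro conjI homogeneous_basis_nh_psi)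
  interpret graded_sl2_module n "NH_module b n" by (rule NH_module_graded_sl2_module)
  show "downfree_filtration_wrt n (NH_module b n) (symm_group n)
      (\<lambda>w. rank_one_span n (NH_module b n) (nh_psi n w)) (bruhat n)"
    by unfold_locales
       (use graded_free_rank_one_nh_psi nh_psi_splitting partial_order_on_bruhat nh_z_preserves_span
         nh_d_lowers_span in auto)
qed

theorem theorem1p20:
  fixes n :: nat
  assumes "n \<ge> 1"
  shows "downfree_basis n (NH_left n) (symm_group n) (nh_psi n) (bruhat n) \<and>
         downfree_basis n (NH_right n) (symm_group n) (nh_psi n) (bruhat n)"
  using downfree_basis_nh_psi[of n True] downfree_basis_nh_psi[of n False]
  by (simp add: NH_module_def)

end
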